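(* Let $p\ge3$ be a fixed integer, $h=0$, and $0<\beta<\beta_f$. Put $\ell_p=3$ if $p$ is even and $\ell_p=4$ if $p$ is odd. Then $$N^{\frac14\ell_p(p-2)}\log\hat Z_N(\beta,0)\to \mathrm N(0,v_p(\beta)^2)\quad\text{in distribution as }N\to\infty,$$ where, with $\eta\sim \mathrm N(0,1)$, $$v_p(\beta)^2=\begin{cases}\dfrac{\beta^6}{3!\,p!^{3/2}}\,\mathbb E\,H_3\big(H_p(\eta)/\sqrt{p!}\big)=\dfrac{\beta^6}{3!\,p!^3}\,\mathbb E\big(H_p(\eta)^3\big), & p\text{ even},\\[2mm] \dfrac{\beta^8}{4!\,p!^2}\,\mathbb E\,H_4\big(H_p(\eta)/\sqrt{p!}\big)=\dfrac{\beta^8}{4!\,p!^4}\,\mathbb E\big(H_p(\eta)^4-3\,p!^2\big), & p\text{ odd}.\end{cases}$$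
   Context: Pure $p$-spin model. $\mathcal E_{N,p}$ is the set of $p$-tuples $\boldsymbol i=(i_1,\dots,i_p)$ with $1\le i_1<\cdots<i_p\le N$; for $\sigma\in\{-1,+1\}^N$, $\sigma_{\boldsymbol i}=\prod_{j=1}^p\sigma_{i_j}$. The variables $(J_{\boldsymbol i})_{\boldsymbol i\in\mathcal E_{N,p}}$ are i.i.d., symmetrically distributed with mean zero, variance one and finite fourth moment. Define $$\hat Z_N(\beta,0)=\mathbb E_0\prod_{\boldsymbol i\in\mathcal E_{N,p}}\big(1+\sigma_{\boldsymbol i}\tanh(\beta J_{\boldsymbol i}/N^{(p-1)/2})\big),$$ where under $\mathbb E_0$ the $\sigma_i$ are i.i.d. uniform on $\{-1,+1\}$, independent of $J$. Equivalently $\hat Z_N(\beta,0)=2^{-N}Z_N(\beta,0)/\prod_{\boldsymbol i}\cosh(\beta J_{\boldsymbol i}/N^{(p-1)/2})$ with $Z_N(\beta,0)=\sum_\sigma\exp\big(\beta N^{-(p-1)/2}\sum_{\boldsymbol i}J_{\boldsymbol i}\sigma_{\boldsymbol i}\big)$. $\beta_f=\inf_{x\in(0,1)}\sqrt{p!\,I(x)/x^p}$ with $I(x)=\frac12(1+x)\log(1+x)+\frac12(1-x)\log(1-x)$. $H_k$ denotes the (probabilists', monic) Hermite polynomial of degree $k$, e.g. $H_2(x)=x^2-1$. *)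

theory Defs
  imports "HOL-Probability.Probability"
begin

text \<open>
  The probabilists' (monic) Hermite polynomials, as functions, by their three-term recurrence
  \<open>H\<^sub>k\<^sub>+\<^sub>2(x) = x H\<^sub>k\<^sub>+\<^sub>1(x) - (k + 1) H\<^sub>k(x)\<close>.
\<close>
fun hermite :: "nat \<Rightarrow> real \<Rightarrow> real" where
  "hermite 0 x = 1"
| "hermite (Suc 0) x = x"
| "hermite (Suc (Suc k)) x = x * hermite (Suc k) x - real (Suc k) * hermite k x"

lemma hermite_2: "hermite 2 x = x\<^sup>2 - 1"
  by (simp add: numeral_2_eq_2 power2_eq_square)

text \<open>A tuple \<open>(i\<^sub>1, \<dots>, i\<^sub>p)\<close> is a list of length \<open>p\<close>; it is indexed from 0 by \<open>!\<close>.\<close>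
definition index_tuples :: "nat \<Rightarrow> nat \<Rightarrow> nat list set" where
  "index_tuples N p = {i. length i = p \<and> sorted_wrt (<) i \<and> set i \<subseteq> {1..N}}"

definition spin_prod :: "(nat \<Rightarrow> real) \<Rightarrow> nat list \<Rightarrow> real" where
  "spin_prod \<sigma> i = (\<Prod>j<length i. \<sigma> (i ! j))"

text \<open>
  The law of the spins under \<open>E\<^sub>0\<close>: \<open>\<sigma>\<^sub>1, \<dots>, \<sigma>\<^sub>N\<close> are i.i.d. uniform on \<open>{-1, 1}\<close>.
  Outside \<open>{1..N}\<close> the functions are given the irrelevant value 0.
\<close>
definition spin_pmf :: "nat \<Rightarrow> (nat \<Rightarrow> real) pmf" where
  "spin_pmf N = Pi_pmf {1..N} 0 (\<lambda>_. pmf_of_set {-1, 1})"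

text \<open>
  The normalised partition function without external field (\<open>h = 0\<close>), for a given realisation
  \<open>J\<close> of the couplings. For \<open>N < p\<close> the product is empty, so the value is 1.
\<close>
definition Z_hat :: "nat \<Rightarrow> nat \<Rightarrow> real \<Rightarrow> (nat list \<Rightarrow> real) \<Rightarrow> real" where
  "Z_hat p N \<beta> J =
     measure_pmf.expectation (spin_pmf N)
       (\<lambda>\<sigma>. \<Prod>i\<in>index_tuples N p.
          1 + spin_prod \<sigma> i * tanh (\<beta> * J i / real N powr ((real p - 1) / 2)))"

definition rate_I :: "real \<Rightarrow> real" where
  "rate_I x = (1 + x) * ln (1 + x) / 2 + (1 - x) * ln (1 - x) / 2"

definition beta_f :: "nat \<Rightarrow> real" where
  "beta_f p = (INF x\<in>{0<..<1}. sqrt (fact p * rate_I x / x ^ p))"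

definition ell :: "nat \<Rightarrow> nat" where
  "ell p = (if even p then 3 else 4)"

text \<open>The limiting variance \<open>v\<^sub>p(\<beta>)\<^sup>2\<close> (not its square root).\<close>
definition limit_variance :: "nat \<Rightarrow> real \<Rightarrow> real" where
  "limit_variance p \<beta> =
     (if even p then
        \<beta> ^ 6 / (fact 3 * fact p powr (3 / 2)) *
        (\<integral>\<eta>. hermite 3 (hermite p \<eta> / sqrt (fact p)) \<partial>std_normal_distribution)
      else
        \<beta> ^ 8 / (fact 4 * (fact p)\<^sup>2) *
        (\<integral>\<eta>. hermite 4 (hermite p \<eta> / sqrt (fact p)) \<partial>std_normal_distribution))"

end

theory Submission
  imports Defs
begin

text \<open>
  Expanding the product over the couplings and averaging over the spins turns the normalised
  partition function into a sum, over the even hypergraphs \<open>\<Gamma>\<close> on \<open>{1..N}\<close>, of the products of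
  \<open>t\<^sub>i = tanh (\<beta> J\<^sub>i / N\<^sup>(\<^sup>p\<^sup>-\<^sup>1\<^sup>)\<^sup>/\<^sup>2)\<close> over the edges \<open>i \<in> \<Gamma>\<close>; a set of \<open>p\<close>-tuples is even if every vertex has
  even degree (\<open>Z_hat_expansion\<close>). The \<open>t\<^sub>i\<close> are independent and centred, so different \<open>\<Gamma>\<close> give
  orthogonal terms and variances are read off by counting. An even hypergraph with \<open>m\<close> edges has at
  most \<open>m p / 2\<close> vertices, while \<open>E t\<^sub>i\<^sup>2\<close> is of order \<open>N\<^sup>1\<^sup>-\<^sup>p\<close>: heuristically the edge number \<open>m\<close>
  contributes variance \<open>N\<^sup>-\<^sup>m\<^sup>(\<^sup>p\<^sup>-\<^sup>2\<^sup>)\<^sup>/\<^sup>2\<close>, and the fewest edges win. One or two edges cannot be even, and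
  three cannot if \<open>p\<close> is odd because the degrees add up to \<open>3 p\<close>; this is where \<open>ell p\<close> comes from
  (\<open>even_hypergraph_card_ge\<close>). So \<open>ln Z_hat\<close> is close to the sum \<open>W\<close> over the even hypergraphs with
  exactly \<open>k = ell p\<close> edges, and three facts remain.

  \<^emph>\<open>\<open>W\<close> is asymptotically normal.\<close> Let \<open>W\<^sub>i\<close> collect the terms of \<open>W\<close> that contain the edge \<open>i\<close>. Given
  the other couplings \<open>W\<^sub>i\<close> is centred and \<open>W - W\<^sub>i\<close> is fixed, so a second order expansion of
  \<open>exp (\<i> u W)\<close> around \<open>W - W\<^sub>i\<close>, summed over \<open>i\<close>, shows that the characteristic function nearly solves
  \<open>\<phi>' = - u v \<phi>\<close>, provided that \<open>\<Sum>\<^sub>i W\<^sub>i\<^sup>2\<close> concentrates (\<open>charfun_derivative_bound\<close>). The errors are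
  bounded by the number of quadruples of minimal hypergraphs which cover every edge an even number
  of times without being two disjoint equal pairs. If such a quadruple spanned \<open>k p\<close> vertices, the
  largest possible number, every vertex would lie in exactly two edges; then the pairwise
  intersections would be even, hence by minimality empty or everything, which leaves only the
  excluded configuration. One vertex is lost and a factor \<open>1 / N\<close> gained (\<open>card_bad_quads_le\<close>).

  \<^emph>\<open>The variance.\<close> On variables \<open>\<plusminus>1\<close> the elementary symmetric polynomials are Krawtchouk polynomials of
  the sum (\<open>fact_esym\<close>), and under central scaling these become Hermite polynomials. Applied to
  the spins this gives the limit \<open>H\<^sub>p(\<eta>)\<close> of the energy \<open>X = \<Sum>\<^sub>i \<sigma>\<^sub>i\<close>; applied to the edge variables
  \<open>\<sigma>\<^sub>i\<close>, whose \<open>k\<close>-th elementary symmetric polynomial has the number of even \<open>k\<close>-edge hypergraphs as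
  its spin average, it gives \<open>E H\<^sub>k(H\<^sub>p(\<eta>) / \<surd>p!)\<close> (\<open>card_even_hypergraphs_asymp\<close>).

  \<^emph>\<open>The remaining terms are negligible up to \<open>\<beta>\<^sub>f\<close>.\<close> The number \<open>c\<^sub>m\<close> of even hypergraphs with \<open>m\<close> edges
  satisfies \<open>m! c\<^sub>m \<le> E\<^sub>0 X\<^sup>m\<close>, so with \<open>s = E t\<^sub>i\<^sup>2\<close> the variance of the terms with more than \<open>k\<close> edges
  is at most \<open>E\<^sub>0 ((s |X|)\<^sup>k\<^sup>+\<^sup>1 exp (s |X|))\<close>. Up to constants \<open>s |X|\<close> is at most \<open>\<beta>\<^sup>2 N x\<^sup>p / p!\<close>, where
  \<open>x\<close> is the absolute magnetisation, whose law costs \<open>exp (- N I(x))\<close>; and \<open>\<beta> < \<beta>\<^sub>f\<close> says that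
  \<open>\<beta>\<^sup>2 x\<^sup>p / p!\<close> stays below \<open>I(x)\<close> by a fixed factor (\<open>spin_mean_energy_exp_le\<close>).
\<close>

section \<open>Hermite polynomials under the Gaussian law\<close>

fun hermite_poly :: "nat \<Rightarrow> real poly" where
  "hermite_poly 0 = 1"
| "hermite_poly (Suc 0) = [:0, 1:]"
| "hermite_poly (Suc (Suc k)) =
     [:0, 1:] * hermite_poly (Suc k) - smult (real (Suc k)) (hermite_poly k)"

lemma poly_hermite_poly: "poly (hermite_poly m) x = hermite m x"
  by (induction m x rule: hermite.induct) auto

lemma pderiv_hermite_poly: "pderiv (hermite_poly (Suc m)) = smult (real (Suc m)) (hermite_poly m)"
proof (induction m rule: less_induct)
  case (less m)
  show ?case
  proof (cases m rule: hermite_poly.cases)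
    case 1
    then show ?thesis by (simp add: pderiv_pCons one_pCons)
  next
    case 2
    then show ?thesis by (simp add: pderiv_pCons pderiv_diff pderiv_smult pderiv_mult one_pCons)
  next
    case (3 k)
    have 1: "pderiv (hermite_poly (Suc k)) = smult (real (Suc k)) (hermite_poly k)"
      by (rule less) (simp add: 3)
    have 2: "pderiv (hermite_poly (Suc (Suc k))) = smult (real (Suc (Suc k))) (hermite_poly (Suc k))"
      by (rule less) (simp add: 3)
    have "pderiv (hermite_poly (Suc (Suc (Suc k)))) =
        hermite_poly (Suc (Suc k)) + [:0, 1:] * pderiv (hermite_poly (Suc (Suc k)))
        - smult (real (Suc (Suc k))) (pderiv (hermite_poly (Suc k)))"
      unfolding hermite_poly.simps(3)[of "Suc k"] pderiv_diff pderiv_mult pderiv_smult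
      by (simp add: pderiv_pCons one_pCons del: hermite_poly.simps)
    also have "\<dots> = smult (real (Suc m)) (hermite_poly m)"
      unfolding 1 2 unfolding 3 hermite_poly.simps(3)[of k]
      by (rule poly_eq_poly_eq_iff[THEN iffD1], rule ext) (simp add: algebra_simps)
    finally show ?thesis unfolding 3 .
  qed
qed

definition gauss_mean :: "real poly \<Rightarrow> real" where
  "gauss_mean P = (\<integral>x. poly P x \<partial>std_normal_distribution)"

lemma integrable_poly_std_normal [simp]: "integrable std_normal_distribution (poly P)"
  unfolding poly_altdef
  by (intro Bochner_Integration.integrable_sum integrable_mult_right
      integrable_std_normal_distribution_moment)

lemma gauss_mean_add: "gauss_mean (P + Q) = gauss_mean P + gauss_mean Q"
  and gauss_mean_diff: "gauss_mean (P - Q) = gauss_mean P - gauss_mean Q"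
  and gauss_mean_smult: "gauss_mean (smult c P) = c * gauss_mean P"
  by (simp_all add: gauss_mean_def)

lemma gauss_mean_sum: "gauss_mean (\<Sum>i\<in>A. f i) = (\<Sum>i\<in>A. gauss_mean (f i))"
  by (simp add: gauss_mean_def poly_sum)

lemma gauss_mean_one [simp]: "gauss_mean 1 = 1"
proof -
  interpret real_distribution std_normal_distribution by (rule real_dist_normal_dist)
  show ?thesis using prob_space by (simp add: gauss_mean_def)
qed

lemma gauss_mean_monom: "gauss_mean (monom 1 k) = (\<integral>x. x ^ k \<partial>std_normal_distribution)"
  by (simp add: gauss_mean_def poly_monom)

lemma gauss_mean_expand: "gauss_mean P = (\<Sum>i\<le>degree P. coeff P i * gauss_mean (monom 1 i))"
  by (subst poly_as_sum_of_monoms[symmetric], subst gauss_mean_sum)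
     (simp add: gauss_mean_smult[symmetric] smult_monom)

lemma gauss_moment_Suc:
  "gauss_mean (monom 1 (Suc k)) = real k * gauss_mean (monom 1 (k - 1))"
proof (cases "even k")
  case True
  then show ?thesis
    using integral_std_normal_distribution_moment_odd[of "Suc k"]
      integral_std_normal_distribution_moment_odd[of "k - 1"]
    by (cases "k = 0") (simp_all only: gauss_mean_monom, simp_all)
next
  case False
  then obtain j where k: "k = 2 * j + 1" by (elim oddE)
  have "Suc k = 2 * Suc j" "k - 1 = 2 * j" by (auto simp: k)
  have "(fact (2 * Suc j) :: real) = (2 * (real j + 1)) * (real k * fact (2 * j))"
    "(2 ^ Suc j * fact (Suc j) :: real) = (2 * (real j + 1)) * (2 ^ j * fact j)"
    by (simp_all add: k algebra_simps)
  then have "(fact (2 * Suc j) / (2 ^ Suc j * fact (Suc j)) :: real) = real k * (fact (2 * j) / (2 ^ j * fact j))"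
    by (simp only: mult_divide_mult_cancel_left_if times_divide_eq_right) (auto simp: add_eq_0_iff)
  then show ?thesis
    unfolding gauss_mean_monom \<open>Suc k = _\<close> \<open>k - 1 = _\<close> std_normal_distribution_even_moments .
qed

lemma pderiv_sum: "pderiv (\<Sum>i\<in>A. f i) = (\<Sum>i\<in>A. pderiv (f i))"
  by (induction A rule: infinite_finite_induct) (simp_all add: pderiv_add)

text \<open>
  Gaussian integration by parts for polynomials; on monomials it is the recursion of the moments.
\<close>
lemma gauss_mean_stein: "gauss_mean ([:0, 1:] * P) = gauss_mean (pderiv P)"
proof -
  have "gauss_mean ([:0, 1:] * monom c k) = gauss_mean (pderiv (monom c k))" for c k
  proof -
    have gm: "gauss_mean (monom a j) = a * gauss_mean (monom 1 j)" for a j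
      by (simp add: gauss_mean_smult[symmetric] smult_monom)
    have "gauss_mean ([:0, 1:] * monom c k) = gauss_mean (monom c (Suc k))"
      by (simp add: monom_Suc)
    then show ?thesis
      unfolding pderiv_monom gm[of c] gm[of "_ * c"] gauss_moment_Suc by simp
  qed
  note * = this
  have "gauss_mean ([:0, 1:] * P) = (\<Sum>i\<le>degree P. gauss_mean ([:0, 1:] * monom (coeff P i) i))"
    by (subst (1) poly_as_sum_of_monoms[symmetric, of P]) (simp only: sum_distrib_left gauss_mean_sum)
  also have "\<dots> = gauss_mean (pderiv (\<Sum>i\<le>degree P. monom (coeff P i) i))"
    by (simp only: * gauss_mean_sum[symmetric] pderiv_sum)
  finally show ?thesis by (simp add: poly_as_sum_of_monoms)
qed

lemma hermite_poly_Suc: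
  "hermite_poly (Suc m) = [:0, 1:] * hermite_poly m - pderiv (hermite_poly m)"
  by (cases m) (simp_all add: pderiv_hermite_poly)

text \<open>
  \<open>x - d/dx\<close> raises Hermite polynomials and is the adjoint of \<open>d/dx\<close> under the
  Gaussian law.
\<close>
lemma gauss_mean_hermite_by_parts:
  "gauss_mean (hermite_poly (Suc m) * P) = gauss_mean (hermite_poly m * pderiv P)"
proof -
  have "gauss_mean (hermite_poly (Suc m) * P) =
      gauss_mean ([:0, 1:] * (hermite_poly m * P)) - gauss_mean (pderiv (hermite_poly m) * P)"
    unfolding hermite_poly_Suc by (simp add: gauss_mean_diff[symmetric] algebra_simps)
  then show ?thesis
    unfolding gauss_mean_stein pderiv_mult by (simp add: gauss_mean_add mult.commute)
qed

lemma gauss_mean_hermite: "gauss_mean (hermite_poly m) = (if m = 0 then 1 else 0)"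
proof (cases m)
  case (Suc k)
  then show ?thesis using gauss_mean_hermite_by_parts[of k 1] by (simp add: gauss_mean_def)
qed simp

definition hermite_triple :: "nat \<Rightarrow> nat \<Rightarrow> nat \<Rightarrow> real" where
  "hermite_triple p q r = gauss_mean (hermite_poly p * (hermite_poly q * hermite_poly r))"

lemma pderiv_hermite_poly_pred: "pderiv (hermite_poly m) = smult (real m) (hermite_poly (m - 1))"
  by (cases m) (simp_all add: pderiv_hermite_poly)

text \<open>
  Integrating one factor by parts lowers one of the other two. The coefficients are nonnegative, so all
  positivity statements below follow by induction from the case \<open>p = 0\<close>, which is
  orthogonality.
\<close>
lemma hermite_triple_Suc:
  "hermite_triple (Suc p) q r =
     real q * hermite_triple p (q - 1) r + real r * hermite_triple p q (r - 1)"
proof -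
  have "hermite_triple (Suc p) q r = gauss_mean
     (smult (real q) (hermite_poly p * (hermite_poly (q - 1) * hermite_poly r))
    + smult (real r) (hermite_poly p * (hermite_poly q * hermite_poly (r - 1))))"
    unfolding hermite_triple_def gauss_mean_hermite_by_parts pderiv_mult pderiv_hermite_poly_pred
    by (intro arg_cong[of _ _ gauss_mean]) (simp add: algebra_simps)
  then show ?thesis
    by (simp add: hermite_triple_def gauss_mean_add gauss_mean_smult)
qed

lemma hermite_triple_0: "hermite_triple 0 q r = (if q = r then fact q else 0)"
proof (induction q arbitrary: r)
  case 0
  then show ?case by (simp add: hermite_triple_def gauss_mean_hermite)
next
  case (Suc q)
  have "hermite_triple 0 (Suc q) r = real r * hermite_triple 0 q (r - 1)"
    by (simp add: hermite_triple_def gauss_mean_hermite_by_parts pderiv_hermite_poly_pred gauss_mean_smult)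
  then show ?case using Suc by (cases r) (simp_all add: algebra_simps)
qed

lemma hermite_triple_nonneg: "hermite_triple p q r \<ge> 0"
  by (induction p arbitrary: q r) (simp_all add: hermite_triple_0 hermite_triple_Suc)

lemma hermite_triple_add: "hermite_triple (q + r) q r = fact (q + r)"
proof (induction "q + r" arbitrary: q r)
  case 0
  then show ?case by (simp add: hermite_triple_0)
next
  case (Suc n)
  have 1: "real q * hermite_triple n (q - 1) r = real q * fact n"
  proof (cases q)
    case (Suc q')
    then have "n = q' + r" using \<open>Suc n = q + r\<close> by simp
    with Suc.hyps(1)[OF this] show ?thesis by (simp add: Suc)
  qed simp
  have 2: "real r * hermite_triple n q (r - 1) = real r * fact n"
  proof (cases r)
    case (Suc r')
    then have "n = q + r'" using \<open>Suc n = q + r\<close> by simp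
    with Suc.hyps(1)[OF this] show ?thesis by (simp add: Suc)
  qed simp
  have "hermite_triple (q + r) q r = (real q + real r) * fact n"
    unfolding Suc.hyps(2)[symmetric] hermite_triple_Suc 1 2 by (simp add: algebra_simps)
  also have "real q + real r = real (Suc n)"
    using Suc.hyps(2) by linarith
  finally show ?case unfolding Suc.hyps(2)[symmetric] by simp
qed

lemma hermite_triple_mono: "hermite_triple (p + j) (q + j) r \<ge> hermite_triple p q r"
proof (induction j)
  case (Suc j)
  have "hermite_triple (Suc (p + j)) (Suc (q + j)) r \<ge> real (Suc (q + j)) * hermite_triple (p + j) (q + j) r"
    unfolding hermite_triple_Suc using hermite_triple_nonneg by simp
  moreover have "real (Suc (q + j)) * hermite_triple (p + j) (q + j) r \<ge> 1 * hermite_triple (p + j) (q + j) r"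
    by (intro mult_right_mono hermite_triple_nonneg) simp
  ultimately show ?case using Suc by simp
qed simp

lemma gauss_mean_hermite_sq: "gauss_mean (hermite_poly m ^ 2) = fact m"
  using hermite_triple_0[of m m] by (simp add: hermite_triple_def power2_eq_square)

text \<open>
  For \<open>p = 2 m\<close> the triple \<open>(p, p, p)\<close> dominates \<open>(m, m, 2 m)\<close>,
  whose mean is \<open>(2 m)!\<close>.
\<close>
lemma gauss_mean_hermite_cube_pos:
  assumes "even p"
  shows "gauss_mean (hermite_poly p ^ 3) > 0"
proof -
  obtain m where p: "p = m + m" using assms by (metis evenE mult_2)
  have "0 < (fact (m + m) :: real)" by simp
  also have "\<dots> = hermite_triple m m (m + m)"
    using hermite_triple_add[of m m] by (simp add: hermite_triple_def algebra_simps)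
  also have "\<dots> \<le> hermite_triple p p p"
    unfolding p by (rule hermite_triple_mono)
  finally show ?thesis by (simp add: hermite_triple_def power3_eq_cube mult_ac)
qed

lemma fact_double_ge:
  assumes "p \<ge> 2"
  shows "(fact (2 * p) :: real) > 2 * (fact p)\<^sup>2"
  using assms
proof (induction p rule: dec_induct)
  case base
  then show ?case by (simp add: fact_numeral power2_eq_square)
next
  case (step n)
  have "2 * (fact (Suc n))\<^sup>2 = real ((Suc n)\<^sup>2) * (2 * (fact n)\<^sup>2 :: real)"
    by (simp add: power2_eq_square algebra_simps)
  also have "\<dots> < real ((Suc n)\<^sup>2) * fact (2 * n)"
    using step by (intro mult_strict_left_mono) auto
  also have "\<dots> \<le> real ((2 * n + 2) * (2 * n + 1)) * fact (2 * n)"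
    by (intro mult_right_mono) (auto simp: power2_eq_square simp del: of_nat_mult of_nat_power)
  also have "\<dots> = fact (2 * Suc n)" by (simp add: algebra_simps)
  finally show ?case .
qed

text \<open>
  Bessel's inequality for \<open>H\<^sub>p\<^sup>2\<close> and the orthogonal polynomials \<open>1\<close>
  and \<open>H\<^sub>2\<^sub>p\<close>: the two projections have squared norms \<open>p!\<^sup>2\<close>
  and \<open>(2 p)!\<close>, and the latter exceeds \<open>2 p!\<^sup>2\<close>.
\<close>
lemma gauss_mean_hermite_fourth_gt:
  assumes "p \<ge> 2"
  shows "gauss_mean (hermite_poly p ^ 4) > 3 * (fact p)\<^sup>2"
proof -
  let ?h = "hermite_poly p" and ?g = "hermite_poly (2 * p)" and ?f = "fact p :: real"
  \<comment> \<open>\<open>H\<^sub>p\<^sup>2\<close> minus its projections to \<open>1\<close> and \<open>H\<^sub>2\<^sub>p\<close>\<close>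
  let ?P = "?h ^ 2 - smult ?f 1 - ?g"
  have "0 \<le> gauss_mean (?P ^ 2)"
    unfolding gauss_mean_def by (intro Bochner_Integration.integral_nonneg) (auto simp: poly_power)
  also have "?P ^ 2 = ?h ^ 4 + smult (?f\<^sup>2) 1 + ?g ^ 2 - smult (2 * ?f) (?h ^ 2)
      - smult 2 (?g * (?h * ?h)) + smult (2 * ?f) ?g"
    by (rule poly_eq_poly_eq_iff[THEN iffD1], rule ext)
       (simp add: algebra_simps power2_eq_square power4_eq_xxxx)
  also have "gauss_mean \<dots> = gauss_mean (?h ^ 4) + ?f\<^sup>2 + fact (2 * p) - 2 * ?f * ?f
      - 2 * fact (2 * p)"
    using assms hermite_triple_add[of p p]
    by (simp only: gauss_mean_add gauss_mean_diff gauss_mean_smult gauss_mean_hermite_sq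
        gauss_mean_hermite hermite_triple_def mult_2[symmetric]) simp
  finally show ?thesis using fact_double_ge[OF assms] by (simp add: power2_eq_square)
qed

section \<open>Elementary symmetric polynomials of signs and their Gaussian limits\<close>

definition esym :: "nat \<Rightarrow> 'a set \<Rightarrow> ('a \<Rightarrow> real) \<Rightarrow> real" where
  "esym m A y = (\<Sum>B | B \<subseteq> A \<and> card B = m. \<Prod>a\<in>B. y a)"

lemma esym_0: "finite A \<Longrightarrow> esym 0 A y = 1"
proof -
  assume "finite A"
  then have "{B. B \<subseteq> A \<and> card B = 0} = {{}}" by (auto dest: finite_subset)
  then show ?thesis by (simp add: esym_def)
qed

lemma esym_insert:
  assumes "finite A" "a \<notin> A"
  shows "esym (Suc m) (insert a A) y = esym (Suc m) A y + y a * esym m A y"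
proof -
  let ?F = "\<lambda>A m. {B. B \<subseteq> A \<and> card B = m}"
  have fin: "finite (?F C k)" if "finite C" for C :: "'a set" and k using that by simp
  have eq: "?F (insert a A) (Suc m) = ?F A (Suc m) \<union> insert a ` ?F A m"
  proof (intro equalityI subsetI)
    fix B assume B: "B \<in> ?F (insert a A) (Suc m)"
    show "B \<in> ?F A (Suc m) \<union> insert a ` ?F A m"
    proof (cases "a \<in> B")
      case True
      then have "B = insert a (B - {a})" "B - {a} \<in> ?F A m"
        using B by (auto simp: card_Diff_singleton)
      then show ?thesis by blast
    qed (use B in auto)
  next
    fix B assume "B \<in> ?F A (Suc m) \<union> insert a ` ?F A m"
    then show "B \<in> ?F (insert a A) (Suc m)"
    proof
      assume "B \<in> insert a ` ?F A m"
      then obtain C where C: "C \<subseteq> A" "card C = m" "B = insert a C" by auto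
      moreover have "finite C" "a \<notin> C" using C assms by (auto dest: finite_subset)
      ultimately show ?thesis by auto
    qed auto
  qed
  have inj: "inj_on (insert a) (?F A m)"
    using assms(2) by (intro inj_onI) (auto simp: insert_eq_iff)
  have "esym (Suc m) (insert a A) y =
      esym (Suc m) A y + (\<Sum>B\<in>insert a ` ?F A m. \<Prod>a\<in>B. y a)"
    unfolding esym_def eq using assms by (intro sum.union_disjoint) auto
  also have "(\<Sum>B\<in>insert a ` ?F A m. \<Prod>a\<in>B. y a) = (\<Sum>B\<in>?F A m. \<Prod>a\<in>insert a B. y a)"
    by (subst sum.reindex[OF inj]) simp
  also have "\<dots> = (\<Sum>B\<in>?F A m. y a * (\<Prod>a\<in>B. y a))"
    using assms by (intro sum.cong refl prod.insert) (auto dest: finite_subset)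
  finally show ?thesis by (simp add: esym_def sum_distrib_left)
qed

lemma esym_empty: "esym m {} y = of_bool (m = 0)"
proof -
  have "{B :: 'a set. B \<subseteq> {} \<and> card B = m} = (if m = 0 then {{}} else {})" by auto
  then show ?thesis by (simp add: esym_def)
qed

text \<open>
  The two claims are proved together, by adding one variable at a time, because the case \<open>m =
  0\<close> of the recurrence needs the first one. The hypothesis \<open>y\<^sup>2 = 1\<close> makes the
  terms in which the new variable occurs twice collapse.
\<close>
lemma esym_recurrence_aux:
  assumes "finite A" "\<And>a. a \<in> A \<Longrightarrow> (y a)\<^sup>2 = 1"
  shows "esym (Suc 0) A y = (\<Sum>a\<in>A. y a) \<and>
    (\<forall>m. real (m + 2) * esym (m + 2) A y =
     (\<Sum>a\<in>A. y a) * esym (Suc m) A y - (real (card A) - real m) * esym m A y)"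
  using assms
proof (induction A rule: finite_induct)
  case empty
  then show ?case by (auto simp: esym_empty)
next
  case (insert a A)
  let ?S = "\<Sum>a\<in>A. y a"
  have IH1: "esym (Suc 0) A y = ?S" and
    IH: "real (m + 2) * esym (m + 2) A y =
     ?S * esym (Suc m) A y - (real (card A) - real m) * esym m A y" for m
    using insert by auto
  have ya: "y a * y a = 1" using insert.prems[of a] by (simp add: power2_eq_square)
  show ?case
  proof (intro conjI allI)
    show "esym (Suc 0) (insert a A) y = (\<Sum>a\<in>insert a A. y a)"
      using insert by (simp add: esym_insert esym_0 IH1)
    fix m
    have e2: "esym (m + 2) (insert a A) y = esym (m + 2) A y + y a * esym (Suc m) A y"
      using esym_insert[OF insert(1,2), of "Suc m"] by simp
    have e1: "esym (Suc m) (insert a A) y = esym (Suc m) A y + y a * esym m A y"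
      using esym_insert[OF insert(1,2)] by simp
    have s: "(\<Sum>a\<in>insert a A. y a) = y a + ?S" "real (card (insert a A)) = real (card A) + 1"
      using insert by auto
    show "real (m + 2) * esym (m + 2) (insert a A) y =
        (\<Sum>a\<in>insert a A. y a) * esym (Suc m) (insert a A) y
        - (real (card (insert a A)) - real m) * esym m (insert a A) y"
    proof (cases m)
      case 0
      have e0: "esym 0 (insert a A) y = 1" "esym 0 A y = 1"
        using insert by (simp_all add: esym_0)
      have "2 * esym 2 A y = ?S * ?S - real (card A)"
        using IH[of 0] unfolding IH1 by (simp add: e0 numeral_2_eq_2 IH1)
      then show ?thesis
        unfolding e1 e2 s unfolding 0 using ya
        by (simp add: e0 IH1 numeral_2_eq_2[symmetric] algebra_simps)
    next
      case (Suc k)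
      have em: "esym m (insert a A) y = esym m A y + y a * esym k A y"
        using esym_insert[OF insert(1,2), of k] Suc by simp
      have IHk: "real (m + 1) * esym (Suc m) A y =
         ?S * esym m A y - (real (card A) - real k) * esym k A y"
        using IH[of k] Suc by simp
      have "(y a + ?S) * (esym (Suc m) A y + y a * esym m A y)
          - (real (card A) + 1 - real m) * (esym m A y + y a * esym k A y)
        = (?S * esym (Suc m) A y - (real (card A) - real m) * esym m A y)
          + y a * (esym (Suc m) A y + (?S * esym m A y - (real (card A) - real k) * esym k A y))
          + (y a * y a - 1) * esym m A y"
        by (simp add: Suc algebra_simps)
      also have "\<dots> = real (m + 2) * (esym (m + 2) A y + y a * esym (Suc m) A y)"
        unfolding IHk[symmetric] IH[symmetric] ya by (simp add: algebra_simps)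
      finally show ?thesis unfolding e1 e2 s em by simp
    qed
  qed
qed

lemma esym_1: "finite A \<Longrightarrow> esym (Suc 0) A y = (\<Sum>a\<in>A. y a)"
  by (induction A rule: finite_induct) (simp_all add: esym_empty esym_insert esym_0)

lemma esym_recurrence:
  assumes "finite A" "\<And>a. a \<in> A \<Longrightarrow> (y a)\<^sup>2 = 1"
  shows "real (m + 2) * esym (m + 2) A y =
     (\<Sum>a\<in>A. y a) * esym (Suc m) A y - (real (card A) - real m) * esym m A y"
  using esym_recurrence_aux[of A y, OF assms] by blast

text \<open>
  The Krawtchouk polynomial of degree \<open>m\<close>, normalised to be monic and written in terms of the
  sum \<open>x\<close> of \<open>n\<close> signs.
\<close>
fun krawtchouk :: "real \<Rightarrow> nat \<Rightarrow> real \<Rightarrow> real" where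
  "krawtchouk n 0 x = 1"
| "krawtchouk n (Suc 0) x = x"
| "krawtchouk n (Suc (Suc m)) x =
     x * krawtchouk n (Suc m) x - real (Suc m) * (n - real m) * krawtchouk n m x"

lemma fact_esym:
  assumes "finite A" "\<And>a. a \<in> A \<Longrightarrow> (y a)\<^sup>2 = 1"
  shows "fact m * esym m A y = krawtchouk (real (card A)) m (\<Sum>a\<in>A. y a)"
proof (induction m rule: less_induct)
  case (less m)
  show ?case
  proof (cases m rule: hermite_poly.cases)
    case 1
    then show ?thesis using assms by (simp add: esym_0)
  next
    case 2
    then show ?thesis using assms by (simp add: esym_1)
  next
    case (3 k)
    have "fact m * esym m A y = fact (Suc k) * (real (k + 2) * esym (k + 2) A y)"
      by (simp add: 3)
    also have "real (k + 2) * esym (k + 2) A y =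
        (\<Sum>a\<in>A. y a) * esym (Suc k) A y - (real (card A) - real k) * esym k A y"
      by (rule esym_recurrence[OF assms])
    also have "fact (Suc k) * \<dots> = (\<Sum>a\<in>A. y a) * (fact (Suc k) * esym (Suc k) A y)
        - real (Suc k) * (real (card A) - real k) * (fact k * esym k A y)"
      by (simp add: algebra_simps)
    finally show ?thesis using less[of "Suc k"] less[of k] 3 by simp
  qed
qed

text \<open>
  The same polynomials after the central rescaling \<open>x = \<surd>n y\<close>,
  \<open>n\<^sup>m\<^sup>/\<^sup>2\<close> being divided out; for \<open>n \<rightarrow>
  \<infinity>\<close> the recurrence becomes that of the Hermite polynomials.
\<close>
fun krawtchouk_poly :: "real \<Rightarrow> nat \<Rightarrow> real poly" where
  "krawtchouk_poly n 0 = 1"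
| "krawtchouk_poly n (Suc 0) = [:0, 1:]"
| "krawtchouk_poly n (Suc (Suc m)) = [:0, 1:] * krawtchouk_poly n (Suc m)
     - smult (real (Suc m) * (1 - real m / n)) (krawtchouk_poly n m)"

lemma krawtchouk_scaled:
  assumes "n > 0"
  shows "krawtchouk n m x = sqrt n ^ m * poly (krawtchouk_poly n m) (x / sqrt n)"
proof (induction m rule: less_induct)
  case (less m)
  show ?case
  proof (cases m rule: hermite_poly.cases)
    case (3 k)
    define q z c where "q = sqrt n" and "z = x / q" and "c = 1 - real k / n"
    have x: "x = q * z" and nk: "n - real k = q * q * c"
      using assms by (simp_all add: q_def z_def c_def field_simps)
    have "krawtchouk n m x = x * (q ^ Suc k * poly (krawtchouk_poly n (Suc k)) z)
        - real (Suc k) * (n - real k) * (q ^ k * poly (krawtchouk_poly n k) z)"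
      using less[of k] less[of "Suc k"] 3 by (simp add: q_def z_def)
    also have "\<dots> = q ^ Suc (Suc k) * (z * poly (krawtchouk_poly n (Suc k)) z
        - real (Suc k) * c * poly (krawtchouk_poly n k) z)"
      unfolding x nk by (simp add: algebra_simps)
    finally show ?thesis by (simp add: 3 q_def z_def c_def)
  qed (use assms in auto)
qed

lemma krawtchouk_poly_monic:
  "degree (krawtchouk_poly n m) \<le> m \<and> coeff (krawtchouk_poly n m) m = 1"
proof (induction m rule: less_induct)
  case (less m)
  show ?case
  proof (cases m rule: hermite_poly.cases)
    case (3 k)
    have *: "degree (krawtchouk_poly n k) \<le> k" "degree (krawtchouk_poly n (Suc k)) \<le> Suc k"
      "coeff (krawtchouk_poly n (Suc k)) (Suc k) = 1"
      using less[of k] less[of "Suc k"] 3 by auto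
    have "degree ([:0, 1:] * krawtchouk_poly n (Suc k)) \<le> m"
      using * 3 by (intro order_trans[OF degree_mult_le]) auto
    moreover have "coeff (krawtchouk_poly n k) m = 0" using * 3 by (intro coeff_eq_0) auto
    moreover have "degree (smult (real (Suc k) * (1 - real k / n)) (krawtchouk_poly n k)) \<le> m"
      using * 3 by (intro order_trans[OF degree_smult_le]) auto
    ultimately show ?thesis using * 3 by (auto intro!: degree_diff_le)
  qed auto
qed

text \<open>
  Division by \<open>0\<close> being \<open>0\<close>, the parameter \<open>0\<close> gives the limit
  \<open>n = \<infinity>\<close>.
\<close>
lemma hermite_poly_monic: "degree (hermite_poly m) \<le> m \<and> coeff (hermite_poly m) m = 1"
proof -
  have "hermite_poly m = krawtchouk_poly 0 m"
    by (induction m rule: hermite_poly.induct) simp_all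
  then show ?thesis by (simp add: krawtchouk_poly_monic)
qed

text \<open>
  Coefficientwise convergence with bounded degrees, which makes the limit of an expectation depend on
  finitely many moments only.
\<close>
definition poly_conv :: "(nat \<Rightarrow> real poly) \<Rightarrow> real poly \<Rightarrow> bool" where
  "poly_conv P Q \<longleftrightarrow> (\<forall>i. (\<lambda>n. coeff (P n) i) \<longlonglongrightarrow> coeff Q i) \<and> (\<exists>d. \<forall>n. degree (P n) \<le> d)"

lemma poly_conv_const: "poly_conv (\<lambda>_. Q) Q"
  by (auto simp: poly_conv_def)

lemma poly_conv_mult:
  assumes "poly_conv P Q" "poly_conv P' Q'"
  shows "poly_conv (\<lambda>n. P n * P' n) (Q * Q')"
proof -
  obtain d d' where d: "\<And>n. degree (P n) \<le> d" "\<And>n. degree (P' n) \<le> d'"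
    using assms by (auto simp: poly_conv_def)
  have "degree (P n * P' n) \<le> d + d'" for n
    using degree_mult_le[of "P n" "P' n"] d[of n] by linarith
  then show ?thesis
    using assms by (auto simp: poly_conv_def coeff_mult intro!: tendsto_intros)
qed

lemma poly_conv_diff:
  assumes "poly_conv P Q" "poly_conv P' Q'"
  shows "poly_conv (\<lambda>n. P n - P' n) (Q - Q')"
proof -
  obtain d d' where d: "\<And>n. degree (P n) \<le> d" "\<And>n. degree (P' n) \<le> d'"
    using assms by (auto simp: poly_conv_def)
  have "degree (P n - P' n) \<le> max d d'" for n
    using degree_diff_le_max[of "P n" "P' n"] d[of n] by linarith
  then show ?thesis
    using assms by (auto simp: poly_conv_def intro!: tendsto_intros)
qed

lemma poly_conv_smult:
  assumes "poly_conv P Q" "c \<longlonglongrightarrow> l"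
  shows "poly_conv (\<lambda>n. smult (c n) (P n)) (smult l Q)"
proof -
  obtain d where d: "\<And>n. degree (P n) \<le> d"
    using assms by (auto simp: poly_conv_def)
  have "degree (smult (c n) (P n)) \<le> d" for n
    using degree_smult_le[of "c n" "P n"] d[of n] by linarith
  then show ?thesis
    using assms by (auto simp: poly_conv_def intro!: tendsto_intros)
qed

lemma poly_conv_power: "poly_conv P Q \<Longrightarrow> poly_conv (\<lambda>n. P n ^ j) (Q ^ j)"
  by (induction j) (auto intro: poly_conv_const poly_conv_mult)

lemma poly_conv_krawtchouk:
  assumes "filterlim n at_top sequentially"
  shows "poly_conv (\<lambda>N. krawtchouk_poly (n N) m) (hermite_poly m)"
proof (induction m rule: less_induct)
  case (less m)
  show ?case
  proof (cases m rule: hermite_poly.cases)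
    case (3 k)
    have "((\<lambda>N. real k / n N) \<longlongrightarrow> 0) sequentially"
      by (rule tendsto_divide_0[OF tendsto_const filterlim_at_top_imp_at_infinity[OF assms]])
    then have "(\<lambda>N. real (Suc k) * (1 - real k / n N)) \<longlonglongrightarrow> real (Suc k) * (1 - 0)"
      by (intro tendsto_intros)
    then have "poly_conv (\<lambda>N. krawtchouk_poly (n N) m)
        ([:0, 1:] * hermite_poly (Suc k) - smult (real (Suc k) * (1 - 0)) (hermite_poly k))"
      unfolding 3 krawtchouk_poly.simps using less[of k] less[of "Suc k"] 3
      by (intro poly_conv_diff poly_conv_smult poly_conv_mult poly_conv_const) auto
    then show ?thesis by (simp add: 3)
  qed (auto intro: poly_conv_const)
qed

lemma finite_set_spin_pmf [simp]: "finite (set_pmf (spin_pmf N))"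
  unfolding spin_pmf_def
  by (subst set_Pi_pmf) (auto intro!: finite_PiE_dflt)

lemma integrable_spin_pmf [simp]: "integrable (measure_pmf (spin_pmf N)) (f :: _ \<Rightarrow> real)"
  by (rule integrable_measure_pmf_finite) simp

abbreviation spin_mean :: "nat \<Rightarrow> ((nat \<Rightarrow> real) \<Rightarrow> real) \<Rightarrow> real" where
  "spin_mean N f \<equiv> measure_pmf.expectation (spin_pmf N) f"

lemma spin_values:
  assumes "\<sigma> \<in> set_pmf (spin_pmf N)" "v \<in> {1..N}"
  shows "\<sigma> v = -1 \<or> \<sigma> v = 1"
  using assms unfolding spin_pmf_def by (subst (asm) set_Pi_pmf) (auto simp: PiE_dflt_def)

lemma spin_mean_cong:
  assumes "\<And>\<sigma>. (\<And>v. v \<in> {1..N} \<Longrightarrow> \<sigma> v = -1 \<or> \<sigma> v = 1) \<Longrightarrow> f \<sigma> = g \<sigma>"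
  shows "spin_mean N f = spin_mean N g"
  by (intro integral_cong_AE) (auto simp: AE_measure_pmf_iff intro!: assms dest: spin_values)

lemma spin_mean_mono:
  assumes "\<And>\<sigma>. (\<And>v. v \<in> {1..N} \<Longrightarrow> \<sigma> v = -1 \<or> \<sigma> v = 1) \<Longrightarrow> f \<sigma> \<le> g \<sigma>"
  shows "spin_mean N f \<le> spin_mean N g"
  by (intro integral_mono_AE) (auto simp: AE_measure_pmf_iff intro!: assms dest: spin_values)

lemma spin_mean_prod:
  "spin_mean N (\<lambda>\<sigma>. \<Prod>v\<in>{1..N}. f v (\<sigma> v)) = (\<Prod>v\<in>{1..N}. (f v (-1) + f v 1) / 2)"
proof -
  have "prob_space.indep_vars (spin_pmf N) (\<lambda>_. count_space UNIV) (\<lambda>v \<sigma>. \<sigma> v) {1..N}"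
    unfolding spin_pmf_def by (rule indep_vars_Pi_pmf) simp
  then have "prob_space.indep_vars (spin_pmf N) (\<lambda>_. borel) (\<lambda>v \<sigma>. f v (\<sigma> v)) {1..N}"
    by (rule prob_space.indep_vars_compose2[OF prob_space_measure_pmf]) simp
  then have "spin_mean N (\<lambda>\<sigma>. \<Prod>v\<in>{1..N}. f v (\<sigma> v)) = (\<Prod>v\<in>{1..N}. spin_mean N (\<lambda>\<sigma>. f v (\<sigma> v)))"
    by (intro prob_space.indep_vars_lebesgue_integral[OF prob_space_measure_pmf]) auto
  also have "\<dots> = (\<Prod>v\<in>{1..N}. (f v (-1) + f v 1) / 2)"
  proof (intro prod.cong refl)
    fix v assume v: "v \<in> {1..N}"
    have "map_pmf (\<lambda>\<sigma>. \<sigma> v) (spin_pmf N) = pmf_of_set {-1, 1}"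
      unfolding spin_pmf_def using v by (subst Pi_pmf_component) auto
    then have "spin_mean N (\<lambda>\<sigma>. f v (\<sigma> v)) = measure_pmf.expectation (pmf_of_set {-1, 1}) (f v)"
      by (metis integral_map_pmf)
    then show "spin_mean N (\<lambda>\<sigma>. f v (\<sigma> v)) = (f v (-1) + f v 1) / 2"
      by (simp add: integral_pmf_of_set)
  qed
  finally show ?thesis .
qed

lemma spin_mean_monomial:
  "spin_mean N (\<lambda>\<sigma>. \<Prod>v\<in>{1..N}. \<sigma> v ^ d v) = of_bool (\<forall>v\<in>{1..N}. even (d v))"
proof -
  have "spin_mean N (\<lambda>\<sigma>. \<Prod>v\<in>{1..N}. \<sigma> v ^ d v) = (\<Prod>v\<in>{1..N}. of_bool (even (d v)))"
    by (subst spin_mean_prod) (auto intro!: prod.cong)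
  also have "\<dots> = of_bool (\<forall>v\<in>{1..N}. even (d v))" by auto
  finally show ?thesis .
qed

lemma spin_mean_esym: "spin_mean N (esym m {1..N}) = of_bool (m = 0)"
proof -
  have *: "spin_mean N (\<lambda>\<sigma>. \<Prod>v\<in>B. \<sigma> v) = of_bool (B = {})" if "B \<subseteq> {1..N}" for B
  proof -
    have "(\<Prod>v\<in>B. \<sigma> v) = (\<Prod>v\<in>{1..N}. \<sigma> v ^ of_bool (v \<in> B))" for \<sigma> :: "nat \<Rightarrow> real"
      using that by (intro prod.mono_neutral_cong_left) auto
    then show ?thesis using that by (simp only: spin_mean_monomial) auto
  qed
  have "spin_mean N (esym m {1..N}) = (\<Sum>B | B \<subseteq> {1..N} \<and> card B = m. of_bool (B = {}))"
    unfolding esym_def by (subst Bochner_Integration.integral_sum) (auto intro!: sum.cong simp: *)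
  also have "\<dots> = (\<Sum>B | B \<subseteq> {1..N} \<and> card B = m. if B = {} then 1 else 0)"
    by (intro sum.cong) auto
  also have "\<dots> = of_bool (m = 0)" by (subst sum.delta) auto
  finally show ?thesis .
qed

text \<open>
  The limit law is encoded by a polynomial \<open>Q\<close>, which stands for the law of
  \<open>Q(\<eta>)\<close> with \<open>\<eta>\<close> standard normal.
\<close>
definition moments_conv :: "(nat \<Rightarrow> (nat \<Rightarrow> real) \<Rightarrow> real) \<Rightarrow> real poly \<Rightarrow> bool" where
  "moments_conv Y Q \<longleftrightarrow> (\<forall>j. (\<lambda>N. spin_mean N (\<lambda>\<sigma>. Y N \<sigma> ^ j)) \<longlonglongrightarrow> gauss_mean (Q ^ j))"

lemma moments_conv_mean:
  assumes "moments_conv Y Q" "poly_conv P R"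
  shows "(\<lambda>N. spin_mean N (\<lambda>\<sigma>. poly (P N) (Y N \<sigma>))) \<longlonglongrightarrow> gauss_mean (pcompose R Q)"
proof -
  obtain d where d: "\<And>n. degree (P n) \<le> d" using assms(2) by (auto simp: poly_conv_def)
  define D where "D = max d (degree R)"
  have ex: "poly S x = (\<Sum>i\<le>D. coeff S i * x ^ i)" if "degree S \<le> D" for S and x :: real
    unfolding poly_altdef using that by (intro sum.mono_neutral_left) (auto simp: coeff_eq_0)
  have "spin_mean N (\<lambda>\<sigma>. poly (P N) (Y N \<sigma>)) =
      (\<Sum>i\<le>D. coeff (P N) i * spin_mean N (\<lambda>\<sigma>. Y N \<sigma> ^ i))" for N
    using d[of N] by (subst ex) (auto simp: D_def)
  moreover have "(\<lambda>N. \<Sum>i\<le>D. coeff (P N) i * spin_mean N (\<lambda>\<sigma>. Y N \<sigma> ^ i)) \<longlonglongrightarrow>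
      (\<Sum>i\<le>D. coeff R i * gauss_mean (Q ^ i))"
    using assms by (auto simp: moments_conv_def poly_conv_def intro!: tendsto_intros)
  moreover have "gauss_mean (pcompose R Q) = (\<Sum>i\<le>D. coeff R i * gauss_mean (Q ^ i))"
  proof -
    have "poly (pcompose R Q) = poly (\<Sum>i\<le>D. smult (coeff R i) (Q ^ i))"
      by (rule ext, simp add: poly_pcompose poly_power poly_sum, subst ex) (auto simp: D_def)
    then show ?thesis unfolding poly_eq_poly_eq_iff by (simp add: gauss_mean_sum gauss_mean_smult)
  qed
  ultimately show ?thesis by simp
qed

lemma moments_conv_poly:
  assumes "moments_conv Y Q" "poly_conv P R"
  shows "moments_conv (\<lambda>N \<sigma>. poly (P N) (Y N \<sigma>)) (pcompose R Q)"
  unfolding moments_conv_def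
proof
  fix j
  have "poly (pcompose R Q ^ j) = poly (pcompose (R ^ j) Q)"
    by (simp add: fun_eq_iff poly_pcompose poly_power)
  then show "(\<lambda>N. spin_mean N (\<lambda>\<sigma>. poly (P N) (Y N \<sigma>) ^ j)) \<longlonglongrightarrow> gauss_mean (pcompose R Q ^ j)"
    using moments_conv_mean[OF assms(1) poly_conv_power[OF assms(2), of j]]
    by (simp add: gauss_mean_def poly_power)
qed

text \<open>
  Moment form of the central limit theorem for the spins. The \<open>j\<close>-th elementary symmetric
  polynomial of the spins has mean \<open>0\<close> for \<open>j > 0\<close>, so the rescaled Krawtchouk
  polynomials have the same means as the Hermite polynomials have in the limit; both families are monic,
  and the moments follow by triangularity.
\<close>
lemma moments_conv_spin_sum:
  "moments_conv (\<lambda>N \<sigma>. (\<Sum>v\<in>{1..N}. \<sigma> v) / sqrt N) [:0, 1:]"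
  unfolding moments_conv_def
proof
  fix j
  let ?Y = "\<lambda>(N::nat) (\<sigma>::nat \<Rightarrow> real). (\<Sum>v\<in>{1..N}. \<sigma> v) / sqrt (real N)"
  have X: "[:0, 1:] ^ j = (monom 1 j :: real poly)" for j
    by (simp add: monom_altdef)
  show "(\<lambda>N. spin_mean N (\<lambda>\<sigma>. ?Y N \<sigma> ^ j)) \<longlonglongrightarrow> gauss_mean ([:0, 1:] ^ j)"
  proof (induction j rule: less_induct)
    case (less j)
    have ev: "\<forall>\<^sub>F N in sequentially. of_bool (j = 0) -
        (\<Sum>i<j. coeff (krawtchouk_poly N j) i * spin_mean N (\<lambda>\<sigma>. ?Y N \<sigma> ^ i))
        = spin_mean N (\<lambda>\<sigma>. ?Y N \<sigma> ^ j)"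
      using eventually_gt_at_top[of 0]
    proof eventually_elim
      case (elim N)
      have "sqrt (real N) ^ j * spin_mean N (\<lambda>\<sigma>. poly (krawtchouk_poly N j) (?Y N \<sigma>))
          = spin_mean N (\<lambda>\<sigma>. krawtchouk N j (\<Sum>v\<in>{1..N}. \<sigma> v))"
        using elim by (simp add: krawtchouk_scaled)
      also have "\<dots> = spin_mean N (\<lambda>\<sigma>. fact j * esym j {1..N} \<sigma>)"
        by (intro spin_mean_cong, subst fact_esym) force+
      also have "\<dots> = fact j * of_bool (j = 0)"
        using spin_mean_esym[of N j] by simp
      also have "\<dots> = sqrt (real N) ^ j * of_bool (j = 0)" by (cases "j = 0") auto
      finally have "spin_mean N (\<lambda>\<sigma>. poly (krawtchouk_poly N j) (?Y N \<sigma>)) = of_bool (j = 0)"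
        using elim by simp
      moreover have "spin_mean N (\<lambda>\<sigma>. poly (krawtchouk_poly N j) (?Y N \<sigma>)) =
          (\<Sum>i\<le>j. coeff (krawtchouk_poly N j) i * spin_mean N (\<lambda>\<sigma>. ?Y N \<sigma> ^ i))"
      proof -
        have "poly (krawtchouk_poly N j) x = (\<Sum>i\<le>j. coeff (krawtchouk_poly N j) i * x ^ i)" for x
          unfolding poly_altdef using krawtchouk_poly_monic[of N j]
          by (intro sum.mono_neutral_left) (auto simp: coeff_eq_0)
        then show ?thesis by simp
      qed
      moreover have "{..j} = insert j {..<j}" by auto
      ultimately show ?case using krawtchouk_poly_monic[of N j] by simp
    qed
    have "poly_conv (\<lambda>N. krawtchouk_poly (real N) j) (hermite_poly j)"
      by (rule poly_conv_krawtchouk) (rule filterlim_real_sequentially)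
    then have "(\<lambda>N. of_bool (j = 0) -
        (\<Sum>i<j. coeff (krawtchouk_poly N j) i * spin_mean N (\<lambda>\<sigma>. ?Y N \<sigma> ^ i))) \<longlonglongrightarrow>
        of_bool (j = 0) - (\<Sum>i<j. coeff (hermite_poly j) i * gauss_mean ([:0, 1:] ^ i))"
      using less by (intro tendsto_intros) (auto simp: poly_conv_def)
    moreover have "of_bool (j = 0) - (\<Sum>i<j. coeff (hermite_poly j) i * gauss_mean ([:0, 1:] ^ i))
        = gauss_mean ([:0, 1:] ^ j)"
    proof -
      have dj: "degree (hermite_poly j) = j"
        using hermite_poly_monic[of j] by (metis le_antisym le_degree zero_neq_one)
      have "{..j} = insert j {..<j}" by auto
      then have "gauss_mean (hermite_poly j) = gauss_mean (monom 1 j) +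
          (\<Sum>i<j. coeff (hermite_poly j) i * gauss_mean (monom 1 i))"
        using hermite_poly_monic[of j] by (subst gauss_mean_expand) (simp add: dj)
      then show ?thesis unfolding X gauss_mean_hermite by (auto simp: of_bool_def)
    qed
    ultimately show ?case
      using tendsto_cong[OF ev] by simp
  qed
qed

section \<open>Products of independent symmetric variables\<close>

text \<open>
  Gronwall for \<open>\<phi>' = - w v \<phi>\<close>: the function \<open>exp (v w\<^sup>2 / 2)
  \<phi>(w)\<close> has small derivative.
\<close>
lemma gaussian_ode_bound:
  fixes \<phi> D :: "real \<Rightarrow> complex"
  assumes "\<phi> 0 = 1" and der: "\<And>w. (\<phi> has_vector_derivative D w) (at w)"
    and bound: "\<And>w. \<bar>w\<bar> \<le> \<bar>u\<bar> \<Longrightarrow> norm (D w + of_real (w * v) * \<phi> w) \<le> \<epsilon>"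
    and "v \<ge> 0"
  shows "norm (\<phi> u - of_real (exp (- v * u\<^sup>2 / 2))) \<le> \<bar>u\<bar> * \<epsilon>"
proof -
  define g where "g w = exp (v * w\<^sup>2 / 2) *\<^sub>R \<phi> w" for w
  define g' where "g' w = exp (v * w\<^sup>2 / 2) *\<^sub>R (D w + of_real (w * v) * \<phi> w)" for w
  define B where "B = exp (v * u\<^sup>2 / 2) * \<epsilon>"
  have \<epsilon>: "\<epsilon> \<ge> 0" using norm_ge_zero bound[of u] by (rule order_trans) simp
  have g': "(g has_vector_derivative g' w) (at w)" for w
  proof -
    have "((\<lambda>w. exp (v * w\<^sup>2 / 2)) has_real_derivative (exp (v * w\<^sup>2 / 2) * (v * w))) (at w)"
      by (auto intro!: derivative_eq_intros)
    from has_vector_derivative_scaleR[OF this der[of w]]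
    show ?thesis unfolding g_def g'_def
      by (simp add: algebra_simps scaleR_conv_of_real)
  qed
  have "norm (g u - g 0) \<le> B * norm (u - 0)"
  proof (rule differentiable_bound)
    show "convex (closed_segment 0 u)" by simp
    fix w assume w: "w \<in> closed_segment 0 u"
    show "(g has_derivative (\<lambda>h. h *\<^sub>R g' w)) (at w within closed_segment 0 u)"
      using g'[of w] unfolding has_vector_derivative_def by (rule has_derivative_at_withinI)
    have "\<bar>w\<bar> \<le> \<bar>u\<bar>" using w by (auto simp: closed_segment_eq_real_ivl split: if_splits)
    then have "w\<^sup>2 \<le> u\<^sup>2" by (simp add: abs_le_square_iff)
    then have "v * w\<^sup>2 \<le> v * u\<^sup>2" using \<open>v \<ge> 0\<close> by (rule mult_left_mono)
    then have "exp (v * w\<^sup>2 / 2) \<le> exp (v * u\<^sup>2 / 2)" by simp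
    then have "norm (g' w) \<le> B"
      unfolding g'_def B_def using bound[OF \<open>\<bar>w\<bar> \<le> \<bar>u\<bar>\<close>] by (simp add: mult_mono)
    then show "onorm (\<lambda>h. h *\<^sub>R g' w) \<le> B"
      by (intro onorm_le) (simp, subst mult.commute, rule mult_right_mono, auto)
  qed auto
  then have 1: "norm (g u - 1) \<le> exp (v * u\<^sup>2 / 2) * (\<bar>u\<bar> * \<epsilon>)"
    using assms(1) by (simp add: g_def B_def mult_ac)
  have "\<phi> u - of_real (exp (- v * u\<^sup>2 / 2)) = exp (- v * u\<^sup>2 / 2) *\<^sub>R (g u - 1)"
    by (simp add: g_def scaleR_diff_right exp_minus of_real_def)
  then have "norm (\<phi> u - of_real (exp (- v * u\<^sup>2 / 2))) = exp (- v * u\<^sup>2 / 2) * norm (g u - 1)"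
    by simp
  also have "\<dots> \<le> exp (- v * u\<^sup>2 / 2) * (exp (v * u\<^sup>2 / 2) * (\<bar>u\<bar> * \<epsilon>))"
    using 1 by (intro mult_left_mono) auto
  also have "\<dots> = \<bar>u\<bar> * \<epsilon>" by (simp add: exp_minus)
  finally show ?thesis .
qed

context prob_space
begin

text \<open>
  Boundedness is required everywhere rather than almost everywhere: the class is then closed under all
  operations that occur, and every member is integrable.
\<close>
definition bounded_rv :: "('a \<Rightarrow> 'b :: {real_normed_vector, second_countable_topology}) \<Rightarrow> bool" where
  "bounded_rv f \<longleftrightarrow> f \<in> borel_measurable M \<and> (\<exists>B. \<forall>\<omega>. norm (f \<omega>) \<le> B)"

lemma bounded_rv_integrable:
  fixes f :: "'a \<Rightarrow> 'b :: {banach, second_countable_topology}"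
  assumes "bounded_rv f"
  shows "integrable M f"
proof -
  obtain B where "\<And>\<omega>. norm (f \<omega>) \<le> B" using assms by (auto simp: bounded_rv_def)
  then show ?thesis using assms
    by (intro integrable_const_bound[of _ B]) (auto simp: bounded_rv_def)
qed

lemma bounded_rv_const: "bounded_rv (\<lambda>_. c)"
  by (auto simp: bounded_rv_def)

lemma bounded_rv_add:
  assumes "bounded_rv f" "bounded_rv g"
  shows "bounded_rv (\<lambda>\<omega>. f \<omega> + g \<omega>)"
proof -
  obtain B C where "\<And>\<omega>. norm (f \<omega>) \<le> B" "\<And>\<omega>. norm (g \<omega>) \<le> C"
    using assms by (auto simp: bounded_rv_def)
  then have "norm (f \<omega> + g \<omega>) \<le> B + C" for \<omega>
    by (meson add_mono norm_triangle_ineq order_trans)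
  then show ?thesis using assms by (auto simp: bounded_rv_def)
qed

lemma bounded_rv_mult:
  fixes f g :: "'a \<Rightarrow> 'b :: {real_normed_algebra, second_countable_topology}"
  assumes "bounded_rv f" "bounded_rv g"
  shows "bounded_rv (\<lambda>\<omega>. f \<omega> * g \<omega>)"
proof -
  obtain B C where BC: "\<And>\<omega>. norm (f \<omega>) \<le> B" "\<And>\<omega>. norm (g \<omega>) \<le> C"
    using assms by (auto simp: bounded_rv_def)
  have "norm (f \<omega> * g \<omega>) \<le> B * C" for \<omega>
    by (rule order_trans[OF norm_mult_ineq]) (meson BC mult_mono norm_ge_zero order_trans)
  then show ?thesis using assms by (auto simp: bounded_rv_def)
qed

lemma bounded_rv_diff:
  assumes "bounded_rv f" "bounded_rv g"
  shows "bounded_rv (\<lambda>\<omega>. f \<omega> - g \<omega>)"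
proof -
  have "bounded_rv (\<lambda>\<omega>. - g \<omega>)" using assms(2) by (auto simp: bounded_rv_def)
  from bounded_rv_add[OF assms(1) this] show ?thesis by simp
qed

lemma bounded_rv_sum:
  "(\<And>i. i \<in> I \<Longrightarrow> bounded_rv (f i)) \<Longrightarrow> bounded_rv (\<lambda>\<omega>. \<Sum>i\<in>I. f i \<omega>)"
  by (induction I rule: infinite_finite_induct) (auto intro: bounded_rv_const bounded_rv_add)

lemma bounded_rv_prod:
  fixes f :: "'i \<Rightarrow> 'a \<Rightarrow> 'b :: {real_normed_field, second_countable_topology}"
  shows "(\<And>i. i \<in> I \<Longrightarrow> bounded_rv (f i)) \<Longrightarrow> bounded_rv (\<lambda>\<omega>. \<Prod>i\<in>I. f i \<omega>)"
  by (induction I rule: infinite_finite_induct) (auto intro: bounded_rv_const bounded_rv_mult)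

lemma bounded_rv_power:
  fixes f :: "'a \<Rightarrow> 'b :: {real_normed_field, second_countable_topology}"
  shows "bounded_rv f \<Longrightarrow> bounded_rv (\<lambda>\<omega>. f \<omega> ^ n)"
  by (induction n) (auto intro: bounded_rv_const bounded_rv_mult)

lemma bounded_rv_of_real:
  "bounded_rv f \<Longrightarrow> bounded_rv (\<lambda>\<omega>. complex_of_real (f \<omega>))"
  by (auto simp: bounded_rv_def)

lemma bounded_rv_abs: "bounded_rv f \<Longrightarrow> bounded_rv (\<lambda>\<omega>. \<bar>f \<omega> :: real\<bar>)"
  by (auto simp: bounded_rv_def)

lemma bounded_rv_norm: "bounded_rv f \<Longrightarrow> bounded_rv (\<lambda>\<omega>. norm (f \<omega>))"
  by (auto simp: bounded_rv_def)

lemma bounded_rv_iexp: "bounded_rv f \<Longrightarrow> bounded_rv (\<lambda>\<omega>. iexp (u * f \<omega>))"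
  by (auto simp: bounded_rv_def intro!: exI[of _ 1])

lemmas bounded_rv_intros = bounded_rv_const bounded_rv_add bounded_rv_mult bounded_rv_diff
  bounded_rv_sum bounded_rv_prod bounded_rv_power bounded_rv_of_real bounded_rv_abs
  bounded_rv_norm bounded_rv_iexp

lemma norm_expectation_le:
  fixes f :: "'a \<Rightarrow> 'b :: {banach, second_countable_topology}"
  assumes "bounded_rv f" "bounded_rv g" "\<And>\<omega>. norm (f \<omega>) \<le> g \<omega>"
  shows "norm (\<integral>\<omega>. f \<omega> \<partial>M) \<le> expectation g"
proof -
  have "norm (\<integral>\<omega>. f \<omega> \<partial>M) \<le> expectation (\<lambda>\<omega>. norm (f \<omega>))"
    by (rule integral_norm_bound)
  also have "\<dots> \<le> expectation g"
    by (intro integral_mono bounded_rv_integrable bounded_rv_intros assms)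
  finally show ?thesis .
qed

lemma charfun_has_derivative:
  assumes Y: "bounded_rv (Y :: 'a \<Rightarrow> real)"
  shows "((\<lambda>u. CLINT \<omega>|M. iexp (u * Y \<omega>)) has_vector_derivative
     (CLINT \<omega>|M. \<i> * Y \<omega> * iexp (u * Y \<omega>))) (at u)"
proof -
  define D where "D = (CLINT \<omega>|M. \<i> * Y \<omega> * iexp (u * Y \<omega>))"
  define C where "C = expectation (\<lambda>\<omega>. Y \<omega> ^ 2)"
  have int: "integrable M (\<lambda>\<omega>. iexp (u * Y \<omega>))" for u
    by (intro bounded_rv_integrable bounded_rv_intros Y)
  have int': "integrable M (\<lambda>\<omega>. \<i> * Y \<omega> * iexp (u * Y \<omega>))"
    by (intro bounded_rv_integrable bounded_rv_intros Y)
  have C: "C \<ge> 0" unfolding C_def by simp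
  have bd: "norm ((CLINT \<omega>|M. iexp (w * Y \<omega>)) - (CLINT \<omega>|M. iexp (u * Y \<omega>)) - (w - u) *\<^sub>R D)
      \<le> (w - u)\<^sup>2 * C" for w
  proof -
    have "(CLINT \<omega>|M. iexp (w * Y \<omega>)) - (CLINT \<omega>|M. iexp (u * Y \<omega>)) - (w - u) *\<^sub>R D
        = (CLINT \<omega>|M. iexp (w * Y \<omega>) - iexp (u * Y \<omega>) - (w - u) *\<^sub>R (\<i> * Y \<omega> * iexp (u * Y \<omega>)))"
      unfolding D_def using int int' by simp
    also have "norm \<dots> \<le> expectation (\<lambda>\<omega>. (w - u)\<^sup>2 * Y \<omega> ^ 2)"
    proof (rule norm_expectation_le)
      show "bounded_rv (\<lambda>\<omega>. iexp (w * Y \<omega>) - iexp (u * Y \<omega>) - (w - u) *\<^sub>R (\<i> * Y \<omega> * iexp (u * Y \<omega>)))"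
        unfolding scaleR_conv_of_real by (intro bounded_rv_intros Y)
      show "bounded_rv (\<lambda>\<omega>. (w - u)\<^sup>2 * Y \<omega> ^ 2)"
        by (intro bounded_rv_intros Y)
      fix \<omega>
      define h where "h = (w - u) * Y \<omega>"
      have "w * Y \<omega> = u * Y \<omega> + h" by (simp add: h_def algebra_simps)
      then have e: "iexp (w * Y \<omega>) = iexp (u * Y \<omega>) * iexp h"
        by (simp add: exp_add algebra_simps)
      have "iexp (w * Y \<omega>) - iexp (u * Y \<omega>) - (w - u) *\<^sub>R (\<i> * Y \<omega> * iexp (u * Y \<omega>))
          = iexp (u * Y \<omega>) * (iexp h - (1 + \<i> * h))"
        unfolding e by (simp add: h_def algebra_simps scaleR_conv_of_real)
      also have "norm \<dots> = norm (iexp h - (\<Sum>k\<le>1. (\<i> * h) ^ k / fact k))"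
        by (simp add: norm_mult)
      also have "\<dots> \<le> \<bar>h\<bar> ^ 2 / 2"
        using iexp_approx1[of h 1] by (simp add: numeral_2_eq_2)
      also have "\<dots> \<le> (w - u)\<^sup>2 * Y \<omega> ^ 2" by (simp add: h_def power_mult_distrib)
      finally show "norm (iexp (w * Y \<omega>) - iexp (u * Y \<omega>) - (w - u) *\<^sub>R (\<i> * Y \<omega> * iexp (u * Y \<omega>)))
          \<le> (w - u)\<^sup>2 * Y \<omega> ^ 2" .
    qed
    also have "\<dots> = (w - u)\<^sup>2 * C" by (simp add: C_def)
    finally show ?thesis .
  qed
  show ?thesis
    unfolding has_vector_derivative_def D_def[symmetric]
  proof (rule has_derivativeI_sandwich[of 1])
    show "((\<lambda>w. \<bar>w - u\<bar> * C) \<longlongrightarrow> 0) (at u)"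
      by (auto intro!: tendsto_eq_intros)
    fix w assume "w \<noteq> u"
    then show "norm ((CLINT \<omega>|M. iexp (w * Y \<omega>)) - (CLINT \<omega>|M. iexp (u * Y \<omega>)) - (w - u) *\<^sub>R D) / norm (w - u)
       \<le> \<bar>w - u\<bar> * C"
      using bd[of w] by (simp add: divide_simps power2_eq_square mult_ac abs_mult[symmetric])
  qed (auto intro: bounded_linear_scaleR_left)
qed

end

definition mult4 :: "'e set \<times> 'e set \<times> 'e set \<times> 'e set \<Rightarrow> 'e \<Rightarrow> nat" where
  "mult4 = (\<lambda>(A, B, C, D) e. of_bool (e \<in> A) + of_bool (e \<in> B) + of_bool (e \<in> C) + of_bool (e \<in> D))"

text \<open>
  The quadruples that contribute to the variance of the sum \<open>\<Sum>\<^sub>e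
  W\<^sub>e\<^sup>2\<close> of squared edge parts and to \<open>\<Sum>\<^sub>e E
  W\<^sub>e\<^sup>4\<close>. A quadruple \<open>(A, A, C, C)\<close> with disjoint \<open>A\<close> and
  \<open>C\<close> is left out since its expectation is cancelled by the square of the mean.
\<close>
definition bad_quads ::
  "'e set \<Rightarrow> 'e set set \<Rightarrow> ('e set \<times> 'e set \<times> 'e set \<times> 'e set) set" where
  "bad_quads E G = {T \<in> G \<times> G \<times> G \<times> G. (\<forall>e\<in>E. even (mult4 T e)) \<and>
     (case T of (A, B, C, D) \<Rightarrow> A \<inter> B \<noteq> {} \<and> C \<inter> D \<noteq> {} \<and> \<not> (A = B \<and> C = D \<and> A \<inter> C = {}))}"

text \<open>
  The fourth moments are compared with the square of an upper bound \<open>a\<close> of the second moment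
  \<open>s\<close>: for the couplings both estimates come from \<open>|tanh x| \<le> |x|\<close>, which
  bounds no moment from below.
\<close>
locale symmetric_family = prob_space M for M :: "'a measure" +
  fixes E :: "'e set" and X :: "'e \<Rightarrow> 'a \<Rightarrow> real" and s a K :: real
  assumes fin: "finite E" and indep: "indep_vars (\<lambda>_. borel) X E"
    and X_bounded: "\<And>e \<omega>. e \<in> E \<Longrightarrow> \<bar>X e \<omega>\<bar> \<le> 1"
    and mean1: "\<And>e. e \<in> E \<Longrightarrow> expectation (X e) = 0"
    and mean2: "\<And>e. e \<in> E \<Longrightarrow> expectation (\<lambda>\<omega>. X e \<omega> ^ 2) = s"
    and mean3: "\<And>e. e \<in> E \<Longrightarrow> expectation (\<lambda>\<omega>. X e \<omega> ^ 3) = 0"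
    and mean4: "\<And>e. e \<in> E \<Longrightarrow> expectation (\<lambda>\<omega>. X e \<omega> ^ 4) \<le> K * a\<^sup>2"
    and s_nonneg: "0 \<le> s" and s_le: "s \<le> a" and K_ge: "K \<ge> 1"
begin

definition mon :: "'e set \<Rightarrow> 'a \<Rightarrow> real" where
  "mon A \<omega> = (\<Prod>e\<in>A. X e \<omega>)"

lemma X_brv: "e \<in> E \<Longrightarrow> bounded_rv (X e)"
  using indep X_bounded by (auto simp: bounded_rv_def indep_vars_def)

lemma mon_brv: "A \<subseteq> E \<Longrightarrow> bounded_rv (mon A)"
  unfolding mon_def by (intro bounded_rv_prod X_brv) auto

lemma expectation_powers:
  "expectation (\<lambda>\<omega>. \<Prod>e\<in>E. X e \<omega> ^ m e) = (\<Prod>e\<in>E. expectation (\<lambda>\<omega>. X e \<omega> ^ m e))"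
proof (rule indep_vars_lebesgue_integral[OF fin])
  show "indep_vars (\<lambda>_. borel) (\<lambda>e \<omega>. X e \<omega> ^ m e) E"
    by (rule indep_vars_compose2[OF indep, of "\<lambda>e x. x ^ m e"]) auto
qed (intro bounded_rv_integrable bounded_rv_power X_brv)

lemma mon_powers: "A \<subseteq> E \<Longrightarrow> mon A \<omega> = (\<Prod>e\<in>E. X e \<omega> ^ of_bool (e \<in> A))"
  unfolding mon_def using fin by (intro prod.mono_neutral_cong_left) auto

lemma prod_indicator_power:
  assumes "A \<subseteq> E"
  shows "(\<Prod>e\<in>E. if e \<in> A then r else 1) = (r :: real) ^ card A"
proof -
  have "(\<Prod>e\<in>E. if e \<in> A then r else 1) = (\<Prod>e\<in>A. r)"
    using assms fin by (intro prod.mono_neutral_cong_right) auto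
  then show ?thesis by simp
qed

text \<open>
  Different edge sets give orthogonal monomials: an edge in exactly one of them contributes its mean
  \<open>0\<close>.
\<close>
lemma expectation_mon2:
  assumes "A \<subseteq> E" "B \<subseteq> E"
  shows "expectation (\<lambda>\<omega>. mon A \<omega> * mon B \<omega>) = (if A = B then s ^ card A else 0)"
proof -
  let ?m = "\<lambda>e. of_bool (e \<in> A) + of_bool (e \<in> B) :: nat"
  have *: "expectation (\<lambda>\<omega>. mon A \<omega> * mon B \<omega>) = (\<Prod>e\<in>E. expectation (\<lambda>\<omega>. X e \<omega> ^ ?m e))"
    unfolding expectation_powers[symmetric]
    by (simp only: mon_powers[OF assms(1)] mon_powers[OF assms(2)] prod.distrib[symmetric] power_add)
  show ?thesis
  proof (cases "A = B")
    case True
    have "(\<Prod>e\<in>E. expectation (\<lambda>\<omega>. X e \<omega> ^ ?m e)) = (\<Prod>e\<in>E. if e \<in> A then s else 1)"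
      using True mean2 prob_space by (intro prod.cong refl) (auto simp: numeral_2_eq_2)
    then show ?thesis using * True assms by (simp add: prod_indicator_power)
  next
    case False
    then obtain e where "e \<in> E" "e \<in> A \<longleftrightarrow> e \<notin> B" using assms by blast
    then have e: "e \<in> E" "?m e = 1" by auto
    then have "expectation (\<lambda>\<omega>. X e \<omega> ^ ?m e) = 0" using mean1 by simp
    then have "(\<Prod>e\<in>E. expectation (\<lambda>\<omega>. X e \<omega> ^ ?m e)) = 0"
      using e(1) by (intro prod_zero[OF fin]) blast
    then show ?thesis using * False by simp
  qed
qed

lemma expectation_sum_mon_sq:
  assumes "finite F" "\<And>A. A \<in> F \<Longrightarrow> A \<subseteq> E"
  shows "expectation (\<lambda>\<omega>. (\<Sum>A\<in>F. mon A \<omega>)\<^sup>2) = (\<Sum>A\<in>F. s ^ card A)"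
proof -
  have "expectation (\<lambda>\<omega>. (\<Sum>A\<in>F. mon A \<omega>)\<^sup>2)
      = (\<Sum>A\<in>F. \<Sum>B\<in>F. expectation (\<lambda>\<omega>. mon A \<omega> * mon B \<omega>))"
    unfolding power2_eq_square sum_product
    by (simp add: Bochner_Integration.integral_sum bounded_rv_integrable bounded_rv_intros mon_brv assms)
  also have "\<dots> = (\<Sum>A\<in>F. \<Sum>B\<in>F. if A = B then s ^ card A else 0)"
    using assms by (intro sum.cong refl expectation_mon2) auto
  finally show ?thesis using assms by simp
qed

definition mean_mon4 :: "'e set \<times> 'e set \<times> 'e set \<times> 'e set \<Rightarrow> real" where
  "mean_mon4 = (\<lambda>(A, B, C, D). expectation (\<lambda>\<omega>. mon A \<omega> * mon B \<omega> * (mon C \<omega> * mon D \<omega>)))"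

lemma mean_mon4_eq:
  assumes "A \<subseteq> E" "B \<subseteq> E" "C \<subseteq> E" "D \<subseteq> E"
  shows "mean_mon4 (A, B, C, D) = (\<Prod>e\<in>E. expectation (\<lambda>\<omega>. X e \<omega> ^ mult4 (A, B, C, D) e))"
  unfolding expectation_powers[symmetric] mean_mon4_def mult4_def
  by (simp only: prod.case mon_powers[OF assms(1)] mon_powers[OF assms(2)] mon_powers[OF assms(3)]
      mon_powers[OF assms(4)] prod.distrib[symmetric] power_add mult.assoc)

lemma mean_mon4_odd:
  assumes "A \<subseteq> E" "B \<subseteq> E" "C \<subseteq> E" "D \<subseteq> E"
    and e: "e \<in> E" "odd (mult4 (A, B, C, D) e)"
  shows "mean_mon4 (A, B, C, D) = 0"
proof -
  have "mult4 (A, B, C, D) e = 1 \<or> mult4 (A, B, C, D) e = 3"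
    using e(2) by (auto simp: mult4_def of_bool_def split: if_splits)
  then have "expectation (\<lambda>\<omega>. X e \<omega> ^ mult4 (A, B, C, D) e) = 0"
    using mean1[OF e(1)] mean3[OF e(1)] by auto
  then show ?thesis
    unfolding mean_mon4_eq[OF assms(1-4)] using fin e by (auto intro!: prod_zero)
qed

lemma sum_mult4:
  assumes "A \<subseteq> E" "B \<subseteq> E" "C \<subseteq> E" "D \<subseteq> E"
  shows "(\<Sum>e\<in>E. mult4 (A, B, C, D) e) = card A + card B + card C + card D"
proof -
  have "(\<Sum>e\<in>E. of_bool (e \<in> S)) = card S" if "S \<subseteq> E" for S
    using that fin by (simp add: of_bool_def sum.If_cases Int_absorb1)
  then show ?thesis using assms by (simp add: mult4_def sum.distrib)
qed

text \<open>
  Each edge occurs \<open>0\<close>, \<open>2\<close> or \<open>4\<close> times, and each pair of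
  occurrences costs at most \<open>K a\<close>.
\<close>
lemma mean_mon4_le:
  assumes "A \<subseteq> E" "B \<subseteq> E" "C \<subseteq> E" "D \<subseteq> E"
    and card: "card A = k" "card B = k" "card C = k" "card D = k"
  shows "mean_mon4 (A, B, C, D) \<le> (K * a) ^ (2 * k)"
proof (cases "\<exists>e\<in>E. odd (mult4 (A, B, C, D) e)")
  case True
  have "0 \<le> (K * a) ^ (2 * k)" by simp
  then show ?thesis using mean_mon4_odd[OF assms(1-4)] True by auto
next
  case False
  let ?m = "mult4 (A, B, C, D)"
  have a: "0 \<le> a" using s_nonneg s_le by simp
  have "0 \<le> expectation (\<lambda>\<omega>. X e \<omega> ^ ?m e) \<and> expectation (\<lambda>\<omega>. X e \<omega> ^ ?m e) \<le> (K * a) ^ (?m e div 2)"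
    if e: "e \<in> E" for e
  proof
    show "0 \<le> expectation (\<lambda>\<omega>. X e \<omega> ^ ?m e)"
      using False e by (intro Bochner_Integration.integral_nonneg zero_le_even_power) auto
    have "?m e = 0 \<or> ?m e = 2 \<or> ?m e = 4"
      using False e by (auto simp: mult4_def of_bool_def split: if_splits)
    then show "expectation (\<lambda>\<omega>. X e \<omega> ^ ?m e) \<le> (K * a) ^ (?m e div 2)"
    proof (elim disjE)
      assume "?m e = 2"
      then show ?thesis
        using mean2[OF e] s_le mult_right_mono[OF K_ge a] by simp
    next
      assume m: "?m e = 4"
      have "K * a\<^sup>2 \<le> K\<^sup>2 * a\<^sup>2"
        using K_ge by (intro mult_right_mono) (auto simp: power2_eq_square)
      then show ?thesis
        using mean4[OF e] m by (simp add: power_mult_distrib)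
    qed (simp add: prob_space)
  qed
  then have "mean_mon4 (A, B, C, D) \<le> (\<Prod>e\<in>E. (K * a) ^ (?m e div 2))"
    unfolding mean_mon4_eq[OF assms(1-4)] by (intro prod_mono)
  also have "\<dots> = (K * a) ^ (\<Sum>e\<in>E. ?m e div 2)" by (simp add: power_sum)
  also have "(\<Sum>e\<in>E. ?m e div 2) = 2 * k"
  proof -
    have "2 * (\<Sum>e\<in>E. ?m e div 2) = (\<Sum>e\<in>E. ?m e)"
      unfolding sum_distrib_left using False by (intro sum.cong) auto
    then show ?thesis using sum_mult4[OF assms(1-4)] card by simp
  qed
  finally show ?thesis .
qed

lemma mean_mon4_paired:
  assumes "A \<subseteq> E" "C \<subseteq> E" "A \<inter> C = {}"
  shows "mean_mon4 (A, A, C, C) = s ^ (card A + card C)"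
proof -
  have "(\<Prod>e\<in>E. expectation (\<lambda>\<omega>. X e \<omega> ^ mult4 (A, A, C, C) e))
      = (\<Prod>e\<in>E. if e \<in> A \<union> C then s else 1)"
    using mean2 assms prob_space by (intro prod.cong refl) (auto simp: mult4_def numeral_2_eq_2)
  also have "\<dots> = s ^ card (A \<union> C)" using assms by (intro prod_indicator_power) auto
  also have "card (A \<union> C) = card A + card C"
    using assms fin by (intro card_Un_disjoint) (auto dest: finite_subset)
  finally show ?thesis unfolding mean_mon4_eq[OF assms(1) assms(1) assms(2) assms(2)] .
qed

end

section \<open>A central limit estimate for multilinear sums\<close>

locale multilinear_sum = symmetric_family M E X s a K
  for M :: "'a measure" and E :: "'e set" and X s a K +
  fixes G :: "'e set set" and k :: nat and c :: real
  assumes G_sub: "\<And>A. A \<in> G \<Longrightarrow> A \<subseteq> E" and G_card: "\<And>A. A \<in> G \<Longrightarrow> card A = k"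
    and k_pos: "k > 0"
begin

lemma finite_G: "finite G"
  using G_sub fin by (meson Pow_iff finite_Pow_iff finite_subset subsetI)

definition Y :: "'a \<Rightarrow> real" where "Y \<omega> = c * (\<Sum>A\<in>G. mon A \<omega>)"

text \<open>
  The part of \<open>Y\<close> that changes when the variable of the edge \<open>e\<close> is set to
  \<open>0\<close>.
\<close>
definition edge_part :: "'e \<Rightarrow> 'a \<Rightarrow> real" where
  "edge_part e \<omega> = c * (\<Sum>A\<in>G. of_bool (e \<in> A) * mon A \<omega>)"

definition Q :: "'a \<Rightarrow> real" where "Q \<omega> = (\<Sum>e\<in>E. edge_part e \<omega> ^ 2)"

definition var_Y :: real where "var_Y = c\<^sup>2 * real (card G) * s ^ k"

abbreviation bad :: "('e set \<times> 'e set \<times> 'e set \<times> 'e set) set" where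
  "bad \<equiv> bad_quads E G"

definition err :: real where "err = c ^ 4 * real (card bad) * (K * a) ^ (2 * k)"

lemma mon_brv_G: "A \<in> G \<Longrightarrow> bounded_rv (mon A)"
  using G_sub mon_brv by blast

lemma Y_brv: "bounded_rv Y"
  unfolding Y_def by (intro bounded_rv_intros mon_brv_G)

lemma edge_part_brv: "bounded_rv (edge_part e)"
  unfolding edge_part_def by (intro bounded_rv_intros mon_brv_G)

lemma Q_brv: "bounded_rv Q"
  unfolding Q_def by (intro bounded_rv_intros edge_part_brv)

lemma sum_of_bool_card: "A \<subseteq> E \<Longrightarrow> (\<Sum>e\<in>E. of_bool (e \<in> A)) = real (card A)"
  using fin by (simp add: of_bool_def sum.If_cases Int_absorb1)

text \<open>
  Every monomial of degree \<open>k\<close> is counted once for each of its \<open>k\<close> edges.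
\<close>
lemma sum_edge_part: "(\<Sum>e\<in>E. edge_part e \<omega>) = k * Y \<omega>"
proof -
  have "(\<Sum>e\<in>E. edge_part e \<omega>) = c * (\<Sum>A\<in>G. (\<Sum>e\<in>E. of_bool (e \<in> A)) * mon A \<omega>)"
    unfolding edge_part_def sum_distrib_left[symmetric] sum_distrib_right by (subst sum.swap) simp
  also have "\<dots> = c * (\<Sum>A\<in>G. k * mon A \<omega>)"
    using G_sub G_card by (intro arg_cong[of _ _ "(*) c"] sum.cong refl) (simp add: sum_of_bool_card)
  finally show ?thesis by (simp add: Y_def sum_distrib_left mult_ac)
qed

lemma edge_part_sq:
  "edge_part e \<omega> ^ 2 =
     c\<^sup>2 * (\<Sum>A\<in>G. \<Sum>B\<in>G. of_bool (e \<in> A \<inter> B) * (mon A \<omega> * mon B \<omega>))"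
  unfolding edge_part_def power_mult_distrib power2_eq_square[of "sum _ _"] sum_product
  by (simp add: of_bool_conj mult_ac)

lemma Q_eq: "Q \<omega> = c\<^sup>2 * (\<Sum>A\<in>G. \<Sum>B\<in>G. card (A \<inter> B) * (mon A \<omega> * mon B \<omega>))"
proof -
  have "Q \<omega> = c\<^sup>2 * (\<Sum>e\<in>E. \<Sum>A\<in>G. \<Sum>B\<in>G. of_bool (e \<in> A \<inter> B) * (mon A \<omega> * mon B \<omega>))"
    unfolding Q_def edge_part_sq sum_distrib_left ..
  also have "(\<Sum>e\<in>E. \<Sum>A\<in>G. \<Sum>B\<in>G. of_bool (e \<in> A \<inter> B) * (mon A \<omega> * mon B \<omega>))
      = (\<Sum>A\<in>G. \<Sum>B\<in>G. (\<Sum>e\<in>E. of_bool (e \<in> A \<inter> B)) * (mon A \<omega> * mon B \<omega>))"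
    unfolding sum_distrib_right by (subst sum.swap, intro sum.cong refl, subst sum.swap) simp
  also have "\<dots> = (\<Sum>A\<in>G. \<Sum>B\<in>G. card (A \<inter> B) * (mon A \<omega> * mon B \<omega>))"
    using G_sub by (intro sum.cong refl, subst sum_of_bool_card) auto
  finally show ?thesis .
qed

lemma expectation_Q: "expectation Q = k * var_Y"
proof -
  have "expectation Q =
      c\<^sup>2 * (\<Sum>A\<in>G. \<Sum>B\<in>G. card (A \<inter> B) * expectation (\<lambda>\<omega>. mon A \<omega> * mon B \<omega>))"
    unfolding Q_eq[abs_def]
    by (simp add: Bochner_Integration.integral_sum bounded_rv_integrable bounded_rv_intros mon_brv_G)
  also have "(\<Sum>A\<in>G. \<Sum>B\<in>G. card (A \<inter> B) * expectation (\<lambda>\<omega>. mon A \<omega> * mon B \<omega>))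
      = (\<Sum>A\<in>G. \<Sum>B\<in>G. if A = B then k * s ^ k else 0)"
    using G_sub G_card by (intro sum.cong refl) (auto simp: expectation_mon2)
  finally show ?thesis using finite_G by (simp add: var_Y_def)
qed

lemma sum4: "(\<Sum>A\<in>G. \<Sum>B\<in>G. \<Sum>C\<in>G. \<Sum>D\<in>G. f (A, B, C, D)) = (\<Sum>T\<in>G \<times> G \<times> G \<times> G. f T)"
  by (simp add: sum.cartesian_product case_prod_unfold)

lemma double_sum_product:
  "(\<Sum>A\<in>G. \<Sum>B\<in>G. f A B) * (\<Sum>C\<in>G. \<Sum>D\<in>G. g C D)
     = (\<Sum>A\<in>G. \<Sum>B\<in>G. \<Sum>C\<in>G. \<Sum>D\<in>G. f A B * (g C D :: real))"
  unfolding sum_distrib_right unfolding sum_distrib_left ..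

lemma mean_mon4_bad: "T \<in> bad \<Longrightarrow> mean_mon4 T \<le> (K * a) ^ (2 * k)"
  by (auto simp: bad_quads_def intro!: mean_mon4_le G_sub G_card)

lemma mean_mon4_even:
  assumes "T \<in> G \<times> G \<times> G \<times> G" "mean_mon4 T \<noteq> 0"
  shows "\<forall>e\<in>E. even (mult4 T e)"
proof
  fix e assume e: "e \<in> E"
  obtain A B C D where T: "T = (A, B, C, D)" by (cases T)
  show "even (mult4 T e)"
    using mean_mon4_odd[of A B C D e] assms e G_sub unfolding T by blast
qed

lemma card_Int_le: "A \<in> G \<Longrightarrow> card (A \<inter> B) \<le> k"
  using G_card G_sub fin by (metis card_mono finite_subset inf_le1)

lemma sum_bad: "(\<Sum>T\<in>G \<times> G \<times> G \<times> G. r * of_bool (T \<in> bad)) = r * real (card bad)"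
proof -
  have "bad \<subseteq> G \<times> G \<times> G \<times> G" by (auto simp: bad_quads_def)
  then show ?thesis using finite_G
    by (simp add: sum_distrib_left[symmetric] of_bool_def sum.If_cases Int_absorb1)
qed

text \<open>
  Expanding the square, a quadruple has nonzero mean only if it covers every edge evenly. Such a quadruple
  is bad, or has a vanishing weight, or consists of two disjoint equal pairs; the last kind adds up to at
  most the squared mean of \<open>Q\<close>.
\<close>
lemma expectation_Q_sq: "expectation (\<lambda>\<omega>. Q \<omega> ^ 2) \<le> (k * var_Y)\<^sup>2 + k\<^sup>2 * err"
proof -
  let ?w = "\<lambda>(A, B, C, D). real (card (A \<inter> B)) * real (card (C \<inter> D))"
  let ?P = "\<lambda>(A, B, C, D). A = B \<and> C = D"
  have "Q \<omega> ^ 2 = c ^ 4 * (\<Sum>A\<in>G. \<Sum>B\<in>G. \<Sum>C\<in>G. \<Sum>D\<in>G.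
      ?w (A, B, C, D) * (mon A \<omega> * mon B \<omega> * (mon C \<omega> * mon D \<omega>)))" for \<omega>
  proof -
    have "Q \<omega> ^ 2 = c ^ 4 * ((\<Sum>A\<in>G. \<Sum>B\<in>G. card (A \<inter> B) * (mon A \<omega> * mon B \<omega>))
        * (\<Sum>C\<in>G. \<Sum>D\<in>G. card (C \<inter> D) * (mon C \<omega> * mon D \<omega>)))"
      unfolding Q_eq by (simp add: power2_eq_square power4_eq_xxxx)
    then show ?thesis
      unfolding double_sum_product by (simp add: mult_ac)
  qed
  then have "expectation (\<lambda>\<omega>. Q \<omega> ^ 2) = c ^ 4 *
      (\<Sum>A\<in>G. \<Sum>B\<in>G. \<Sum>C\<in>G. \<Sum>D\<in>G. ?w (A, B, C, D) * mean_mon4 (A, B, C, D))"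
    by (simp add: Bochner_Integration.integral_sum bounded_rv_integrable bounded_rv_intros
        mon_brv_G mean_mon4_def)
  also have "\<dots> = c ^ 4 * (\<Sum>T\<in>G \<times> G \<times> G \<times> G. ?w T * mean_mon4 T)"
    unfolding sum4[symmetric] by simp
  also have "\<dots> \<le> c ^ 4 * (\<Sum>T\<in>G \<times> G \<times> G \<times> G.
      k\<^sup>2 * s ^ (2 * k) * of_bool (?P T) + k\<^sup>2 * (K * a) ^ (2 * k) * of_bool (T \<in> bad))"
  proof (intro mult_left_mono sum_mono)
    fix T assume T: "T \<in> G \<times> G \<times> G \<times> G"
    obtain A B C D where TT: "T = (A, B, C, D)" by (cases T)
    have mem: "A \<in> G" "B \<in> G" "C \<in> G" "D \<in> G" using T TT by auto
    have w: "0 \<le> ?w T" "?w T \<le> k\<^sup>2"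
      using card_Int_le[OF mem(1), of B] card_Int_le[OF mem(3), of D]
      by (auto simp: TT power2_eq_square of_nat_mult[symmetric] simp del: of_nat_mult intro!: mult_mono)
    have r: "0 \<le> k\<^sup>2 * s ^ (2 * k) * of_bool (?P T)" "0 \<le> k\<^sup>2 * (K * a) ^ (2 * k) * of_bool (T \<in> bad)"
      by (auto simp: s_nonneg)
    consider "?w T * mean_mon4 T = 0" | "T \<in> bad"
      | "A = B" "C = D" "A \<inter> C = {}"
      using mean_mon4_even[OF T] T unfolding bad_quads_def TT by fastforce
    then show "?w T * mean_mon4 T \<le>
        k\<^sup>2 * s ^ (2 * k) * of_bool (?P T) + k\<^sup>2 * (K * a) ^ (2 * k) * of_bool (T \<in> bad)"
    proof cases
      case 1
      then show ?thesis using r by linarith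
    next
      case 2
      have "?w T * mean_mon4 T \<le> ?w T * (K * a) ^ (2 * k)"
        using mean_mon4_bad[OF 2] w by (intro mult_left_mono)
      also have "\<dots> \<le> k\<^sup>2 * (K * a) ^ (2 * k)" using w by (intro mult_right_mono) auto
      finally have "?w T * mean_mon4 T \<le> k\<^sup>2 * (K * a) ^ (2 * k) * of_bool (T \<in> bad)"
        using 2 by simp
      then show ?thesis using r(1) by linarith
    next
      case 3
      have "mean_mon4 T = s ^ (2 * k)"
        using mean_mon4_paired[of A C] G_sub G_card mem 3 TT by (simp add: mult_2)
      then have "?w T * mean_mon4 T \<le> k\<^sup>2 * s ^ (2 * k)"
        using w s_nonneg by (simp add: mult_right_mono)
      then have "?w T * mean_mon4 T \<le> k\<^sup>2 * s ^ (2 * k) * of_bool (?P T)"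
        using 3 TT by simp
      then show ?thesis using r(2) by linarith
    qed
  qed simp
  also have "(\<Sum>T\<in>G \<times> G \<times> G \<times> G.
      k\<^sup>2 * s ^ (2 * k) * of_bool (?P T) + k\<^sup>2 * (K * a) ^ (2 * k) * of_bool (T \<in> bad))
    = k\<^sup>2 * s ^ (2 * k) * (real (card G))\<^sup>2 + k\<^sup>2 * (K * a) ^ (2 * k) * real (card bad)"
  proof -
    have "(\<Sum>T\<in>G \<times> G \<times> G \<times> G. of_bool (?P T)) = real (card {T \<in> G \<times> G \<times> G \<times> G. ?P T})"
      using finite_G by (simp add: of_bool_def sum.If_cases Int_def)
    also have "{T \<in> G \<times> G \<times> G \<times> G. ?P T} = (\<lambda>(A, C). (A, A, C, C)) ` (G \<times> G)" by auto
    also have "card \<dots> = card G * card G"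
      by (subst card_image) (auto simp: inj_on_def card_cartesian_product)
    finally show ?thesis
      unfolding sum.distrib sum_distrib_left[symmetric]
      using sum_bad[of 1] by (simp add: power2_eq_square)
  qed
  also have "c ^ 4 * \<dots> = (k * var_Y)\<^sup>2 + k\<^sup>2 * err"
  proof -
    have p: "s ^ (2 * k) = s ^ k * s ^ k" by (simp only: power_even_eq power2_eq_square)
    show ?thesis
      unfolding p by (simp add: var_Y_def err_def power2_eq_square power4_eq_xxxx algebra_simps)
  qed
  finally show ?thesis .
qed

lemma expectation_Q_dev: "expectation (\<lambda>\<omega>. (Q \<omega> - k * var_Y)\<^sup>2) \<le> k\<^sup>2 * err"
proof -
  have "expectation (\<lambda>\<omega>. (Q \<omega> - k * var_Y)\<^sup>2) =
      expectation (\<lambda>\<omega>. Q \<omega> ^ 2 - (2 * (k * var_Y)) * Q \<omega> + (k * var_Y)\<^sup>2)"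
    by (simp add: power2_diff algebra_simps)
  also have "\<dots> = expectation (\<lambda>\<omega>. Q \<omega> ^ 2) - (2 * (k * var_Y)) * expectation Q + (k * var_Y)\<^sup>2"
    using prob_space by (simp add: bounded_rv_integrable bounded_rv_intros Q_brv)
  also have "\<dots> \<le> k\<^sup>2 * err"
    using expectation_Q_sq unfolding expectation_Q power2_eq_square by (simp add: algebra_simps)
  finally show ?thesis .
qed

text \<open>
  All four members of a quadruple with nonzero weight share the edge \<open>e\<close>, so it cannot be
  made of two disjoint pairs: only bad quadruples contribute.
\<close>
lemma sum_edge_part_fourth: "(\<Sum>e\<in>E. expectation (\<lambda>\<omega>. edge_part e \<omega> ^ 4)) \<le> k * err"
proof -
  let ?w = "\<lambda>e (A, B, C, D). of_bool (e \<in> A \<inter> B) * of_bool (e \<in> C \<inter> D) :: real"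
  let ?w' = "\<lambda>T. \<Sum>e\<in>E. ?w e T"
  have "edge_part e \<omega> ^ 4 = c ^ 4 * (\<Sum>A\<in>G. \<Sum>B\<in>G. \<Sum>C\<in>G. \<Sum>D\<in>G.
      ?w e (A, B, C, D) * (mon A \<omega> * mon B \<omega> * (mon C \<omega> * mon D \<omega>)))" for e \<omega>
  proof -
    have "edge_part e \<omega> ^ 4 = (edge_part e \<omega> ^ 2) * (edge_part e \<omega> ^ 2)"
      by (simp add: power2_eq_square power4_eq_xxxx)
    also have "\<dots> = c ^ 4 * ((\<Sum>A\<in>G. \<Sum>B\<in>G. of_bool (e \<in> A \<inter> B) * (mon A \<omega> * mon B \<omega>))
        * (\<Sum>C\<in>G. \<Sum>D\<in>G. of_bool (e \<in> C \<inter> D) * (mon C \<omega> * mon D \<omega>)))"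
      unfolding edge_part_sq by (simp add: power2_eq_square power4_eq_xxxx)
    finally show ?thesis
      unfolding double_sum_product by (simp add: mult_ac)
  qed
  then have "expectation (\<lambda>\<omega>. edge_part e \<omega> ^ 4) = c ^ 4 *
      (\<Sum>A\<in>G. \<Sum>B\<in>G. \<Sum>C\<in>G. \<Sum>D\<in>G. ?w e (A, B, C, D) * mean_mon4 (A, B, C, D))" for e
    by (simp add: Bochner_Integration.integral_sum bounded_rv_integrable bounded_rv_intros
        mon_brv_G mean_mon4_def)
  then have "expectation (\<lambda>\<omega>. edge_part e \<omega> ^ 4) = c ^ 4 *
      (\<Sum>T\<in>G \<times> G \<times> G \<times> G. ?w e T * mean_mon4 T)" for e
    unfolding sum4[symmetric] by simp
  then have "(\<Sum>e\<in>E. expectation (\<lambda>\<omega>. edge_part e \<omega> ^ 4)) = c ^ 4 *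
      (\<Sum>T\<in>G \<times> G \<times> G \<times> G. ?w' T * mean_mon4 T)"
    unfolding sum_distrib_right by (subst sum.swap) (simp add: sum_distrib_left)
  also have "\<dots> \<le> c ^ 4 * (\<Sum>T\<in>G \<times> G \<times> G \<times> G. k * (K * a) ^ (2 * k) * of_bool (T \<in> bad))"
  proof (intro mult_left_mono sum_mono)
    fix T assume T: "T \<in> G \<times> G \<times> G \<times> G"
    obtain A B C D where TT: "T = (A, B, C, D)" by (cases T)
    have mem: "A \<in> G" "B \<in> G" "C \<in> G" "D \<in> G" using T TT by auto
    have w': "?w' T = real (card ((A \<inter> B) \<inter> (C \<inter> D)))"
      using G_sub[OF mem(1)] unfolding TT
      by (subst sum_of_bool_card[symmetric]) (auto intro!: sum.cong simp: of_bool_def)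
    have w: "0 \<le> ?w' T" "?w' T \<le> k"
      using card_Int_le[OF mem(1), of "B \<inter> (C \<inter> D)"] unfolding w' by (auto simp: Int_assoc)
    show "?w' T * mean_mon4 T \<le> k * (K * a) ^ (2 * k) * of_bool (T \<in> bad)"
    proof (cases "T \<in> bad")
      case True
      have "?w' T * mean_mon4 T \<le> ?w' T * (K * a) ^ (2 * k)"
        using mean_mon4_bad[OF True] w by (intro mult_left_mono)
      also have "\<dots> \<le> k * (K * a) ^ (2 * k)" using w by (intro mult_right_mono) auto
      finally show ?thesis using True by simp
    next
      case False
      have "mean_mon4 T = 0 \<or> (A \<inter> B) \<inter> (C \<inter> D) = {}"
        using mean_mon4_even[OF T] T False unfolding bad_quads_def TT by fastforce
      then have "?w' T * mean_mon4 T = 0" unfolding w' by auto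
      then show ?thesis using False by (simp only: of_bool_eq mult_zero_right order_refl)
    qed
  qed simp
  also have "\<dots> = k * err" unfolding sum_bad by (simp add: err_def mult_ac)
  finally show ?thesis .
qed

text \<open>
  The edge part is the variable of \<open>e\<close> times a function of the other variables, and
  \<open>Y\<close> without its edge part is a function of the other variables too.
\<close>
lemma edge_part_iexp_mean:
  assumes e: "e \<in> E"
  shows "(CLINT \<omega>|M. edge_part e \<omega> * iexp (u * (Y \<omega> - edge_part e \<omega>))) = 0"
proof -
  define V where "V f = c * (\<Sum>A\<in>{A \<in> G. e \<in> A}. \<Prod>x\<in>A - {e}. f x)" for f :: "'e \<Rightarrow> real"
  define U where "U f = c * (\<Sum>A\<in>{A \<in> G. e \<notin> A}. \<Prod>x\<in>A. f x)" for f :: "'e \<Rightarrow> real"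
  define Z where "Z \<omega> = (\<lambda>i\<in>E - {e}. X i \<omega>)" for \<omega>
  have part: "edge_part e \<omega> = X e \<omega> * V (Z \<omega>)" for \<omega>
  proof -
    have "edge_part e \<omega> = c * (\<Sum>A\<in>{A \<in> G. e \<in> A}. mon A \<omega>)"
      unfolding edge_part_def using finite_G
      by (intro arg_cong[of _ _ "(*) c"] sum.mono_neutral_cong_right) auto
    also have "(\<Sum>A\<in>{A \<in> G. e \<in> A}. mon A \<omega>) =
        (\<Sum>A\<in>{A \<in> G. e \<in> A}. X e \<omega> * (\<Prod>x\<in>A - {e}. Z \<omega> x))"
    proof (intro sum.cong refl)
      fix A assume A: "A \<in> {A \<in> G. e \<in> A}"
      then have "finite A" using G_sub fin by (auto dest: finite_subset)
      then have "mon A \<omega> = X e \<omega> * (\<Prod>x\<in>A - {e}. X x \<omega>)"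
        unfolding mon_def using A by (intro prod.remove) auto
      also have "(\<Prod>x\<in>A - {e}. X x \<omega>) = (\<Prod>x\<in>A - {e}. Z \<omega> x)"
        using A G_sub by (intro prod.cong) (auto simp: Z_def)
      finally show "mon A \<omega> = X e \<omega> * (\<Prod>x\<in>A - {e}. Z \<omega> x)" .
    qed
    finally show ?thesis by (simp add: V_def sum_distrib_left mult_ac)
  qed
  have rest: "Y \<omega> - edge_part e \<omega> = U (Z \<omega>)" for \<omega>
  proof -
    have "Y \<omega> - edge_part e \<omega> = c * (\<Sum>A\<in>G. of_bool (e \<notin> A) * mon A \<omega>)"
      unfolding Y_def edge_part_def right_diff_distrib[symmetric] sum_subtractf[symmetric]
      by (intro arg_cong[of _ _ "(*) c"] sum.cong) auto
    also have "\<dots> = c * (\<Sum>A\<in>{A \<in> G. e \<notin> A}. mon A \<omega>)"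
      using finite_G by (intro arg_cong[of _ _ "(*) c"] sum.mono_neutral_cong_right) auto
    also have "\<dots> = U (Z \<omega>)"
      unfolding U_def mon_def using G_sub
      by (intro arg_cong[of _ _ "(*) c"] sum.cong prod.cong) (auto simp: Z_def)
    finally show ?thesis .
  qed
  \<comment> \<open>the cofactor of \<open>X e\<close>, as a function on the product space over \<open>E - {e}\<close>\<close>
  define g where "g f = complex_of_real (V f) * iexp (u * U f)" for f
  have meas: "g \<in> borel_measurable (PiM (E - {e}) (\<lambda>_. borel))"
  proof -
    have "V \<in> borel_measurable (PiM (E - {e}) (\<lambda>_. borel))"
      unfolding V_def using G_sub
      by (intro borel_measurable_times borel_measurable_const borel_measurable_sum
          borel_measurable_prod measurable_component_singleton) auto
    moreover have "U \<in> borel_measurable (PiM (E - {e}) (\<lambda>_. borel))"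
      unfolding U_def using G_sub
      by (intro borel_measurable_times borel_measurable_const borel_measurable_sum
          borel_measurable_prod measurable_component_singleton) auto
    ultimately show ?thesis unfolding g_def by measurable
  qed
  have "indep_var (PiM {e} (\<lambda>_. borel)) (\<lambda>\<omega>. \<lambda>i\<in>{e}. X i \<omega>)
      (PiM (E - {e}) (\<lambda>_. borel)) (\<lambda>\<omega>. \<lambda>i\<in>E - {e}. X i \<omega>)"
    using e by (intro indep_var_restrict[OF indep]) auto
  then have "indep_var borel ((\<lambda>f. complex_of_real (f e)) \<circ> (\<lambda>\<omega>. \<lambda>i\<in>{e}. X i \<omega>))
      borel (g \<circ> (\<lambda>\<omega>. \<lambda>i\<in>E - {e}. X i \<omega>))"
    by (rule indep_var_compose) (use meas in auto)
  then have iv: "indep_var borel (\<lambda>\<omega>. complex_of_real (X e \<omega>)) borel (\<lambda>\<omega>. g (Z \<omega>))"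
    by (simp add: comp_def Z_def[symmetric])
  have Zb: "bounded_rv (\<lambda>\<omega>. Z \<omega> x)" if "x \<in> E - {e}" for x
    using that X_brv by (simp add: Z_def)
  have gb: "bounded_rv (\<lambda>\<omega>. g (Z \<omega>))"
    unfolding g_def U_def V_def using G_sub
    by (intro bounded_rv_intros Zb) auto
  have "(CLINT \<omega>|M. edge_part e \<omega> * iexp (u * (Y \<omega> - edge_part e \<omega>)))
      = (CLINT \<omega>|M. complex_of_real (X e \<omega>) * g (Z \<omega>))"
    unfolding rest unfolding part g_def by (simp add: mult_ac)
  also have "\<dots> = (CLINT \<omega>|M. complex_of_real (X e \<omega>)) * (CLINT \<omega>|M. g (Z \<omega>))"
    by (intro indep_var_lebesgue_integral iv bounded_rv_integrable bounded_rv_of_real X_brv e gb)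
  also have "(CLINT \<omega>|M. complex_of_real (X e \<omega>)) = 0"
    using mean1[OF e] by simp
  finally show ?thesis by simp
qed

text \<open>
  Write \<open>k Y = \<Sum>\<^sub>e Y\<^sub>e\<close> with the edge parts \<open>Y\<^sub>e\<close>, and
  expand \<open>exp (\<i> u Y)\<close> around \<open>exp (\<i> u (Y - Y\<^sub>e))\<close>. The zeroth
  order terms have mean \<open>0\<close>, the first order terms add up to \<open>\<i> u Q exp (\<i> u
  Y)\<close>, and \<open>Q\<close> is replaced by its mean \<open>k var_Y\<close>. The free parameter
  \<open>l\<close> balances the elementary inequalities \<open>|x| \<le> (l + x\<^sup>2 / l) / 2\<close>
  and \<open>|x|\<^sup>3 \<le> (l x\<^sup>2 + x\<^sup>4 / l) / 2\<close>, which avoid square roots of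
  expectations.
\<close>
lemma charfun_derivative_bound:
  assumes "l > 0"
  shows "norm ((CLINT \<omega>|M. \<i> * Y \<omega> * iexp (u * Y \<omega>)) + (u * var_Y) * (CLINT \<omega>|M. iexp (u * Y \<omega>)))
    \<le> \<bar>u\<bar> * (l + k\<^sup>2 * err / l) / 2 + u\<^sup>2 * (l * var_Y + err / l) / 4"
proof -
  let ?E = "\<lambda>\<omega>. iexp (u * Y \<omega>)"
  let ?q = "\<lambda>\<omega>. Q \<omega> - k * var_Y"
  let ?r = "\<lambda>\<omega>. k * Y \<omega> * ?E \<omega> - \<i> * u * Q \<omega> * ?E \<omega>
     - (\<Sum>e\<in>E. edge_part e \<omega> * iexp (u * (Y \<omega> - edge_part e \<omega>)))"
  have kr: "real k \<ge> 1" using k_pos by simp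
  note brv = bounded_rv_intros Y_brv edge_part_brv Q_brv
  have abs_le: "\<bar>x\<bar> ^ 3 \<le> (l * x\<^sup>2 + inverse l * x ^ 4) / 2" for x :: real
  proof -
    have "0 \<le> x\<^sup>2 * (l - \<bar>x\<bar>)\<^sup>2 / l" using \<open>l > 0\<close> by simp
    also have "\<dots> = l * x\<^sup>2 - 2 * \<bar>x\<bar> ^ 3 + x ^ 4 / l"
      using \<open>l > 0\<close> by (simp add: power2_eq_square power3_eq_cube power4_eq_xxxx field_simps abs_if)
    finally show ?thesis by (simp add: inverse_eq_divide)
  qed
  have abs_le1: "\<bar>x\<bar> \<le> l / 2 + inverse (2 * l) * x\<^sup>2" for x :: real
  proof -
    have "0 \<le> (l - \<bar>x\<bar>)\<^sup>2 / l" using \<open>l > 0\<close> by simp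
    also have "\<dots> = l - 2 * \<bar>x\<bar> + x\<^sup>2 / l"
      using \<open>l > 0\<close> by (simp add: power2_eq_square field_simps abs_if)
    finally show ?thesis by (simp add: inverse_eq_divide)
  qed
  have r: "norm (?r \<omega>) \<le> (\<Sum>e\<in>E. u\<^sup>2 / 4 * (l * edge_part e \<omega> ^ 2 + inverse l * edge_part e \<omega> ^ 4))" for \<omega>
  proof -
    have rr: "?r \<omega> = (\<Sum>e\<in>E. edge_part e \<omega> * ?E \<omega> - \<i> * u * edge_part e \<omega> ^ 2 * ?E \<omega>
        - edge_part e \<omega> * iexp (u * (Y \<omega> - edge_part e \<omega>)))"
    proof -
      have "complex_of_real (k * Y \<omega>) = (\<Sum>e\<in>E. complex_of_real (edge_part e \<omega>))"
        by (simp only: sum_edge_part[symmetric] of_real_sum)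
      moreover have "complex_of_real (Q \<omega>) = (\<Sum>e\<in>E. complex_of_real (edge_part e \<omega>) ^ 2)"
        by (simp add: Q_def)
      ultimately show ?thesis
        by (simp only: sum_subtractf sum_distrib_left sum_distrib_right of_real_power)
    qed
    show ?thesis unfolding rr
    proof (rule sum_norm_le)
      fix e
      define y where "y = edge_part e \<omega>"
      define z where "z = - (u * y)"
      have e: "iexp (u * (Y \<omega> - y)) = ?E \<omega> * iexp z"
        by (simp add: z_def exp_add[symmetric] algebra_simps)
      have "y * ?E \<omega> - \<i> * u * y ^ 2 * ?E \<omega> - y * iexp (u * (Y \<omega> - y))
          = - (y * ?E \<omega> * (iexp z - (1 + \<i> * z)))"
        unfolding e by (simp add: z_def algebra_simps power2_eq_square)
      also have "norm \<dots> = \<bar>y\<bar> * norm (iexp z - (\<Sum>k\<le>1. (\<i> * z) ^ k / fact k))"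
        by (simp add: norm_mult)
      also have "\<dots> \<le> \<bar>y\<bar> * (\<bar>z\<bar> ^ 2 / 2)"
        using iexp_approx1[of z 1] by (intro mult_left_mono) (auto simp: numeral_2_eq_2)
      also have "\<dots> = u\<^sup>2 / 2 * \<bar>y\<bar> ^ 3"
      proof -
        have "\<bar>z\<bar> ^ 2 = u\<^sup>2 * \<bar>y\<bar> ^ 2" by (simp add: z_def power_mult_distrib)
        moreover have "t * (w * t ^ 2 / 2) = w / 2 * t ^ 3" for t w :: real
          by (simp add: power3_eq_cube power2_eq_square)
        ultimately show ?thesis by (simp only:)
      qed
      also have "\<dots> \<le> u\<^sup>2 / 2 * ((l * y\<^sup>2 + inverse l * y ^ 4) / 2)"
        by (intro mult_left_mono abs_le) simp
      finally show "norm (edge_part e \<omega> * ?E \<omega> - \<i> * u * edge_part e \<omega> ^ 2 * ?E \<omega>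
          - edge_part e \<omega> * iexp (u * (Y \<omega> - edge_part e \<omega>)))
          \<le> u\<^sup>2 / 4 * (l * edge_part e \<omega> ^ 2 + inverse l * edge_part e \<omega> ^ 4)"
        by (simp add: y_def)
    qed
  qed
  have 1: "norm (CLINT \<omega>|M. ?r \<omega>) \<le> u\<^sup>2 / 4 * (l * (k * var_Y) + k * err / l)"
  proof -
    have "norm (CLINT \<omega>|M. ?r \<omega>) \<le>
        expectation (\<lambda>\<omega>. \<Sum>e\<in>E. u\<^sup>2 / 4 * (l * edge_part e \<omega> ^ 2 + inverse l * edge_part e \<omega> ^ 4))"
      by (intro norm_expectation_le brv r)
    also have "\<dots> = u\<^sup>2 / 4 * (l * expectation Q + inverse l * (\<Sum>e\<in>E. expectation (\<lambda>\<omega>. edge_part e \<omega> ^ 4)))"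
    proof -
      have "expectation (\<lambda>\<omega>. u\<^sup>2 / 4 * (l * edge_part e \<omega> ^ 2 + inverse l * edge_part e \<omega> ^ 4))
          = u\<^sup>2 / 4 * (l * expectation (\<lambda>\<omega>. edge_part e \<omega> ^ 2)
            + inverse l * expectation (\<lambda>\<omega>. edge_part e \<omega> ^ 4))" for e
        by (simp add: bounded_rv_integrable bounded_rv_intros edge_part_brv)
      moreover have "expectation Q = (\<Sum>e\<in>E. expectation (\<lambda>\<omega>. edge_part e \<omega> ^ 2))"
        unfolding Q_def[abs_def]
        by (intro Bochner_Integration.integral_sum bounded_rv_integrable brv)
      moreover have "expectation (\<lambda>\<omega>. \<Sum>e\<in>E. u\<^sup>2 / 4 * (l * edge_part e \<omega> ^ 2 + inverse l * edge_part e \<omega> ^ 4))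
          = (\<Sum>e\<in>E. expectation (\<lambda>\<omega>. u\<^sup>2 / 4 * (l * edge_part e \<omega> ^ 2 + inverse l * edge_part e \<omega> ^ 4)))"
        by (intro Bochner_Integration.integral_sum bounded_rv_integrable brv)
      ultimately show ?thesis
        by (simp only: sum_distrib_left sum.distrib distrib_left)
    qed
    also have "\<dots> \<le> u\<^sup>2 / 4 * (l * (k * var_Y) + inverse l * (k * err))"
      using sum_edge_part_fourth \<open>l > 0\<close>
      by (intro mult_left_mono add_mono) (auto simp: expectation_Q)
    finally show ?thesis by (simp add: field_simps)
  qed
  have 2: "norm (CLINT \<omega>|M. ?q \<omega> * ?E \<omega>) \<le> (l + k\<^sup>2 * err / l) / 2"
  proof -
    have "norm (CLINT \<omega>|M. ?q \<omega> * ?E \<omega>) \<le> expectation (\<lambda>\<omega>. l / 2 + inverse (2 * l) * ?q \<omega> ^ 2)"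
    proof (intro norm_expectation_le brv)
      fix \<omega>
      have "norm (?q \<omega> * ?E \<omega>) = \<bar>?q \<omega>\<bar>"
        by (simp add: norm_mult del: of_real_diff of_real_mult)
      also have "\<dots> \<le> l / 2 + inverse (2 * l) * ?q \<omega> ^ 2"
        by (rule abs_le1)
      finally show "norm (?q \<omega> * ?E \<omega>) \<le> l / 2 + inverse (2 * l) * ?q \<omega> ^ 2" .
    qed
    also have "\<dots> = l / 2 + inverse (2 * l) * expectation (\<lambda>\<omega>. ?q \<omega> ^ 2)"
      using prob_space by (simp add: bounded_rv_integrable brv)
    also have "\<dots> \<le> l / 2 + inverse (2 * l) * (k\<^sup>2 * err)"
      using expectation_Q_dev \<open>l > 0\<close> by (intro add_mono mult_left_mono) auto
    finally show ?thesis using \<open>l > 0\<close> by (simp add: field_simps)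
  qed
  have R: "(CLINT \<omega>|M. ?r \<omega>) = k * (CLINT \<omega>|M. Y \<omega> * ?E \<omega>) - \<i> * u * (CLINT \<omega>|M. Q \<omega> * ?E \<omega>)"
  proof -
    have "(CLINT \<omega>|M. ?r \<omega>) = (CLINT \<omega>|M. k * (Y \<omega> * ?E \<omega>) - \<i> * u * (Q \<omega> * ?E \<omega>)
     - (\<Sum>e\<in>E. edge_part e \<omega> * iexp (u * (Y \<omega> - edge_part e \<omega>))))"
      by (simp add: mult.assoc)
    also have "\<dots> = k * (CLINT \<omega>|M. Y \<omega> * ?E \<omega>) - \<i> * u * (CLINT \<omega>|M. Q \<omega> * ?E \<omega>)
        - (\<Sum>e\<in>E. CLINT \<omega>|M. edge_part e \<omega> * iexp (u * (Y \<omega> - edge_part e \<omega>)))"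
      by (simp only: Bochner_Integration.integral_diff Bochner_Integration.integral_sum
          integral_mult_right_zero bounded_rv_integrable brv)
    also have "(\<Sum>e\<in>E. CLINT \<omega>|M. edge_part e \<omega> * iexp (u * (Y \<omega> - edge_part e \<omega>))) = 0"
      by (rule sum.neutral) (blast intro: edge_part_iexp_mean)
    finally show ?thesis by (simp only: diff_zero)
  qed
  have S: "(CLINT \<omega>|M. ?q \<omega> * ?E \<omega>) =
      (CLINT \<omega>|M. Q \<omega> * ?E \<omega>) - (k * var_Y) * (CLINT \<omega>|M. ?E \<omega>)"
  proof -
    have "(CLINT \<omega>|M. ?q \<omega> * ?E \<omega>) = (CLINT \<omega>|M. Q \<omega> * ?E \<omega> - complex_of_real (k * var_Y) * ?E \<omega>)"
      by (simp add: left_diff_distrib)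
    then show ?thesis
      by (simp only: Bochner_Integration.integral_diff integral_mult_right_zero bounded_rv_integrable brv)
  qed
  have IA: "(CLINT \<omega>|M. \<i> * Y \<omega> * ?E \<omega>) = \<i> * (CLINT \<omega>|M. Y \<omega> * ?E \<omega>)"
    by (simp only: mult.assoc integral_mult_right_zero)
  have alg: "k * (\<i> * A + (u * var_Y) * C) = \<i> * (k * A - \<i> * u * B) - u * (B - (k * var_Y) * C)"
    for A B C :: complex
    by (simp add: algebra_simps)
  have eq: "k * ((CLINT \<omega>|M. \<i> * Y \<omega> * ?E \<omega>) + (u * var_Y) * (CLINT \<omega>|M. ?E \<omega>))
      = \<i> * (CLINT \<omega>|M. ?r \<omega>) - u * (CLINT \<omega>|M. ?q \<omega> * ?E \<omega>)"
    unfolding R S IA by (rule alg)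
  have "k * norm ((CLINT \<omega>|M. \<i> * Y \<omega> * ?E \<omega>) + (u * var_Y) * (CLINT \<omega>|M. ?E \<omega>))
      = norm (k * ((CLINT \<omega>|M. \<i> * Y \<omega> * ?E \<omega>) + (u * var_Y) * (CLINT \<omega>|M. ?E \<omega>)))"
    by (simp only: norm_mult) simp
  also have "\<dots> \<le> norm (CLINT \<omega>|M. ?r \<omega>) + \<bar>u\<bar> * norm (CLINT \<omega>|M. ?q \<omega> * ?E \<omega>)"
    unfolding eq by (rule order_trans[OF norm_triangle_ineq4]) (simp add: norm_mult)
  also have "\<dots> \<le> u\<^sup>2 / 4 * (l * (k * var_Y) + k * err / l) + \<bar>u\<bar> * ((l + k\<^sup>2 * err / l) / 2)"
    by (intro add_mono mult_left_mono 1 2) auto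
  also have "\<dots> \<le> u\<^sup>2 / 4 * (l * (k * var_Y) + k * err / l) + k * (\<bar>u\<bar> * ((l + k\<^sup>2 * err / l) / 2))"
  proof -
    have "0 \<le> err" by (simp add: err_def)
    then have "0 \<le> \<bar>u\<bar> * ((l + k\<^sup>2 * err / l) / 2)" using \<open>l > 0\<close> by simp
    from mult_right_mono[OF kr this] show ?thesis by simp
  qed
  also have "\<dots> = k * (\<bar>u\<bar> * (l + k\<^sup>2 * err / l) / 2 + u\<^sup>2 * (l * var_Y + err / l) / 4)"
    by (simp add: algebra_simps add_divide_distrib)
  finally show ?thesis using k_pos by simp
qed

text \<open>
  The choice \<open>l = b\<close> balances the two kinds of errors.
\<close>
lemma charfun_gaussian_approx:
  assumes "b > 0" "err \<le> b\<^sup>2"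
  shows "norm ((CLINT \<omega>|M. iexp (u * Y \<omega>)) - of_real (exp (- var_Y * u\<^sup>2 / 2)))
    \<le> \<bar>u\<bar> * (b * (\<bar>u\<bar> * (1 + k\<^sup>2) / 2 + u\<^sup>2 * (var_Y + 1) / 4))"
proof (rule gaussian_ode_bound)
  show "(CLINT \<omega>|M. iexp (0 * Y \<omega>)) = 1" using prob_space by simp
  show v: "var_Y \<ge> 0" using s_nonneg by (simp add: var_Y_def)
  show "((\<lambda>u. CLINT \<omega>|M. iexp (u * Y \<omega>)) has_vector_derivative
     (CLINT \<omega>|M. \<i> * Y \<omega> * iexp (u * Y \<omega>))) (at u)" for u
    by (rule charfun_has_derivative[OF Y_brv])
  fix w assume w: "\<bar>w\<bar> \<le> \<bar>u\<bar>"
  have eb: "err / b \<le> b" using assms by (simp add: field_simps power2_eq_square)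
  have "norm ((CLINT \<omega>|M. \<i> * Y \<omega> * iexp (w * Y \<omega>)) + complex_of_real (w * var_Y) * (CLINT \<omega>|M. iexp (w * Y \<omega>)))
    \<le> \<bar>w\<bar> * (b + k\<^sup>2 * err / b) / 2 + w\<^sup>2 * (b * var_Y + err / b) / 4"
    using charfun_derivative_bound[OF \<open>b > 0\<close>, of w] by simp
  also have "\<dots> \<le> \<bar>w\<bar> * (b + k\<^sup>2 * b) / 2 + w\<^sup>2 * (b * var_Y + b) / 4"
    using mult_left_mono[OF eb, of "k\<^sup>2"]
    using \<open>b > 0\<close> by (intro add_mono divide_right_mono mult_left_mono eb) auto
  also have "\<dots> \<le> \<bar>u\<bar> * (b + k\<^sup>2 * b) / 2 + u\<^sup>2 * (b * var_Y + b) / 4"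
    using w \<open>b > 0\<close> v abs_le_square_iff[of w u]
    by (intro add_mono divide_right_mono mult_right_mono) auto
  also have "\<dots> = b * (\<bar>u\<bar> * (1 + k\<^sup>2) / 2 + u\<^sup>2 * (var_Y + 1) / 4)"
    by (simp add: algebra_simps add_divide_distrib)
  finally show "norm ((CLINT \<omega>|M. \<i> * Y \<omega> * iexp (w * Y \<omega>)) + complex_of_real (w * var_Y) * (CLINT \<omega>|M. iexp (w * Y \<omega>)))
    \<le> b * (\<bar>u\<bar> * (1 + k\<^sup>2) / 2 + u\<^sup>2 * (var_Y + 1) / 4)" .
qed

end

section \<open>Even hypergraphs\<close>

definition edge_degree :: "nat list set \<Rightarrow> nat \<Rightarrow> nat" where
  "edge_degree \<Gamma> v = card {e \<in> \<Gamma>. v \<in> set e}"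

definition even_hypergraph :: "nat list set \<Rightarrow> bool" where
  "even_hypergraph \<Gamma> \<longleftrightarrow> (\<forall>v. even (edge_degree \<Gamma> v))"

definition even_hypergraphs :: "nat \<Rightarrow> nat \<Rightarrow> nat \<Rightarrow> nat list set set" where
  "even_hypergraphs N p m = {\<Gamma>. \<Gamma> \<subseteq> index_tuples N p \<and> card \<Gamma> = m \<and> even_hypergraph \<Gamma>}"

lemma index_tuples_props:
  assumes "e \<in> index_tuples N p"
  shows "length e = p" "sorted_wrt (<) e" "set e \<subseteq> {1..N}" "distinct e" "card (set e) = p"
  using assms by (auto simp: index_tuples_def strict_sorted_iff distinct_card)

lemma index_tuples_eqI:
  "e \<in> index_tuples N p \<Longrightarrow> f \<in> index_tuples N p \<Longrightarrow> set e = set f \<Longrightarrow> e = f"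
  by (auto simp: index_tuples_def intro: strict_sorted_equal)

lemma finite_index_tuples [simp]: "finite (index_tuples N p)"
  by (rule finite_subset[OF _ finite_lists_length_eq[of "{1..N}" p]])
     (auto simp: index_tuples_def)

lemma sum_edge_degree:
  assumes "finite \<Gamma>" "\<And>e. e \<in> \<Gamma> \<Longrightarrow> card (set e) = p" "(\<Union>e\<in>\<Gamma>. set e) \<subseteq> U" "finite U"
  shows "(\<Sum>v\<in>U. edge_degree \<Gamma> v) = card \<Gamma> * p"
proof -
  have "(\<Sum>v\<in>U. edge_degree \<Gamma> v) = (\<Sum>v\<in>U. \<Sum>e\<in>\<Gamma>. of_bool (v \<in> set e))"
    unfolding edge_degree_def using assms by (simp add: of_bool_def sum.If_cases Int_def)
  also have "\<dots> = (\<Sum>e\<in>\<Gamma>. \<Sum>v\<in>U. of_bool (v \<in> set e))" by (rule sum.swap)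
  also have "\<dots> = (\<Sum>e\<in>\<Gamma>. p)"
  proof (intro sum.cong refl)
    fix e assume e: "e \<in> \<Gamma>"
    then have "U \<inter> {v. v \<in> set e} = set e" using assms(3) by auto
    then show "(\<Sum>v\<in>U. of_bool (v \<in> set e)) = p"
      using assms e by (simp add: of_bool_def sum.If_cases)
  qed
  finally show ?thesis by simp
qed

lemma edge_degree_mono: "finite H \<Longrightarrow> S \<subseteq> H \<Longrightarrow> edge_degree S v \<le> edge_degree H v"
  unfolding edge_degree_def by (intro card_mono) auto

lemma even_hypergraph_degree_ge_2:
  assumes "even_hypergraph \<Gamma>" "finite \<Gamma>" "e \<in> \<Gamma>" "v \<in> set e"
  shows "edge_degree \<Gamma> v \<ge> 2"
proof -
  have "edge_degree \<Gamma> v \<noteq> 0" using assms by (auto simp: edge_degree_def)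
  moreover have "even (edge_degree \<Gamma> v)" using assms by (auto simp: even_hypergraph_def)
  ultimately show ?thesis by presburger
qed

text \<open>
  A single edge gives its vertices degree one; two edges would have to coincide; and the degrees of three
  edges add up to \<open>3 p\<close>, which has to be even.
\<close>
lemma even_hypergraph_card_ge:
  assumes "\<Gamma> \<subseteq> index_tuples N p" "even_hypergraph \<Gamma>" "\<Gamma> \<noteq> {}" "p > 0"
  shows "card \<Gamma> \<ge> ell p"
proof -
  have fin: "finite \<Gamma>" using assms(1) by (rule finite_subset) simp
  have ps: "card (set e) = p" if "e \<in> \<Gamma>" for e using index_tuples_props(5)[OF subsetD[OF assms(1) that]] .
  have "card \<Gamma> \<noteq> 0" using fin assms by simp
  moreover have "card \<Gamma> \<noteq> 1"
  proof
    assume "card \<Gamma> = 1"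
    then obtain e where e: "\<Gamma> = {e}" by (auto simp: card_1_singleton_iff)
    have "set e \<noteq> {}" using ps[of e] e \<open>p > 0\<close> by force
    then obtain v where "v \<in> set e" by (meson equals0I)
    then have "{g \<in> \<Gamma>. v \<in> set g} = {e}" using e by blast
    then have "edge_degree \<Gamma> v = card {e}" unfolding edge_degree_def by (rule arg_cong)
    moreover have "even (edge_degree \<Gamma> v)" using assms(2) unfolding even_hypergraph_def by (rule spec)
    ultimately show False by simp
  qed
  moreover have "card \<Gamma> \<noteq> 2"
  proof
    assume "card \<Gamma> = 2"
    then obtain e f where ef: "\<Gamma> = {e, f}" "e \<noteq> f" by (auto simp: card_2_iff)
    have "v \<in> set e \<longleftrightarrow> v \<in> set f" for v
    proof (rule ccontr)
      assume "\<not> (v \<in> set e \<longleftrightarrow> v \<in> set f)"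
      then have "{g \<in> \<Gamma>. v \<in> set g} = {e} \<or> {g \<in> \<Gamma>. v \<in> set g} = {f}" using ef by auto
      then have "edge_degree \<Gamma> v = card {e} \<or> edge_degree \<Gamma> v = card {f}"
        unfolding edge_degree_def by (elim disjE) (metis, metis)
      moreover have "even (edge_degree \<Gamma> v)"
        using assms(2) unfolding even_hypergraph_def by (rule spec)
      ultimately show False by simp
    qed
    then have "set e = set f" by blast
    moreover have "e \<in> index_tuples N p" "f \<in> index_tuples N p" using ef(1) assms(1) by simp_all
    ultimately show False using ef(2) index_tuples_eqI[of e N p f] by simp
  qed
  moreover have "even p \<or> card \<Gamma> \<noteq> 3"
  proof -
    have "(\<Sum>v\<in>(\<Union>e\<in>\<Gamma>. set e). edge_degree \<Gamma> v) = card \<Gamma> * p"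
      using fin ps by (intro sum_edge_degree) auto
    moreover have "even (\<Sum>v\<in>(\<Union>e\<in>\<Gamma>. set e). edge_degree \<Gamma> v)"
      using assms by (intro dvd_sum) (auto simp: even_hypergraph_def)
    ultimately show ?thesis by auto
  qed
  ultimately show ?thesis by (auto simp: ell_def)
qed

text \<open>
  Let \<open>H\<close> be the set of all edges of the quadruple. Every edge of \<open>H\<close> is used at
  least twice, so \<open>H\<close> has at most \<open>2 k\<close> edges; every vertex lies in at least two
  of them, so there are at most \<open>k p\<close> vertices. In the case of equality all degrees in
  \<open>H\<close> are two. A member of the quadruple then contains both edges at a vertex or none, so
  intersections of members are even again, and minimality makes intersecting members equal. As the first
  two and the last two members intersect, the quadruple consists of two disjoint pairs, unless all four
  agree; but then \<open>H\<close> has only \<open>k\<close> edges.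
\<close>
lemma bad_quad_vertices:
  assumes T: "(A, B, C, D) \<in> bad_quads (index_tuples N p) (even_hypergraphs N p (ell p))"
    and "p > 0"
  shows "card (\<Union>e\<in>A \<union> B \<union> C \<union> D. set e) < ell p * p"
proof (rule ccontr)
  let ?k = "ell p" and ?E = "index_tuples N p"
  define H where "H = A \<union> B \<union> C \<union> D"
  define U where "U = (\<Union>e\<in>H. set e)"
  assume "\<not> card (\<Union>e\<in>A \<union> B \<union> C \<union> D. set e) < ell p * p"
  then have U: "?k * p \<le> card U" by (simp add: U_def H_def)
  have k: "?k > 0" by (simp add: ell_def)
  have sub: "S \<subseteq> ?E" "even_hypergraph S" "card S = ?k" "finite S" "S \<subseteq> H"
    if "S \<in> {A, B, C, D}" for S
    using T that by (auto simp: bad_quads_def even_hypergraphs_def H_def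
        intro: finite_subset[OF _ finite_index_tuples])
  have HE: "H \<subseteq> ?E" using sub by (auto simp: H_def)
  then have fin: "finite H" by (rule finite_subset) simp
  have ps: "card (set e) = p" if "e \<in> H" for e
    using index_tuples_props(5)[OF subsetD[OF HE that]] .
  have finU: "finite U" using fin by (auto simp: U_def)
  \<comment> \<open>count incidences between edges and members of the quadruple\<close>
  have cardH: "2 * card H \<le> 4 * ?k"
  proof -
    have "2 * card H = (\<Sum>e\<in>H. 2)" by simp
    also have "\<dots> \<le> (\<Sum>e\<in>H. mult4 (A, B, C, D) e)"
    proof (rule sum_mono)
      fix e assume e: "e \<in> H"
      have "even (mult4 (A, B, C, D) e)" using T e HE by (auto simp: bad_quads_def)
      moreover have "mult4 (A, B, C, D) e \<noteq> 0" using e by (auto simp: H_def mult4_def)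
      ultimately show "2 \<le> mult4 (A, B, C, D) e" by presburger
    qed
    also have "\<dots> = card A + card B + card C + card D"
    proof -
      have "(\<Sum>e\<in>H. of_bool (e \<in> S)) = card S" if "S \<subseteq> H" for S
        using that fin by (simp add: of_bool_def sum.If_cases Int_absorb1)
      then show ?thesis using sub(5) by (simp add: mult4_def sum.distrib)
    qed
    finally show ?thesis using sub(3) by simp
  qed
  have deg2: "edge_degree H v \<ge> 2" if "v \<in> U" for v
  proof -
    obtain S e where "S \<in> {A, B, C, D}" "e \<in> S" "v \<in> set e"
      using \<open>v \<in> U\<close> by (auto simp: U_def H_def)
    then show ?thesis
      using even_hypergraph_degree_ge_2[of S e v] sub[of S] edge_degree_mono[OF fin, of S v] by simp
  qed
  have sum_deg: "(\<Sum>v\<in>U. edge_degree H v) = card H * p"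
    using fin ps finU by (intro sum_edge_degree) (auto simp: U_def)
  have "(\<Sum>v\<in>U. 2) \<le> (\<Sum>v\<in>U. edge_degree H v)" by (intro sum_mono deg2)
  then have 1: "2 * card U \<le> card H * p" using sum_deg by simp
  have "card H * p \<le> 2 * ?k * p" using cardH by (intro mult_right_mono) auto
  then have 2: "card H * p \<le> 2 * (?k * p)" by (simp only: mult.assoc)
  have eqH: "card H * p = 2 * (?k * p)" and eqU: "2 * card U = card H * p"
    using 1 2 U by linarith+
  then have "card H * p = (2 * ?k) * p" by (simp only: mult.assoc)
  then have Hk: "card H = 2 * ?k" using \<open>p > 0\<close> by (simp only: mult_cancel2) simp
  have deg_eq: "edge_degree H v = 2" if "v \<in> U" for v
  proof (rule sum_mono_inv[of "\<lambda>_. 2" U "edge_degree H", symmetric])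
    show "(\<Sum>v\<in>U. 2) = (\<Sum>v\<in>U. edge_degree H v)" using sum_deg eqU by simp
  qed (use deg2 that finU in auto)
  have part: "{e \<in> S. v \<in> set e} = {} \<or> {e \<in> S. v \<in> set e} = {e \<in> H. v \<in> set e}"
    if S: "S \<in> {A, B, C, D}" for S v
  proof (cases "v \<in> U \<and> {e \<in> S. v \<in> set e} \<noteq> {}")
    case True
    then obtain e where "e \<in> S" "v \<in> set e" by auto
    then have "edge_degree S v \<ge> 2" using even_hypergraph_degree_ge_2 sub[OF S] by blast
    then have "card {e \<in> S. v \<in> set e} = card {e \<in> H. v \<in> set e}"
      using deg_eq[of v] True edge_degree_mono[OF fin sub(5)[OF S], of v]
      by (simp add: edge_degree_def)
    then show ?thesis
      using fin sub(5)[OF S] by (intro disjI2 card_subset_eq) auto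
  next
    case False
    then show ?thesis using sub(5)[OF S] by (auto simp: U_def)
  qed
  have inter: "S = S'" if S: "S \<in> {A, B, C, D}" "S' \<in> {A, B, C, D}" and ne: "S \<inter> S' \<noteq> {}" for S S'
  proof -
    have "even (edge_degree (S \<inter> S') v)" for v
    proof -
      have "{e \<in> S \<inter> S'. v \<in> set e} = {e \<in> S. v \<in> set e} \<inter> {e \<in> S'. v \<in> set e}" by auto
      then have "{e \<in> S \<inter> S'. v \<in> set e} = {} \<or> {e \<in> S \<inter> S'. v \<in> set e} = {e \<in> S. v \<in> set e}"
        using part[OF S(1), of v] part[OF S(2), of v] by blast
      then have "edge_degree (S \<inter> S') v = 0 \<or> edge_degree (S \<inter> S') v = edge_degree S v"
      proof
        assume e: "{e \<in> S \<inter> S'. v \<in> set e} = {}"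
        show ?thesis unfolding edge_degree_def e by simp
      next
        assume e: "{e \<in> S \<inter> S'. v \<in> set e} = {e \<in> S. v \<in> set e}"
        show ?thesis unfolding edge_degree_def e by (rule disjI2) (rule refl)
      qed
      then show ?thesis
        using sub(2)[OF S(1)] by (auto simp: even_hypergraph_def)
    qed
    then have "card (S \<inter> S') \<ge> ?k"
      using sub[OF S(1)] ne \<open>p > 0\<close>
      by (intro even_hypergraph_card_ge[of _ N]) (auto simp: even_hypergraph_def)
    then have "S \<inter> S' = S" using sub(3,4)[OF S(1)] by (intro card_seteq) auto
    then have "S \<subseteq> S'" by blast
    then show ?thesis
      using sub(3,4)[OF S(1)] sub(3,4)[OF S(2)] by (intro card_subset_eq) (auto simp only:)
  qed
  have ne: "A \<inter> B \<noteq> {}" "C \<inter> D \<noteq> {}" "\<not> (A = B \<and> C = D \<and> A \<inter> C = {})"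
    using T by (auto simp: bad_quads_def)
  have AB: "A = B" by (rule inter) (use ne in auto)
  have CD: "C = D" by (rule inter) (use ne in auto)
  have "A = C" by (rule inter) (use ne AB CD in auto)
  then have "H = A" unfolding H_def AB[symmetric] CD[symmetric] by simp
  then show False using Hk sub(3)[of A] k by simp
qed

text \<open>
  A set with at most \<open>m\<close> elements is listed by a word of length \<open>m\<close>, with
  \<open>0\<close> as padding.
\<close>
lemma card_small_subsets: "card {U. U \<subseteq> {1..N} \<and> card U \<le> m} \<le> (N + 1) ^ m"
proof -
  have "{U. U \<subseteq> {1..N} \<and> card U \<le> m} \<subseteq>
      (\<lambda>xs. set xs - {0}) ` {xs. set xs \<subseteq> {0..N} \<and> length xs = m}"
  proof
    fix U assume "U \<in> {U. U \<subseteq> {1..N} \<and> card U \<le> m}"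
    then have U: "U \<subseteq> {1..N}" "card U \<le> m" by auto
    then have "finite U" by (auto intro: finite_subset)
    then obtain xs where xs: "set xs = U" "length xs = card U"
      using finite_distinct_list by (metis distinct_card)
    let ?ys = "xs @ replicate (m - card U) 0"
    have "U = set ?ys - {0}" using U xs by (auto simp: set_replicate_conv_if)
    moreover have "?ys \<in> {xs. set xs \<subseteq> {0..N} \<and> length xs = m}"
      using U xs by (auto simp: set_replicate_conv_if)
    ultimately show "U \<in> (\<lambda>xs. set xs - {0}) ` {xs. set xs \<subseteq> {0..N} \<and> length xs = m}" by blast
  qed
  then have "card {U. U \<subseteq> {1..N} \<and> card U \<le> m} \<le>
      card ((\<lambda>xs. set xs - {0}) ` {xs. set xs \<subseteq> {0..N} \<and> length xs = m})"
    by (intro card_mono finite_imageI finite_lists_length_eq) auto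
  also have "\<dots> \<le> card {xs. set xs \<subseteq> {0..N} \<and> length xs = m}"
    by (intro card_image_le finite_lists_length_eq) auto
  also have "\<dots> = (N + 1) ^ m" by (subst card_lists_length_eq) auto
  finally show ?thesis .
qed

text \<open>
  The vertex set of a quadruple determines it up to a number of choices that does not depend on
  \<open>N\<close>.
\<close>
lemma card_bad_quads_le:
  assumes "p > 0"
  shows "card (bad_quads (index_tuples N p) (even_hypergraphs N p (ell p)))
    \<le> (2 ^ (ell p * p) ^ p) ^ 4 * (N + 1) ^ (ell p * p - 1)"
proof -
  let ?m = "ell p * p - 1" and ?B = "bad_quads (index_tuples N p) (even_hypergraphs N p (ell p))"
  let ?L = "\<lambda>U. {l :: nat list. set l \<subseteq> U \<and> length l = p}"
  let ?F = "\<lambda>U. Pow (?L U) \<times> Pow (?L U) \<times> Pow (?L U) \<times> Pow (?L U)"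
  let ?UU = "{U. U \<subseteq> {1..N} \<and> card U \<le> ?m}"
  define c where "c = (2 :: nat) ^ (ell p * p) ^ p"
  have finU: "finite U" if "U \<in> ?UU" for U using that by (auto intro: finite_subset)
  have finL: "finite (?L U)" if "U \<in> ?UU" for U
    using finite_lists_length_eq[OF finU[OF that]] by simp
  have "?B \<subseteq> (\<Union>U\<in>?UU. ?F U)"
  proof
    fix T assume T: "T \<in> ?B"
    obtain A B C D where TT: "T = (A, B, C, D)" by (cases T)
    define U where "U = (\<Union>e\<in>A \<union> B \<union> C \<union> D. set e)"
    have sub: "A \<union> B \<union> C \<union> D \<subseteq> index_tuples N p"
      using T by (auto simp: TT bad_quads_def even_hypergraphs_def)
    then have e: "set e \<subseteq> {1..N}" "length e = p" if "e \<in> A \<union> B \<union> C \<union> D" for e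
      using that index_tuples_props[of e N p] by blast+
    have "U \<subseteq> {1..N}" unfolding U_def using e(1) by (rule UN_least)
    moreover have "card U \<le> ?m"
      using bad_quad_vertices[OF T[unfolded TT] assms] by (simp add: U_def)
    moreover have "T \<in> ?F U"
    proof -
      have "S \<subseteq> ?L U" if "S \<in> {A, B, C, D}" for S
      proof
        fix e assume "e \<in> S"
        then have "e \<in> A \<union> B \<union> C \<union> D" using that by blast
        then show "e \<in> ?L U" using e(2)[of e] unfolding U_def by blast
      qed
      then show ?thesis unfolding TT by simp
    qed
    ultimately show "T \<in> (\<Union>U\<in>?UU. ?F U)" by blast
  qed
  then have "card ?B \<le> card (\<Union>U\<in>?UU. ?F U)"
    using finL by (intro card_mono finite_UN_I finite_cartesian_product) auto
  also have "\<dots> \<le> (\<Sum>U\<in>?UU. card (?F U))" by (intro card_UN_le) auto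
  also have "\<dots> \<le> (\<Sum>U\<in>?UU. c ^ 4)"
  proof (rule sum_mono)
    fix U assume U: "U \<in> ?UU"
    have "card (?L U) = card U ^ p" using card_lists_length_eq[OF finU[OF U]] by simp
    also have "\<dots> \<le> (ell p * p) ^ p" using U by (intro power_mono) auto
    finally have "(2 :: nat) ^ card (?L U) \<le> c"
      unfolding c_def by (intro power_increasing) auto
    then have "card (Pow (?L U)) \<le> c"
      using card_Pow[OF finL[OF U]] by (simp only:)
    then have "card (Pow (?L U)) ^ 4 \<le> c ^ 4" by (intro power_mono) auto
    then show "card (?F U) \<le> c ^ 4"
      by (simp only: card_cartesian_product power4_eq_xxxx mult.assoc)
  qed
  also have "\<dots> = card ?UU * c ^ 4" by simp
  also have "\<dots> \<le> (N + 1) ^ ?m * c ^ 4"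
    by (intro mult_right_mono card_small_subsets) auto
  finally show ?thesis unfolding c_def by (simp only: mult.commute)
qed

section \<open>Counting even hypergraphs by spin averages\<close>

lemma spin_prod_set:
  assumes "distinct i"
  shows "spin_prod \<sigma> i = (\<Prod>v\<in>set i. \<sigma> v)"
  unfolding spin_prod_def
  by (rule prod.reindex_bij_betw[OF bij_betw_nth[OF assms refl refl]])

lemma bij_betw_index_tuples:
  "bij_betw set (index_tuples N p) {A. A \<subseteq> {1..N} \<and> card A = p}"
proof (rule bij_betwI')
  fix i j assume "i \<in> index_tuples N p" "j \<in> index_tuples N p"
  then show "(set i = set j) = (i = j)" using index_tuples_eqI[of i N p j] by auto
next
  fix i assume "i \<in> index_tuples N p"
  then show "set i \<in> {A. A \<subseteq> {1..N} \<and> card A = p}"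
    using index_tuples_props(3,5)[of i N p] by blast
next
  fix A assume "A \<in> {A. A \<subseteq> {1..N} \<and> card A = p}"
  then have "finite A" "A \<subseteq> {1..N}" "card A = p" by (auto intro: finite_subset)
  then have "sorted_list_of_set A \<in> index_tuples N p \<and> A = set (sorted_list_of_set A)"
    by (simp add: index_tuples_def)
  then show "\<exists>i\<in>index_tuples N p. A = set i" by blast
qed

lemma card_index_tuples: "card (index_tuples N p) = N choose p"
  using bij_betw_same_card[OF bij_betw_index_tuples] by (simp add: n_subsets)

definition spin_energy :: "nat \<Rightarrow> nat \<Rightarrow> (nat \<Rightarrow> real) \<Rightarrow> real" where
  "spin_energy N p \<sigma> = (\<Sum>i\<in>index_tuples N p. spin_prod \<sigma> i)"

lemma spin_energy_esym: "spin_energy N p \<sigma> = esym p {1..N} \<sigma>"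
proof -
  have "spin_energy N p \<sigma> = (\<Sum>i\<in>index_tuples N p. \<Prod>v\<in>set i. \<sigma> v)"
    unfolding spin_energy_def by (intro sum.cong refl spin_prod_set index_tuples_props(4))
  also have "\<dots> = esym p {1..N} \<sigma>"
    unfolding esym_def by (rule sum.reindex_bij_betw[OF bij_betw_index_tuples])
  finally show ?thesis .
qed

lemma prod_spin_prod:
  assumes "\<Gamma> \<subseteq> index_tuples N p"
  shows "(\<Prod>i\<in>\<Gamma>. spin_prod \<sigma> i) = (\<Prod>v\<in>{1..N}. \<sigma> v ^ edge_degree \<Gamma> v)"
proof -
  have fin: "finite \<Gamma>" using assms by (rule finite_subset) simp
  have "(\<Prod>i\<in>\<Gamma>. spin_prod \<sigma> i) = (\<Prod>i\<in>\<Gamma>. \<Prod>v\<in>{1..N}. if v \<in> set i then \<sigma> v else 1)"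
  proof (intro prod.cong refl)
    fix i assume "i \<in> \<Gamma>"
    then have i: "i \<in> index_tuples N p" using assms by blast
    have "(\<Prod>v\<in>set i. \<sigma> v) = (\<Prod>v\<in>{1..N}. if v \<in> set i then \<sigma> v else 1)"
      using index_tuples_props(3)[OF i] by (intro prod.mono_neutral_cong_left) auto
    then show "spin_prod \<sigma> i = (\<Prod>v\<in>{1..N}. if v \<in> set i then \<sigma> v else 1)"
      using spin_prod_set[OF index_tuples_props(4)[OF i]] by simp
  qed
  also have "\<dots> = (\<Prod>v\<in>{1..N}. \<Prod>i\<in>\<Gamma>. if v \<in> set i then \<sigma> v else 1)" by (rule prod.swap)
  also have "\<dots> = (\<Prod>v\<in>{1..N}. \<sigma> v ^ edge_degree \<Gamma> v)"
  proof (intro prod.cong refl)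
    fix v
    have "(\<Prod>i\<in>\<Gamma>. if v \<in> set i then \<sigma> v else 1) = (\<Prod>i\<in>{i \<in> \<Gamma>. v \<in> set i}. \<sigma> v)"
      using fin by (intro prod.mono_neutral_cong_right) auto
    then show "(\<Prod>i\<in>\<Gamma>. if v \<in> set i then \<sigma> v else 1) = \<sigma> v ^ edge_degree \<Gamma> v"
      by (simp add: edge_degree_def)
  qed
  finally show ?thesis .
qed

lemma spin_mean_prod_spin_prod:
  assumes "\<Gamma> \<subseteq> index_tuples N p"
  shows "spin_mean N (\<lambda>\<sigma>. \<Prod>i\<in>\<Gamma>. spin_prod \<sigma> i) = of_bool (even_hypergraph \<Gamma>)"
proof -
  have "edge_degree \<Gamma> v = 0" if "v \<notin> {1..N}" for v
  proof -
    have "v \<notin> set e" if "e \<in> \<Gamma>" for e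
      using subsetD[OF index_tuples_props(3)[OF subsetD[OF assms that]], of v] \<open>v \<notin> {1..N}\<close> by blast
    then have "{e \<in> \<Gamma>. v \<in> set e} = {}" by blast
    then show ?thesis unfolding edge_degree_def by (simp only: card.empty)
  qed
  then have "(\<forall>v\<in>{1..N}. even (edge_degree \<Gamma> v)) = even_hypergraph \<Gamma>"
    unfolding even_hypergraph_def by (metis even_zero)
  then show ?thesis unfolding prod_spin_prod[OF assms] spin_mean_monomial by (simp only:)
qed

lemma finite_even_hypergraphs [simp]: "finite (even_hypergraphs N p m)"
  by (rule finite_subset[of _ "Pow (index_tuples N p)"]) (auto simp: even_hypergraphs_def)

abbreviation edge_esym :: "nat \<Rightarrow> nat \<Rightarrow> nat \<Rightarrow> (nat \<Rightarrow> real) \<Rightarrow> real" where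
  "edge_esym N p m \<sigma> \<equiv> esym m (index_tuples N p) (spin_prod \<sigma>)"

lemma spin_mean_edge_esym:
  "spin_mean N (edge_esym N p m) = real (card (even_hypergraphs N p m))"
proof -
  have "spin_mean N (edge_esym N p m) =
      (\<Sum>\<Gamma> | \<Gamma> \<subseteq> index_tuples N p \<and> card \<Gamma> = m. spin_mean N (\<lambda>\<sigma>. \<Prod>i\<in>\<Gamma>. spin_prod \<sigma> i))"
    unfolding esym_def by (intro Bochner_Integration.integral_sum) simp
  also have "\<dots> = (\<Sum>\<Gamma> | \<Gamma> \<subseteq> index_tuples N p \<and> card \<Gamma> = m. of_bool (even_hypergraph \<Gamma>))"
    by (intro sum.cong refl spin_mean_prod_spin_prod) auto
  also have "\<dots> = (\<Sum>\<Gamma>\<in>even_hypergraphs N p m. 1)"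
    by (intro sum.mono_neutral_cong_right) (auto simp: even_hypergraphs_def)
  finally show ?thesis by simp
qed

lemma spin_prod_sq:
  assumes "i \<in> index_tuples N p" "\<And>v. v \<in> {1..N} \<Longrightarrow> \<sigma> v = -1 \<or> \<sigma> v = 1"
  shows "(spin_prod \<sigma> i)\<^sup>2 = 1"
proof -
  have "(\<sigma> v)\<^sup>2 = 1" if "v \<in> set i" for v
    using assms(2)[OF subsetD[OF index_tuples_props(3)[OF assms(1)] that]] by auto
  then show ?thesis
    by (simp add: spin_prod_set[OF index_tuples_props(4)[OF assms(1)]] prod_power_distrib)
qed

lemma Z_hat_expansion:
  "Z_hat p N \<beta> J = (\<Sum>\<Gamma> | \<Gamma> \<subseteq> index_tuples N p \<and> even_hypergraph \<Gamma>.
     \<Prod>i\<in>\<Gamma>. tanh (\<beta> * J i / real N powr ((real p - 1) / 2)))"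
proof -
  let ?E = "index_tuples N p" and ?t = "\<lambda>i. tanh (\<beta> * J i / real N powr ((real p - 1) / 2))"
  have "(\<Prod>i\<in>?E. 1 + spin_prod \<sigma> i * ?t i) =
      (\<Sum>\<Gamma>\<in>Pow ?E. (\<Prod>i\<in>\<Gamma>. ?t i) * (\<Prod>i\<in>\<Gamma>. spin_prod \<sigma> i))" for \<sigma>
    using prod_add[of ?E "\<lambda>i. spin_prod \<sigma> i * ?t i" "\<lambda>_. 1"]
    by (simp add: add.commute prod.distrib mult.commute)
  then have "Z_hat p N \<beta> J =
      (\<Sum>\<Gamma>\<in>Pow ?E. (\<Prod>i\<in>\<Gamma>. ?t i) * spin_mean N (\<lambda>\<sigma>. \<Prod>i\<in>\<Gamma>. spin_prod \<sigma> i))"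
    unfolding Z_hat_def by simp
  also have "\<dots> = (\<Sum>\<Gamma>\<in>Pow ?E. (\<Prod>i\<in>\<Gamma>. ?t i) * of_bool (even_hypergraph \<Gamma>))"
    by (intro sum.cong refl) (simp add: spin_mean_prod_spin_prod)
  also have "\<dots> = (\<Sum>\<Gamma> | \<Gamma> \<subseteq> ?E \<and> even_hypergraph \<Gamma>. \<Prod>i\<in>\<Gamma>. ?t i)"
    by (intro sum.mono_neutral_cong_right) auto
  finally show ?thesis .
qed

lemma esym_eq_0:
  assumes "finite A" "card A < m"
  shows "esym m A y = 0"
proof -
  have "card B \<noteq> m" if "B \<subseteq> A" for B
    using card_mono[OF assms(1) that] assms(2) by linarith
  then have "{B. B \<subseteq> A \<and> card B = m} = {}" by blast
  then show ?thesis unfolding esym_def by (simp only: sum.empty)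
qed

text \<open>
  Multiplying by the energy moves an elementary symmetric polynomial of the edge variables one degree up
  and one degree down, both with nonnegative coefficients. Nonnegativity of the means passes from
  \<open>j\<close> to \<open>j + 1\<close>, starting from the counts at \<open>j = 0\<close>, and dropping
  the lower degree gives the second claim.
\<close>
lemma spin_mean_energy_edge_esym_step:
  "0 \<le> spin_mean N (\<lambda>\<sigma>. spin_energy N p \<sigma> ^ j * edge_esym N p m \<sigma>) \<and>
   real (Suc m) * spin_mean N (\<lambda>\<sigma>. spin_energy N p \<sigma> ^ j * edge_esym N p (Suc m) \<sigma>)
     \<le> spin_mean N (\<lambda>\<sigma>. spin_energy N p \<sigma> ^ Suc j * edge_esym N p m \<sigma>)"
proof (induction j arbitrary: m)
  have step: "real (Suc m) * spin_mean N (\<lambda>\<sigma>. spin_energy N p \<sigma> ^ j * edge_esym N p (Suc m) \<sigma>)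
     \<le> spin_mean N (\<lambda>\<sigma>. spin_energy N p \<sigma> ^ Suc j * edge_esym N p m \<sigma>)"
    if nn: "\<And>m. 0 \<le> spin_mean N (\<lambda>\<sigma>. spin_energy N p \<sigma> ^ j * edge_esym N p m \<sigma>)" for m j
  proof (cases m)
    case 0
    then show ?thesis
      by (simp add: esym_0 esym_1 spin_energy_def mult.commute)
  next
    case (Suc l)
    let ?M = "real (card (index_tuples N p))" and ?X = "spin_energy N p"
    have "spin_mean N (\<lambda>\<sigma>. ?X \<sigma> ^ Suc j * edge_esym N p m \<sigma>) =
        spin_mean N (\<lambda>\<sigma>. real (Suc m) * (?X \<sigma> ^ j * edge_esym N p (Suc m) \<sigma>)
          + (?M - real l) * (?X \<sigma> ^ j * edge_esym N p l \<sigma>))"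
    proof (rule spin_mean_cong)
      fix \<sigma> :: "nat \<Rightarrow> real"
      assume s: "\<And>v. v \<in> {1..N} \<Longrightarrow> \<sigma> v = -1 \<or> \<sigma> v = 1"
      have "real (Suc m) * edge_esym N p (Suc m) \<sigma> =
          ?X \<sigma> * edge_esym N p m \<sigma> - (?M - real l) * edge_esym N p l \<sigma>"
        using esym_recurrence[of "index_tuples N p" "spin_prod \<sigma>" l, OF finite_index_tuples
            spin_prod_sq[OF _ s]] Suc by (simp add: spin_energy_def)
      then have e: "?X \<sigma> * edge_esym N p m \<sigma> =
          real (Suc m) * edge_esym N p (Suc m) \<sigma> + (?M - real l) * edge_esym N p l \<sigma>" by linarith
      have "?X \<sigma> ^ Suc j * edge_esym N p m \<sigma> = ?X \<sigma> ^ j * (?X \<sigma> * edge_esym N p m \<sigma>)"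
        by simp
      then show "?X \<sigma> ^ Suc j * edge_esym N p m \<sigma> =
          real (Suc m) * (?X \<sigma> ^ j * edge_esym N p (Suc m) \<sigma>)
          + (?M - real l) * (?X \<sigma> ^ j * edge_esym N p l \<sigma>)"
        unfolding e by (simp only: distrib_left mult.left_commute)
    qed
    also have "\<dots> = real (Suc m) * spin_mean N (\<lambda>\<sigma>. ?X \<sigma> ^ j * edge_esym N p (Suc m) \<sigma>)
        + (?M - real l) * spin_mean N (\<lambda>\<sigma>. ?X \<sigma> ^ j * edge_esym N p l \<sigma>)"
      by (simp only: Bochner_Integration.integral_add integral_mult_right_zero integrable_spin_pmf)
    finally have eq: "spin_mean N (\<lambda>\<sigma>. ?X \<sigma> ^ Suc j * edge_esym N p m \<sigma>) =
        real (Suc m) * spin_mean N (\<lambda>\<sigma>. ?X \<sigma> ^ j * edge_esym N p (Suc m) \<sigma>)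
        + (?M - real l) * spin_mean N (\<lambda>\<sigma>. ?X \<sigma> ^ j * edge_esym N p l \<sigma>)" .
    have "0 \<le> (?M - real l) * spin_mean N (\<lambda>\<sigma>. ?X \<sigma> ^ j * edge_esym N p l \<sigma>)"
    proof (cases "l \<le> card (index_tuples N p)")
      case True
      then show ?thesis using nn[of l] by simp
    next
      case False
      then show ?thesis by (simp add: esym_eq_0)
    qed
    then show ?thesis unfolding eq by simp
  qed
  {
    case 0
    have "0 \<le> spin_mean N (\<lambda>\<sigma>. spin_energy N p \<sigma> ^ 0 * edge_esym N p m \<sigma>)" for m
      by (simp add: spin_mean_edge_esym)
    with step[of 0 m] show ?case by blast
  next
    case (Suc j)
    have "0 \<le> spin_mean N (\<lambda>\<sigma>. spin_energy N p \<sigma> ^ Suc j * edge_esym N p m \<sigma>)" for m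
      using Suc[of m] Suc[of "Suc m"]
      by (meson mult_nonneg_nonneg of_nat_0_le_iff order_trans)
    with step[of "Suc j" m] show ?case by blast
  }
qed

text \<open>
  The moment counts all \<open>m\<close>-tuples of edges whose symmetric difference is even, and every
  even hypergraph with \<open>m\<close> edges has \<open>m!\<close> orderings.
\<close>
lemma card_even_hypergraphs_le_moment:
  "fact m * real (card (even_hypergraphs N p m)) \<le> spin_mean N (\<lambda>\<sigma>. spin_energy N p \<sigma> ^ m)"
proof -
  have "fact (m + j) * real (card (even_hypergraphs N p (m + j)))
    \<le> fact m * spin_mean N (\<lambda>\<sigma>. spin_energy N p \<sigma> ^ j * edge_esym N p m \<sigma>)" for m j
  proof (induction j arbitrary: m)
    case 0
    then show ?case by (simp add: spin_mean_edge_esym)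
  next
    case (Suc j)
    have "fact (m + Suc j) * real (card (even_hypergraphs N p (m + Suc j)))
      \<le> fact (Suc m) * spin_mean N (\<lambda>\<sigma>. spin_energy N p \<sigma> ^ j * edge_esym N p (Suc m) \<sigma>)"
      using Suc[of "Suc m"] by simp
    also have "\<dots> = fact m * (real (Suc m) * spin_mean N (\<lambda>\<sigma>. spin_energy N p \<sigma> ^ j * edge_esym N p (Suc m) \<sigma>))"
      by simp
    also have "\<dots> \<le> fact m * spin_mean N (\<lambda>\<sigma>. spin_energy N p \<sigma> ^ Suc j * edge_esym N p m \<sigma>)"
      using spin_mean_energy_edge_esym_step[where ?j = j and ?m = m] by (intro mult_left_mono) auto
    finally show ?case .
  qed
  from this[of 0 m] show ?thesis by (simp add: esym_0)
qed

lemma exp_tail_le: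
  fixes z :: real
  shows "(\<Sum>m=k..M. z ^ m / fact m) \<le> \<bar>z\<bar> ^ k * exp \<bar>z\<bar>"
proof -
  have "(\<Sum>m=k..M. z ^ m / fact m) \<le> (\<Sum>m=k..M. \<bar>z\<bar> ^ k * (\<bar>z\<bar> ^ (m - k) / fact (m - k)))"
  proof (rule sum_mono)
    fix m assume m: "m \<in> {k..M}"
    have "z ^ m / fact m \<le> \<bar>z\<bar> ^ m / fact m"
      by (intro divide_right_mono) (auto simp: power_abs[symmetric])
    also have "\<dots> \<le> \<bar>z\<bar> ^ m / fact (m - k)"
      by (intro divide_left_mono fact_mono) auto
    also have "\<bar>z\<bar> ^ m = \<bar>z\<bar> ^ k * \<bar>z\<bar> ^ (m - k)" using m by (simp add: power_add[symmetric])
    finally show "z ^ m / fact m \<le> \<bar>z\<bar> ^ k * (\<bar>z\<bar> ^ (m - k) / fact (m - k))" by simp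
  qed
  also have "\<dots> = \<bar>z\<bar> ^ k * (\<Sum>m=k..M. \<bar>z\<bar> ^ (m - k) / fact (m - k))"
    by (simp add: sum_distrib_left)
  also have "(\<Sum>m=k..M. \<bar>z\<bar> ^ (m - k) / fact (m - k)) = (\<Sum>j\<in>(\<lambda>m. m - k) ` {k..M}. \<bar>z\<bar> ^ j / fact j)"
    by (subst sum.reindex) (auto simp: inj_on_def)
  also have "\<dots> \<le> exp \<bar>z\<bar>"
    unfolding exp_def
    using sum_le_suminf[OF summable_exp_generic[of "\<bar>z\<bar>"], of "(\<lambda>m. m - k) ` {k..M}"]
    by (simp add: field_simps scaleR_conv_of_real)
  finally show ?thesis by (simp add: mult_left_mono)
qed

text \<open>
  The variance of all terms with at least \<open>k\<close> edges, compared with the tail of an exponential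
  series.
\<close>
lemma even_hypergraph_sum_le:
  assumes "s \<ge> 0"
  shows "(\<Sum>m=k..M. s ^ m * real (card (even_hypergraphs N p m)))
    \<le> spin_mean N (\<lambda>\<sigma>. (s * \<bar>spin_energy N p \<sigma>\<bar>) ^ k * exp (s * \<bar>spin_energy N p \<sigma>\<bar>))"
proof -
  have "(\<Sum>m=k..M. s ^ m * real (card (even_hypergraphs N p m)))
    \<le> (\<Sum>m=k..M. s ^ m * (spin_mean N (\<lambda>\<sigma>. spin_energy N p \<sigma> ^ m) / fact m))"
    using assms card_even_hypergraphs_le_moment
    by (intro sum_mono mult_left_mono) (auto simp: field_simps)
  also have "\<dots> = spin_mean N (\<lambda>\<sigma>. \<Sum>m=k..M. (s * spin_energy N p \<sigma>) ^ m / fact m)"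
    by (simp add: Bochner_Integration.integral_sum power_mult_distrib)
  also have "\<dots> \<le> spin_mean N (\<lambda>\<sigma>. (s * \<bar>spin_energy N p \<sigma>\<bar>) ^ k * exp (s * \<bar>spin_energy N p \<sigma>\<bar>))"
  proof (rule spin_mean_mono)
    fix \<sigma>
    show "(\<Sum>m=k..M. (s * spin_energy N p \<sigma>) ^ m / fact m) \<le>
        (s * \<bar>spin_energy N p \<sigma>\<bar>) ^ k * exp (s * \<bar>spin_energy N p \<sigma>\<bar>)"
      using exp_tail_le[where ?z = "s * spin_energy N p \<sigma>" and ?k = k and ?M = M] assms
      by (simp add: abs_mult)
  qed
  finally show ?thesis .
qed

text \<open>
  The leading term \<open>x\<^sup>m\<close> keeps the constant one, which is what makes the bound sharp up
  to \<open>\<beta>\<^sub>f\<close>. The correction is smaller by a factor \<open>N\<close> at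
  \<open>x\<close> of order \<open>N\<close>.
\<close>
lemma krawtchouk_abs_le:
  "\<exists>C\<ge>0. \<forall>N\<ge>1. \<forall>x. \<bar>x\<bar> \<le> real N \<longrightarrow> \<bar>krawtchouk (real N) m x\<bar> \<le> \<bar>x\<bar> ^ m + C * real N ^ (m - 1)"
proof (induction m rule: less_induct)
  case (less m)
  show ?case
  proof (cases m rule: hermite_poly.cases)
    case 1
    then show ?thesis by (intro exI[of _ 0]) auto
  next
    case 2
    then show ?thesis by (intro exI[of _ 0]) auto
  next
    case (3 k)
    obtain C1 where C1: "C1 \<ge> 0" "\<And>N x. N \<ge> 1 \<Longrightarrow> \<bar>x\<bar> \<le> real N \<Longrightarrow>
        \<bar>krawtchouk (real N) (Suc k) x\<bar> \<le> \<bar>x\<bar> ^ Suc k + C1 * real N ^ k"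
      using less[of "Suc k"] 3 by auto
    obtain C0 where C0: "C0 \<ge> 0" "\<And>N x. N \<ge> 1 \<Longrightarrow> \<bar>x\<bar> \<le> real N \<Longrightarrow>
        \<bar>krawtchouk (real N) k x\<bar> \<le> \<bar>x\<bar> ^ k + C0 * real N ^ (k - 1)"
      using less[of k] 3 by auto
    define c where "c = real (Suc k)"
    define C where "C = C1 + c * c * (1 + C0)"
    have "\<bar>krawtchouk (real N) m x\<bar> \<le> \<bar>x\<bar> ^ m + C * real N ^ (m - 1)"
      if N: "N \<ge> 1" and x: "\<bar>x\<bar> \<le> real N" for N x
    proof -
      let ?n = "real N"
      have n: "?n \<ge> 1" using N by simp
      have a: "\<bar>x * krawtchouk ?n (Suc k) x\<bar> \<le> \<bar>x\<bar> ^ m + C1 * ?n ^ Suc k"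
      proof -
        have "\<bar>x * krawtchouk ?n (Suc k) x\<bar> \<le> \<bar>x\<bar> * (\<bar>x\<bar> ^ Suc k + C1 * ?n ^ k)"
          unfolding abs_mult using C1(2)[OF N x] by (intro mult_left_mono) auto
        also have "\<dots> = \<bar>x\<bar> ^ m + \<bar>x\<bar> * (C1 * ?n ^ k)" by (simp add: 3 algebra_simps)
        also have "\<bar>x\<bar> * (C1 * ?n ^ k) \<le> ?n * (C1 * ?n ^ k)"
          using x C1(1) by (intro mult_right_mono) auto
        finally show ?thesis by (simp add: mult_ac)
      qed
      have b: "\<bar>krawtchouk ?n k x\<bar> \<le> (1 + C0) * ?n ^ k"
      proof -
        have "\<bar>x\<bar> ^ k \<le> ?n ^ k" using x by (intro power_mono) auto
        moreover have "C0 * ?n ^ (k - 1) \<le> C0 * ?n ^ k"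
          using C0(1) n by (intro mult_left_mono power_increasing) auto
        ultimately show ?thesis using C0(2)[OF N x] by (simp add: algebra_simps)
      qed
      have d: "\<bar>?n - real k\<bar> \<le> c * ?n"
      proof -
        have "\<bar>?n - real k\<bar> \<le> ?n + real k * 1" by simp
        also have "\<dots> \<le> ?n + real k * ?n" using n by (intro add_mono mult_left_mono) auto
        finally show ?thesis by (simp add: c_def algebra_simps)
      qed
      have "\<bar>c * (?n - real k) * krawtchouk ?n k x\<bar> = c * (\<bar>?n - real k\<bar> * \<bar>krawtchouk ?n k x\<bar>)"
        by (simp add: abs_mult c_def)
      also have "\<dots> \<le> c * ((c * ?n) * ((1 + C0) * ?n ^ k))"
        using b d by (intro mult_left_mono mult_mono) (auto simp: c_def)
      finally have e: "\<bar>c * (?n - real k) * krawtchouk ?n k x\<bar> \<le> c * c * (1 + C0) * ?n ^ Suc k"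
        by (simp add: mult_ac)
      have "krawtchouk ?n m x = x * krawtchouk ?n (Suc k) x - c * (?n - real k) * krawtchouk ?n k x"
        by (simp add: 3 c_def)
      then have "\<bar>krawtchouk ?n m x\<bar> \<le> \<bar>x\<bar> ^ m + C1 * ?n ^ Suc k + c * c * (1 + C0) * ?n ^ Suc k"
        using a e by linarith
      then show ?thesis by (simp add: 3 C_def algebra_simps)
    qed
    moreover have "C \<ge> 0" using C0 C1 by (simp add: C_def c_def)
    ultimately show ?thesis by blast
  qed
qed

section \<open>The rate function and exponential moments of the energy\<close>

text \<open>
  \<open>I'(x) = artanh x \<ge> x\<close>.
\<close>
lemma rate_I_ge:
  assumes "0 \<le> x" "x \<le> 1"
  shows "x\<^sup>2 / 2 \<le> rate_I x"
proof (cases "x = 1")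
  case True
  have "(1::real) / 2 \<le> ln 2" using ln2_ge_two_thirds by simp
  then show ?thesis using True by (simp add: rate_I_def)
next
  case False
  have ln_diff: "2 * t \<le> ln (1 + t) - ln (1 - t)" if t: "0 \<le> t" "t < 1" for t :: real
  proof -
    have "ln (1 + 0) - ln (1 - 0) - 2 * 0 \<le> ln (1 + t) - ln (1 - t) - 2 * t"
    proof (rule DERIV_nonneg_imp_nondecreasing[OF t(1)])
      fix y assume y: "0 \<le> y" "y \<le> t"
      have "((\<lambda>y. ln (1 + y) - ln (1 - y) - 2 * y) has_real_derivative
          (1 / (1 + y) + 1 / (1 - y) - 2)) (at y)"
        using y t by (auto intro!: derivative_eq_intros)
      moreover have "1 / (1 + y) + 1 / (1 - y) - 2 \<ge> 0"
      proof -
        have "1 / (1 + y) + 1 / (1 - y) - 2 = 2 * y\<^sup>2 / ((1 + y) * (1 - y))"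
          using y t by (simp add: divide_simps power2_eq_square) (simp add: algebra_simps)
        then show ?thesis using y t by simp
      qed
      ultimately show "\<exists>d. ((\<lambda>y. ln (1 + y) - ln (1 - y) - 2 * y) has_real_derivative d) (at y) \<and> 0 \<le> d"
        by blast
    qed
    then show ?thesis by simp
  qed
  have "rate_I 0 - 0\<^sup>2 / 2 \<le> rate_I x - x\<^sup>2 / 2"
  proof (rule DERIV_nonneg_imp_nondecreasing[OF assms(1)])
    fix y assume y: "0 \<le> y" "y \<le> x"
    then have y1: "y < 1" using assms False by simp
    have "((\<lambda>y. rate_I y - y\<^sup>2 / 2) has_real_derivative ((ln (1 + y) - ln (1 - y)) / 2 - y)) (at y)"
      unfolding rate_I_def using y y1
      by (auto intro!: derivative_eq_intros) (simp add: field_simps)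
    then show "\<exists>d. ((\<lambda>y. rate_I y - y\<^sup>2 / 2) has_real_derivative d) (at y) \<and> 0 \<le> d"
      using ln_diff[OF y(1) y1] by (intro exI conjI) auto
  qed
  then show ?thesis by (simp add: rate_I_def)
qed

lemma beta_f_nonneg: "beta_f p \<ge> 0"
proof -
  have "{0<..<1::real} \<noteq> {}" by simp
  then show ?thesis
    unfolding beta_f_def
  proof (rule cINF_greatest)
    fix x :: real assume "x \<in> {0<..<1}"
    then show "0 \<le> sqrt (fact p * rate_I x / x ^ p)"
      using order_trans[OF _ rate_I_ge[of x]] by simp
  qed
qed

text \<open>
  The endpoint \<open>x = 1\<close>, where all spins agree, lies outside the infimum that defines
  \<open>\<beta>\<^sub>f\<close>; there \<open>I(1) = ln 2\<close> bounds \<open>I\<close> from above on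
  \<open>(0, 1)\<close>, and \<open>y \<rightarrow> 1\<close> is taken on the other side.
\<close>
lemma beta_f_rate:
  assumes "0 < x" "x \<le> 1"
  shows "(beta_f p)\<^sup>2 * x ^ p / fact p \<le> rate_I x"
proof -
  have less1: "(beta_f p)\<^sup>2 * y ^ p / fact p \<le> rate_I y" if y: "0 < y" "y < 1" for y
  proof -
    have I: "0 \<le> rate_I y" using y by (intro order_trans[OF _ rate_I_ge]) auto
    have "beta_f p \<le> sqrt (fact p * rate_I y / y ^ p)"
      unfolding beta_f_def
    proof (rule cINF_lower)
      show "bdd_below ((\<lambda>x. sqrt (fact p * rate_I x / x ^ p)) ` {0<..<1})"
        using order_trans[OF _ rate_I_ge] by (intro bdd_belowI[of _ 0]) auto
    qed (use y in auto)
    then have "(beta_f p)\<^sup>2 \<le> (sqrt (fact p * rate_I y / y ^ p))\<^sup>2"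
      using beta_f_nonneg by (intro power_mono)
    also have "\<dots> = fact p * rate_I y / y ^ p" using y I by simp
    finally show ?thesis using y by (simp add: field_simps)
  qed
  show ?thesis
  proof (cases "x < 1")
    case True
    then show ?thesis using less1 assms by simp
  next
    case False
    then have x: "x = 1" using assms by simp
    have "(beta_f p)\<^sup>2 / fact p \<le> ln 2"
    proof (cases "p = 0")
      case True
      have "(beta_f p)\<^sup>2 / fact p \<le> rate_I (1/2)" using less1[of "1/2"] True by simp
      also have "\<dots> \<le> ln 2"
      proof -
        have "rate_I (1/2) = 3 / 4 * ln (3 / 2) + 1 / 4 * ln (1 / 2)" by (simp add: rate_I_def)
        also have "\<dots> \<le> 3 / 4 * ln 2 + 1 / 4 * 0" by (intro add_mono mult_left_mono) auto
        also have "\<dots> \<le> ln 2" by simp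
        finally show ?thesis .
      qed
      finally show ?thesis .
    next
      case False
      show ?thesis
      proof (rule field_le_mult_one_interval)
        fix z :: real assume z: "0 < z" "z < 1"
        define y where "y = root p z"
        have y: "0 < y" "y < 1" "y ^ p = z" using z False by (auto simp: y_def)
        have "z * ((beta_f p)\<^sup>2 / fact p) \<le> rate_I y"
          using less1[OF y(1,2)] y(3) by (simp add: mult.commute)
        also have "rate_I y \<le> ln 2"
        proof -
          have "(1 + y) * ln (1 + y) \<le> 2 * ln 2" using y by (intro mult_mono) auto
          moreover have "(1 - y) * ln (1 - y) \<le> 0" using y by (intro mult_nonneg_nonpos) auto
          ultimately show ?thesis by (simp add: rate_I_def)
        qed
        finally show "z * ((beta_f p)\<^sup>2 / fact p) \<le> ln 2" .
      qed
    qed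
    then show ?thesis by (simp add: x rate_I_def)
  qed
qed

abbreviation spin_sum :: "nat \<Rightarrow> (nat \<Rightarrow> real) \<Rightarrow> real" where
  "spin_sum N \<sigma> \<equiv> \<Sum>v\<in>{1..N}. \<sigma> v"

lemma spin_sum_abs_le:
  assumes "\<And>v. v \<in> {1..N} \<Longrightarrow> \<sigma> v = -1 \<or> \<sigma> v = 1"
  shows "\<bar>spin_sum N \<sigma>\<bar> \<le> real N"
proof -
  have "\<bar>spin_sum N \<sigma>\<bar> \<le> (\<Sum>v\<in>{1..N}. \<bar>\<sigma> v\<bar>)" by (rule sum_abs)
  also have "\<dots> = (\<Sum>v\<in>{1..N}. 1)" using assms by (intro sum.cong refl) force
  finally show ?thesis by simp
qed

lemma spin_sum_int:
  assumes "\<And>v. v \<in> {1..N} \<Longrightarrow> \<sigma> v = -1 \<or> \<sigma> v = 1"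
  shows "\<exists>j\<in>{- int N..int N}. spin_sum N \<sigma> = of_int j"
proof -
  define j where "j = (\<Sum>v\<in>{1..N}. \<lfloor>\<sigma> v\<rfloor>)"
  have "spin_sum N \<sigma> = (\<Sum>v\<in>{1..N}. of_int \<lfloor>\<sigma> v\<rfloor>)"
    using assms by (intro sum.cong refl) force
  then have j: "spin_sum N \<sigma> = of_int j" by (simp add: j_def)
  then have "\<bar>j\<bar> \<le> int N" using spin_sum_abs_le[of N \<sigma>, OF assms] by linarith
  then show ?thesis using j by (intro bexI[of _ j]) auto
qed

text \<open>
  The density, relative to the uniform law, of independent spins with mean \<open>x\<close> depends on the
  spin sum only, and at magnetisation \<open>x\<close> it equals \<open>exp (N I(x))\<close>.
\<close>
lemma exp_rate_eq_tilt:
  assumes \<sigma>: "\<And>v. v \<in> {1..N} \<Longrightarrow> \<sigma> v = -1 \<or> \<sigma> v = 1" and N: "N \<ge> 1"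
    and S: "spin_sum N \<sigma> = real N * x" and x: "\<bar>x\<bar> \<le> 1"
  shows "exp (N * rate_I \<bar>x\<bar>) = (\<Prod>v\<in>{1..N}. 1 + x * \<sigma> v)"
proof (cases "\<bar>x\<bar> < 1")
  case True
  let ?a = "ln (1 + x)" and ?b = "ln (1 - x)"
  have "(\<Prod>v\<in>{1..N}. 1 + x * \<sigma> v) = (\<Prod>v\<in>{1..N}. exp ((?a + ?b) / 2 + \<sigma> v * ((?a - ?b) / 2)))"
  proof (intro prod.cong refl)
    fix v assume "v \<in> {1..N}"
    then consider "\<sigma> v = 1" | "\<sigma> v = -1" using \<sigma> by blast
    then show "1 + x * \<sigma> v = exp ((?a + ?b) / 2 + \<sigma> v * ((?a - ?b) / 2))"
    proof cases
      case 1
      have "(?a + ?b) / 2 + \<sigma> v * ((?a - ?b) / 2) = ?a" using 1 by (simp add: field_simps)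
      then show ?thesis using 1 True by simp
    next
      case 2
      have "(?a + ?b) / 2 + \<sigma> v * ((?a - ?b) / 2) = ?b" using 2 by (simp add: field_simps)
      then show ?thesis using 2 True by simp
    qed
  qed
  also have "\<dots> = exp (\<Sum>v\<in>{1..N}. (?a + ?b) / 2 + \<sigma> v * ((?a - ?b) / 2))"
    by (simp add: exp_sum)
  also have "(\<Sum>v\<in>{1..N}. (?a + ?b) / 2 + \<sigma> v * ((?a - ?b) / 2))
      = N * ((?a + ?b) / 2) + (N * x) * ((?a - ?b) / 2)"
    by (simp only: sum.distrib sum_distrib_right[symmetric] S) simp
  also have "\<dots> = N * rate_I x" by (simp add: rate_I_def field_simps)
  also have "rate_I x = rate_I \<bar>x\<bar>" by (simp add: rate_I_def abs_if algebra_simps)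
  finally show ?thesis by simp
next
  case False
  then have x1: "\<bar>x\<bar> = 1" using x by simp
  then have xx: "x * x = 1" by (auto simp: abs_if split: if_splits)
  have "x * \<sigma> v = 1" if v: "v \<in> {1..N}" for v
  proof (rule sum_mono_inv[of "\<lambda>v. x * \<sigma> v" "{1..N}" "\<lambda>_. 1"])
    have "(\<Sum>v\<in>{1..N}. x * \<sigma> v) = x * (N * x)" by (simp only: sum_distrib_left[symmetric] S)
    also have "\<dots> = N * (x * x)" by simp
    finally show "(\<Sum>v\<in>{1..N}. x * \<sigma> v) = (\<Sum>v\<in>{1..N}. 1)" using xx by simp
    fix w assume "w \<in> {1..N}"
    then show "x * \<sigma> w \<le> 1" using \<sigma>[of w] x1 by (auto simp: abs_if split: if_splits)
  qed (use v in auto)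
  then have "(\<Prod>v\<in>{1..N}. 1 + x * \<sigma> v) = (\<Prod>v\<in>{1..N}. 2)" by (intro prod.cong refl) simp
  also have "\<dots> = exp (N * ln 2)" by (simp add: exp_of_nat_mult)
  finally show ?thesis by (simp add: x1 rate_I_def)
qed

text \<open>
  The tilted density has total mass one, so each value of the spin sum has probability at most \<open>exp
  (- N I)\<close>.
\<close>
lemma spin_mean_rate_atom:
  assumes N: "N \<ge> 1" and j: "j \<in> {- int N..int N}"
  shows "spin_mean N (\<lambda>\<sigma>. of_bool (spin_sum N \<sigma> = of_int j) * exp (N * rate_I (\<bar>of_int j\<bar> / N))) \<le> 1"
proof -
  define x where "x = of_int j / real N"
  have "\<bar>of_int j :: real\<bar> \<le> real N" using j by auto
  then have x: "\<bar>x\<bar> \<le> 1" "\<bar>x\<bar> = \<bar>of_int j\<bar> / N" using N by (auto simp: x_def)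
  have "spin_mean N (\<lambda>\<sigma>. of_bool (spin_sum N \<sigma> = of_int j) * exp (N * rate_I (\<bar>of_int j\<bar> / N)))
      \<le> spin_mean N (\<lambda>\<sigma>. \<Prod>v\<in>{1..N}. 1 + x * \<sigma> v)"
  proof (rule spin_mean_mono)
    fix \<sigma> :: "nat \<Rightarrow> real" assume \<sigma>: "\<And>v. v \<in> {1..N} \<Longrightarrow> \<sigma> v = -1 \<or> \<sigma> v = 1"
    have nn: "0 \<le> (\<Prod>v\<in>{1..N}. 1 + x * \<sigma> v)"
    proof (rule prod_nonneg)
      fix v assume "v \<in> {1..N}"
      then show "0 \<le> 1 + x * \<sigma> v" using \<sigma>[of v] x(1) by (auto simp: abs_le_iff)
    qed
    show "of_bool (spin_sum N \<sigma> = of_int j) * exp (N * rate_I (\<bar>of_int j\<bar> / N)) \<le> (\<Prod>v\<in>{1..N}. 1 + x * \<sigma> v)"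
    proof (cases "spin_sum N \<sigma> = of_int j")
      case True
      then have "spin_sum N \<sigma> = real N * x" using N by (simp add: x_def)
      from exp_rate_eq_tilt[of N \<sigma>, OF \<sigma> N this x(1)] show ?thesis using True x(2) by simp
    qed (use nn in simp)
  qed
  also have "\<dots> = 1" by (subst spin_mean_prod) simp
  finally show ?thesis .
qed

lemma spin_mean_rate_tail:
  assumes N: "N \<ge> 1" and "0 \<le> \<epsilon>" and "0 \<le> r"
  shows "spin_mean N (\<lambda>\<sigma>. of_bool (r \<le> \<bar>spin_sum N \<sigma>\<bar> / N) *
      exp ((1 - \<epsilon>) * (N * rate_I (\<bar>spin_sum N \<sigma>\<bar> / N))))
    \<le> (2 * real N + 1) * exp (- \<epsilon> * (N * r\<^sup>2 / 2))"
proof -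
  let ?J = "{- int N..int N}" and ?S = "spin_sum N"
  let ?f = "\<lambda>j \<sigma>. of_bool (?S \<sigma> = of_int j) * exp (N * rate_I (\<bar>of_int j\<bar> / N)) :: real"
  let ?q = "exp (- \<epsilon> * (N * r\<^sup>2 / 2))"
  have "spin_mean N (\<lambda>\<sigma>. of_bool (r \<le> \<bar>?S \<sigma>\<bar> / N) * exp ((1 - \<epsilon>) * (N * rate_I (\<bar>?S \<sigma>\<bar> / N))))
      \<le> spin_mean N (\<lambda>\<sigma>. \<Sum>j\<in>?J. ?f j \<sigma> * ?q)"
  proof (rule spin_mean_mono)
    fix \<sigma> :: "nat \<Rightarrow> real" assume \<sigma>: "\<And>v. v \<in> {1..N} \<Longrightarrow> \<sigma> v = -1 \<or> \<sigma> v = 1"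
    obtain j where j: "j \<in> ?J" "?S \<sigma> = of_int j" using spin_sum_int[of N \<sigma>, OF \<sigma>] by blast
    let ?x = "\<bar>?S \<sigma>\<bar> / N"
    have x: "0 \<le> ?x" "?x \<le> 1" using spin_sum_abs_le[of N \<sigma>, OF \<sigma>] N by auto
    have "of_bool (r \<le> ?x) * exp ((1 - \<epsilon>) * (N * rate_I ?x)) \<le> exp (N * rate_I ?x) * ?q"
    proof (cases "r \<le> ?x")
      case True
      have "r\<^sup>2 / 2 \<le> ?x\<^sup>2 / 2" using True \<open>0 \<le> r\<close> by (intro divide_right_mono power_mono) auto
      also have "\<dots> \<le> rate_I ?x" by (rule rate_I_ge[OF x])
      finally have "\<epsilon> * (N * (r\<^sup>2 / 2)) \<le> \<epsilon> * (N * rate_I ?x)"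
        using \<open>0 \<le> \<epsilon>\<close> by (intro mult_left_mono) auto
      then have "(1 - \<epsilon>) * (N * rate_I ?x) \<le> N * rate_I ?x + - \<epsilon> * (N * r\<^sup>2 / 2)"
        by (simp add: algebra_simps)
      then show ?thesis using True by (simp add: exp_add[symmetric])
    qed simp
    also have "\<dots> = ?f j \<sigma> * ?q" by (simp add: j(2) del: One_nat_def)
    also have "\<dots> \<le> (\<Sum>j\<in>?J. ?f j \<sigma> * ?q)"
      using j(1) by (intro member_le_sum) auto
    finally show "of_bool (r \<le> ?x) * exp ((1 - \<epsilon>) * (N * rate_I ?x)) \<le> (\<Sum>j\<in>?J. ?f j \<sigma> * ?q)" .
  qed
  also have "\<dots> = (\<Sum>j\<in>?J. spin_mean N (?f j) * ?q)"
    by (simp add: Bochner_Integration.integral_sum)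
  also have "\<dots> \<le> (\<Sum>j\<in>?J. 1 * ?q)"
    using spin_mean_rate_atom[OF N] by (intro sum_mono mult_right_mono) auto
  also have "\<dots> = (2 * real N + 1) * ?q" by simp
  finally show ?thesis by (simp add: add.commute)
qed

lemma power_le_exp:
  fixes z :: real
  assumes "0 \<le> z" "0 < d"
  shows "z ^ m \<le> fact m / d ^ m * exp (d * z)"
proof -
  have "(d * z) ^ m / fact m \<le> exp (d * z)"
    unfolding exp_def
    using sum_le_suminf[OF summable_exp_generic[of "d * z"], of "{m}"] assms
    by (simp add: field_simps scaleR_conv_of_real)
  then show ?thesis using assms by (simp add: field_simps power_mult_distrib)
qed

lemma spin_energy_krawtchouk:
  assumes "\<And>v. v \<in> {1..N} \<Longrightarrow> \<sigma> v = -1 \<or> \<sigma> v = 1"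
  shows "fact p * spin_energy N p \<sigma> = krawtchouk (real N) p (spin_sum N \<sigma>)"
proof -
  have "(\<sigma> v)\<^sup>2 = 1" if "v \<in> {1..N}" for v using assms[OF that] by auto
  from fact_esym[of "{1..N}" \<sigma> p, OF _ this] show ?thesis by (simp add: spin_energy_esym)
qed

text \<open>
  Where \<open>s |X|\<close> is below a constant \<open>T\<close> the exponential is harmless. Where it
  exceeds \<open>T\<close> the absolute magnetisation is at least
  \<open>N\<^sup>-\<^sup>1\<^sup>/\<^sup>p\<close>, and an exponent \<open>\<epsilon>\<close> with
  \<open>(1 + \<epsilon>) \<beta>\<^sup>2 = (1 - \<epsilon>) \<beta>\<^sub>f\<^sup>2\<close> leaves both
  room to absorb the power of \<open>s |X|\<close> and the factor \<open>exp (- \<epsilon> N I)\<close>.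
  As \<open>I(x) \<ge> x\<^sup>2 / 2\<close>, that factor is at most \<open>exp (- \<epsilon>
  N\<^sup>1\<^sup>-\<^sup>2\<^sup>/\<^sup>p / 2)\<close>, and \<open>1 - 2 / p \<ge> 1 / 3\<close>.
\<close>
lemma spin_mean_energy_exp_le:
  assumes p: "p \<ge> 3" and \<beta>: "0 < \<beta>" "\<beta> < beta_f p"
  shows "\<exists>B C c. 0 \<le> B \<and> 0 \<le> C \<and> 0 < c \<and> (\<forall>N\<ge>1. \<forall>s. 0 \<le> s \<longrightarrow> s \<le> \<beta>\<^sup>2 / real N ^ (p - 1) \<longrightarrow>
    spin_mean N (\<lambda>\<sigma>. (s * \<bar>spin_energy N p \<sigma>\<bar>) ^ m * exp (s * \<bar>spin_energy N p \<sigma>\<bar>))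
      \<le> B * spin_mean N (\<lambda>\<sigma>. (s * \<bar>spin_energy N p \<sigma>\<bar>) ^ m)
        + C * ((2 * real N + 1) * exp (- c * real N powr (1 / 3))))"
proof -
  obtain D where D: "D \<ge> 0" "\<And>N x. N \<ge> 1 \<Longrightarrow> \<bar>x\<bar> \<le> real N \<Longrightarrow>
      \<bar>krawtchouk (real N) p x\<bar> \<le> \<bar>x\<bar> ^ p + D * real N ^ (p - 1)"
    using krawtchouk_abs_le[of p] by blast
  define b where "b = \<beta>\<^sup>2"
  \<comment> \<open>the solution of \<open>(1 + \<epsilon>) b = (1 - \<epsilon>) \<beta>\<^sub>f\<^sup>2\<close>\<close>
  define \<epsilon> where "\<epsilon> = ((beta_f p)\<^sup>2 - b) / ((beta_f p)\<^sup>2 + b)"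
  have b: "0 < b" "b < (beta_f p)\<^sup>2"
    using \<beta> by (auto simp: b_def intro!: power_strict_mono)
  have \<epsilon>: "0 < \<epsilon>" "\<epsilon> < 1" "(1 + \<epsilon>) * b = (1 - \<epsilon>) * (beta_f p)\<^sup>2"
    using b by (auto simp: \<epsilon>_def field_simps)
  \<comment> \<open>the bound for \<open>s |X|\<close> at magnetisation \<open>N\<^sup>-\<^sup>1\<^sup>/\<^sup>p\<close>, where \<open>N x\<^sup>p = 1\<close>\<close>
  define T where "T = b / fact p * (1 + D)"
  define L where "L = fact m / \<epsilon> ^ m * exp ((1 + \<epsilon>) * (b / fact p * D))"
  have "spin_mean N (\<lambda>\<sigma>. (s * \<bar>spin_energy N p \<sigma>\<bar>) ^ m * exp (s * \<bar>spin_energy N p \<sigma>\<bar>))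
      \<le> exp T * spin_mean N (\<lambda>\<sigma>. (s * \<bar>spin_energy N p \<sigma>\<bar>) ^ m)
        + L * ((2 * real N + 1) * exp (- (\<epsilon> / 2) * real N powr (1 / 3)))"
    if N: "N \<ge> 1" and s: "0 \<le> s" "s \<le> \<beta>\<^sup>2 / real N ^ (p - 1)" for N s
  proof -
    define r where "r = real N powr (- 1 / p)"
    let ?z = "\<lambda>\<sigma>. s * \<bar>spin_energy N p \<sigma>\<bar>" and ?S = "spin_sum N"
    let ?g = "\<lambda>\<sigma>. of_bool (r \<le> \<bar>?S \<sigma>\<bar> / N) * exp ((1 - \<epsilon>) * (N * rate_I (\<bar>?S \<sigma>\<bar> / N))) :: real"
    have n: "real N \<ge> 1" using N by simp
    have rp: "r ^ p = 1 / N"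
    proof -
      have "r ^ p = r powr p" using n by (simp add: r_def powr_realpow)
      also have "\<dots> = real N powr (- 1 / p * p)" unfolding r_def by (rule powr_powr)
      also have "- 1 / real p * real p = - 1" using p by simp
      finally show ?thesis using n by (simp add: powr_minus_divide)
    qed
    have "spin_mean N (\<lambda>\<sigma>. ?z \<sigma> ^ m * exp (?z \<sigma>))
        \<le> spin_mean N (\<lambda>\<sigma>. exp T * ?z \<sigma> ^ m + L * ?g \<sigma>)"
    proof (rule spin_mean_mono)
      fix \<sigma> :: "nat \<Rightarrow> real" assume \<sigma>: "\<And>v. v \<in> {1..N} \<Longrightarrow> \<sigma> v = -1 \<or> \<sigma> v = 1"
      let ?x = "\<bar>?S \<sigma>\<bar> / N"
      have x: "0 \<le> ?x" "?x \<le> 1" using spin_sum_abs_le[of N \<sigma>, OF \<sigma>] N by auto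
      have z0: "0 \<le> ?z \<sigma>" using s by simp
      have L0: "0 \<le> L" using \<epsilon> by (simp add: L_def)
      have e: "krawtchouk (real N) p (?S \<sigma>) = fact p * spin_energy N p \<sigma>"
        by (rule spin_energy_krawtchouk[of N \<sigma> p, OF \<sigma>, symmetric])
      have "fact p * \<bar>spin_energy N p \<sigma>\<bar> = \<bar>krawtchouk (real N) p (?S \<sigma>)\<bar>"
        unfolding e by (simp add: abs_mult)
      also have "\<dots> \<le> \<bar>?S \<sigma>\<bar> ^ p + D * real N ^ (p - 1)"
        by (rule D(2)[OF N spin_sum_abs_le[of N \<sigma>, OF \<sigma>]])
      also have "\<bar>?S \<sigma>\<bar> ^ p = N ^ (p - 1) * (N * ?x ^ p)"
      proof -
        have "N ^ (p - 1) * (N * ?x ^ p) = (N ^ (p - 1) * N) * ?x ^ p" by simp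
        also have "real (N ^ (p - 1) * N) = real N ^ p" using p by (cases p) auto
        finally show ?thesis using n by (simp add: power_divide)
      qed
      finally have X: "\<bar>spin_energy N p \<sigma>\<bar> \<le> (N ^ (p - 1) * (N * ?x ^ p) + D * real N ^ (p - 1)) / fact p"
        by (simp add: field_simps)
      have "?z \<sigma> \<le> (b / real N ^ (p - 1)) * ((N ^ (p - 1) * (N * ?x ^ p) + D * real N ^ (p - 1)) / fact p)"
        using s X unfolding b_def by (intro mult_mono) auto
      also have "\<dots> = b / fact p * (N * ?x ^ p + D)" using n by (simp add: field_simps)
      finally have z: "?z \<sigma> \<le> b / fact p * (N * ?x ^ p + D)" .
      show "?z \<sigma> ^ m * exp (?z \<sigma>) \<le> exp T * ?z \<sigma> ^ m + L * ?g \<sigma>"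
      proof (cases "?z \<sigma> \<le> T")
        case True
        then have "?z \<sigma> ^ m * exp (?z \<sigma>) \<le> ?z \<sigma> ^ m * exp T"
          using z0 by (intro mult_left_mono) auto
        moreover have "0 \<le> L * ?g \<sigma>" using L0 by simp
        ultimately show ?thesis by (simp add: mult.commute)
      next
        case False
        have rx: "r \<le> ?x"
        proof -
          have "T < b / fact p * (N * ?x ^ p + D)" using False z by linarith
          moreover have "0 < b / fact p" using b(1) by simp
          ultimately have "1 + D < N * ?x ^ p + D"
            unfolding T_def by (simp only: mult_less_cancel_left_pos)
          then have "r ^ p < ?x ^ p" unfolding rp using n by (simp add: field_simps)
          then have "r < ?x" using x(1) by (rule power_less_imp_less_base)
          then show ?thesis by simp
        qed
        have x0: "0 < ?x"
        proof -
          have "0 < r" unfolding r_def using n by simp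
          then show ?thesis using rx by linarith
        qed
        have "?z \<sigma> ^ m * exp (?z \<sigma>) \<le> (fact m / \<epsilon> ^ m * exp (\<epsilon> * ?z \<sigma>)) * exp (?z \<sigma>)"
          using power_le_exp[OF z0 \<epsilon>(1), of m] by (intro mult_right_mono) auto
        also have "\<dots> = fact m / \<epsilon> ^ m * exp ((1 + \<epsilon>) * ?z \<sigma>)"
          by (simp add: exp_add[symmetric] algebra_simps)
        also have "\<dots> \<le> fact m / \<epsilon> ^ m * exp ((1 + \<epsilon>) * (b / fact p * D) + (1 - \<epsilon>) * (N * rate_I ?x))"
        proof (intro mult_left_mono)
          have "(1 + \<epsilon>) * ?z \<sigma> \<le> (1 + \<epsilon>) * (b / fact p * (N * ?x ^ p + D))"
            using z \<epsilon> by (intro mult_left_mono) auto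
          also have "\<dots> = (1 + \<epsilon>) * (b / fact p * D) + N * (((1 + \<epsilon>) * b) * ?x ^ p / fact p)"
          proof -
            have "(1 + \<epsilon>) * (b / f * (n * w + D)) = (1 + \<epsilon>) * (b / f * D) + n * (((1 + \<epsilon>) * b) * w / f)"
              for f n w :: real by (simp add: algebra_simps add_divide_distrib)
            then show ?thesis .
          qed
          also have "N * (((1 + \<epsilon>) * b) * ?x ^ p / fact p) = N * ((1 - \<epsilon>) * ((beta_f p)\<^sup>2 * ?x ^ p / fact p))"
            unfolding \<epsilon>(3) by simp
          also have "\<dots> \<le> N * ((1 - \<epsilon>) * rate_I ?x)"
            using \<epsilon> by (intro mult_left_mono beta_f_rate[OF x0 x(2)]) auto
          finally show "exp ((1 + \<epsilon>) * ?z \<sigma>) \<le> exp ((1 + \<epsilon>) * (b / fact p * D) + (1 - \<epsilon>) * (N * rate_I ?x))"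
            by (simp add: mult.left_commute)
        qed (use \<epsilon> in auto)
        also have "\<dots> = L * ?g \<sigma>" using rx by (simp add: L_def exp_add)
        finally have "?z \<sigma> ^ m * exp (?z \<sigma>) \<le> L * ?g \<sigma>" .
        moreover have "0 \<le> exp T * ?z \<sigma> ^ m" using z0 by simp
        ultimately show ?thesis by linarith
      qed
    qed
    also have "\<dots> = exp T * spin_mean N (\<lambda>\<sigma>. ?z \<sigma> ^ m) + L * spin_mean N ?g" by simp
    finally have main: "spin_mean N (\<lambda>\<sigma>. ?z \<sigma> ^ m * exp (?z \<sigma>))
        \<le> exp T * spin_mean N (\<lambda>\<sigma>. ?z \<sigma> ^ m) + L * spin_mean N ?g" .
    have g: "spin_mean N ?g \<le> (2 * real N + 1) * exp (- (\<epsilon> / 2) * real N powr (1 / 3))"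
    proof -
      have "0 \<le> r" by (simp add: r_def)
      have "spin_mean N ?g \<le> (2 * real N + 1) * exp (- \<epsilon> * (N * r\<^sup>2 / 2))"
        by (rule spin_mean_rate_tail[OF N _ \<open>0 \<le> r\<close>]) (use \<epsilon> in auto)
      also have "\<dots> \<le> (2 * real N + 1) * exp (- (\<epsilon> / 2) * real N powr (1 / 3))"
      proof -
        have "N * r\<^sup>2 = real N powr 1 * (real N powr (- 1 / p) * real N powr (- 1 / p))"
          using n by (simp add: r_def power2_eq_square)
        also have "\<dots> = real N powr (1 + (- 1 / p + - 1 / p))" by (simp only: powr_add)
        also have "\<dots> \<ge> real N powr (1 / 3)"
          using n p by (intro powr_mono) (auto simp: field_simps)
        finally have "\<epsilon> / 2 * real N powr (1 / 3) \<le> \<epsilon> / 2 * (N * r\<^sup>2)"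
          using \<epsilon> by (intro mult_left_mono) auto
        then have "exp (- \<epsilon> * (N * r\<^sup>2 / 2)) \<le> exp (- (\<epsilon> / 2) * real N powr (1 / 3))" by simp
        then show ?thesis by (intro mult_left_mono) auto
      qed
      finally show ?thesis .
    qed
    have "0 \<le> L" using \<epsilon> by (simp add: L_def)
    from main mult_left_mono[OF g this] show ?thesis by linarith
  qed
  moreover have "0 \<le> L" "0 < \<epsilon> / 2" "0 \<le> exp T" using \<epsilon> by (auto simp: L_def)
  ultimately show ?thesis by blast
qed

section \<open>Asymptotics of the counts\<close>

lemma binomial_over_power_tendsto:
  "(\<lambda>N. real (N choose p) / real N ^ p) \<longlonglongrightarrow> 1 / fact p"
proof -
  have "\<forall>\<^sub>F N in sequentially. (\<Prod>i = 0..<p. 1 - real i / real N) / fact p = real (N choose p) / real N ^ p"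
    using eventually_gt_at_top[of 0]
  proof eventually_elim
    case (elim N)
    have "real (N choose p) / real N ^ p = (\<Prod>i = 0..<p. (real N - real i) / real N) / fact p"
      by (simp add: binomial_gbinomial gbinomial_prod_rev prod_dividef)
    also have "(\<Prod>i = 0..<p. (real N - real i) / real N) = (\<Prod>i = 0..<p. 1 - real i / real N)"
      using elim by (intro prod.cong) (auto simp: field_simps)
    finally show ?case by simp
  qed
  moreover have "(\<lambda>N. (\<Prod>i = 0..<p. 1 - real i / real N) / fact p) \<longlonglongrightarrow> (\<Prod>i = 0..<p. 1 - 0) / fact p"
    by (intro tendsto_intros lim_const_over_n) auto
  ultimately show ?thesis using tendsto_cong by force
qed

lemma binomial_at_top:
  assumes "p \<ge> 1"
  shows "filterlim (\<lambda>N. real (N choose p)) at_top sequentially"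
proof -
  have "filterlim (\<lambda>N. real N ^ p) at_top sequentially"
    using assms by (intro filterlim_pow_at_top filterlim_real_sequentially) auto
  then have "filterlim (\<lambda>N. real (N choose p) / real N ^ p * real N ^ p) at_top sequentially"
    by (intro filterlim_tendsto_pos_mult_at_top[OF binomial_over_power_tendsto[of p]]) auto
  moreover have ev: "\<forall>\<^sub>F N in sequentially. real (N choose p) / real N ^ p * real N ^ p = real (N choose p)"
    using eventually_gt_at_top[of 0] by eventually_elim auto
  ultimately show ?thesis using filterlim_cong[OF refl refl ev] by blast
qed

lemma moments_conv_cong:
  assumes "moments_conv Y Q"
    and "\<forall>\<^sub>F N in sequentially. \<forall>\<sigma>. (\<forall>v\<in>{1..N}. \<sigma> v = -1 \<or> \<sigma> v = 1) \<longrightarrow> Y N \<sigma> = Y' N \<sigma>"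
  shows "moments_conv Y' Q"
  unfolding moments_conv_def
proof
  fix j
  have "\<forall>\<^sub>F N in sequentially. spin_mean N (\<lambda>\<sigma>. Y N \<sigma> ^ j) = spin_mean N (\<lambda>\<sigma>. Y' N \<sigma> ^ j)"
    using assms(2) by eventually_elim (intro spin_mean_cong, auto)
  from tendsto_cong[OF this] show "(\<lambda>N. spin_mean N (\<lambda>\<sigma>. Y' N \<sigma> ^ j)) \<longlonglongrightarrow> gauss_mean (Q ^ j)"
    using assms(1)[unfolded moments_conv_def, rule_format, of j] by blast
qed

text \<open>
  The factor \<open>c\<close> is left free for the two normalisations in use: by
  \<open>N\<^sup>p\<^sup>/\<^sup>2\<close>, and by the square root of the number of edges.
\<close>
lemma moments_conv_spin_energy_scaled:
  assumes c: "c \<longlonglongrightarrow> l"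
  shows "moments_conv (\<lambda>N \<sigma>. c N * (fact p * spin_energy N p \<sigma> / sqrt (real N) ^ p))
    (smult l (hermite_poly p))"
proof (rule moments_conv_cong)
  have pc: "poly_conv (\<lambda>N. smult (c N) (krawtchouk_poly (real N) p)) (smult l (hermite_poly p))"
    by (intro poly_conv_smult poly_conv_krawtchouk c filterlim_real_sequentially)
  show "moments_conv (\<lambda>N \<sigma>. poly (smult (c N) (krawtchouk_poly (real N) p))
      ((\<Sum>v\<in>{1..N}. \<sigma> v) / sqrt N)) (smult l (hermite_poly p))"
    using moments_conv_poly[OF moments_conv_spin_sum pc] by (simp add: pcompose_idR)
  show "\<forall>\<^sub>F N in sequentially. \<forall>\<sigma>. (\<forall>v\<in>{1..N}. \<sigma> v = -1 \<or> \<sigma> v = 1) \<longrightarrow>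
      poly (smult (c N) (krawtchouk_poly (real N) p)) ((\<Sum>v\<in>{1..N}. \<sigma> v) / sqrt N)
      = c N * (fact p * spin_energy N p \<sigma> / sqrt (real N) ^ p)"
    using eventually_gt_at_top[of 0]
  proof eventually_elim
    case (elim N)
    show ?case
    proof (intro allI impI)
      fix \<sigma> :: "nat \<Rightarrow> real" assume \<sigma>: "\<forall>v\<in>{1..N}. \<sigma> v = -1 \<or> \<sigma> v = 1"
      have "fact p * spin_energy N p \<sigma> = krawtchouk (real N) p (spin_sum N \<sigma>)"
        by (rule spin_energy_krawtchouk) (use \<sigma> in blast)
      also have "\<dots> = sqrt (real N) ^ p * poly (krawtchouk_poly (real N) p) (spin_sum N \<sigma> / sqrt N)"
        using elim by (intro krawtchouk_scaled) simp
      finally have e: "fact p * spin_energy N p \<sigma> =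
        sqrt (real N) ^ p * poly (krawtchouk_poly (real N) p) (spin_sum N \<sigma> / sqrt N)" .
      show "poly (smult (c N) (krawtchouk_poly (real N) p)) ((\<Sum>v\<in>{1..N}. \<sigma> v) / sqrt N)
        = c N * (fact p * spin_energy N p \<sigma> / sqrt (real N) ^ p)"
        unfolding e using elim by simp
    qed
  qed
qed

lemma moments_conv_spin_energy:
  "moments_conv (\<lambda>N \<sigma>. spin_energy N p \<sigma> / sqrt (real (N choose p)))
    (smult (1 / sqrt (fact p)) (hermite_poly p))"
proof (rule moments_conv_cong)
  let ?c = "\<lambda>N. 1 / (fact p * sqrt (real (N choose p) / real N ^ p))"
  have "?c \<longlonglongrightarrow> 1 / (fact p * sqrt (1 / fact p))"
    by (intro tendsto_intros binomial_over_power_tendsto) auto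
  also have "1 / (fact p * sqrt (1 / fact p)) = 1 / sqrt (fact p)"
    by (simp add: real_sqrt_divide real_div_sqrt)
  finally show "moments_conv (\<lambda>N \<sigma>. ?c N * (fact p * spin_energy N p \<sigma> / sqrt (real N) ^ p))
    (smult (1 / sqrt (fact p)) (hermite_poly p))" by (rule moments_conv_spin_energy_scaled)
  show "\<forall>\<^sub>F N in sequentially. \<forall>\<sigma>. (\<forall>v\<in>{1..N}. \<sigma> v = -1 \<or> \<sigma> v = 1) \<longrightarrow>
      ?c N * (fact p * spin_energy N p \<sigma> / sqrt (real N) ^ p) = spin_energy N p \<sigma> / sqrt (real (N choose p))"
    using eventually_gt_at_top[of 0]
  proof eventually_elim
    case (elim N)
    have "1 / (f * (m / q)) * (f * x / q) = x / m" if "f \<noteq> 0" "q \<noteq> 0" for f m q x :: real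
      using that by simp
    from this[of "fact p" "sqrt (real N) ^ p"] show ?case
      using elim by (simp add: real_sqrt_divide real_sqrt_power)
  qed
qed

text \<open>
  The constant \<open>E H\<^sub>k(H\<^sub>p(\<eta>) / \<surd>p!)\<close>.
\<close>
definition hermite_hermite_mean :: "nat \<Rightarrow> nat \<Rightarrow> real" where
  "hermite_hermite_mean k p =
     gauss_mean (pcompose (hermite_poly k) (smult (1 / sqrt (fact p)) (hermite_poly p)))"

text \<open>
  The count is the spin average of the \<open>k\<close>-th elementary symmetric polynomial of the edge
  variables, hence of a Krawtchouk polynomial in the energy, which itself is a Krawtchouk polynomial in
  the spin sum.
\<close>
lemma card_even_hypergraphs_asymp:
  assumes "p \<ge> 1"
  shows "(\<lambda>N. fact k * real (card (even_hypergraphs N p k)) / sqrt (real (N choose p)) ^ k)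
    \<longlonglongrightarrow> hermite_hermite_mean k p"
proof -
  have "(\<lambda>N. spin_mean N (\<lambda>\<sigma>. poly (krawtchouk_poly (real (N choose p)) k)
      (spin_energy N p \<sigma> / sqrt (real (N choose p))))) \<longlonglongrightarrow> hermite_hermite_mean k p"
    unfolding hermite_hermite_mean_def
    by (rule moments_conv_mean[OF moments_conv_spin_energy poly_conv_krawtchouk[OF binomial_at_top[OF assms]]])
  moreover have ev: "\<forall>\<^sub>F N in sequentially. spin_mean N (\<lambda>\<sigma>. poly (krawtchouk_poly (real (N choose p)) k)
      (spin_energy N p \<sigma> / sqrt (real (N choose p))))
    = fact k * real (card (even_hypergraphs N p k)) / sqrt (real (N choose p)) ^ k"
    using eventually_ge_at_top[of p]
  proof eventually_elim
    case (elim N)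
    let ?M = "real (N choose p)"
    have M: "?M > 0" using elim by simp
    have "fact k * real (card (even_hypergraphs N p k)) = spin_mean N (\<lambda>\<sigma>. fact k * edge_esym N p k \<sigma>)"
      by (simp add: spin_mean_edge_esym)
    also have "\<dots> = spin_mean N (\<lambda>\<sigma>. sqrt ?M ^ k * poly (krawtchouk_poly ?M k) (spin_energy N p \<sigma> / sqrt ?M))"
    proof (rule spin_mean_cong)
      fix \<sigma> :: "nat \<Rightarrow> real" assume \<sigma>: "\<And>v. v \<in> {1..N} \<Longrightarrow> \<sigma> v = -1 \<or> \<sigma> v = 1"
      have "fact k * edge_esym N p k \<sigma> =
          krawtchouk (real (card (index_tuples N p))) k (\<Sum>i\<in>index_tuples N p. spin_prod \<sigma> i)"
        by (rule fact_esym[OF finite_index_tuples spin_prod_sq[OF _ \<sigma>]])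
      then show "fact k * edge_esym N p k \<sigma> =
          sqrt ?M ^ k * poly (krawtchouk_poly ?M k) (spin_energy N p \<sigma> / sqrt ?M)"
        unfolding card_index_tuples spin_energy_def[symmetric] krawtchouk_scaled[OF M] .
    qed
    also have "\<dots> = sqrt ?M ^ k * spin_mean N (\<lambda>\<sigma>. poly (krawtchouk_poly ?M k) (spin_energy N p \<sigma> / sqrt ?M))"
      by simp
    finally show ?case using M by (simp add: field_simps)
  qed
  ultimately show ?thesis using tendsto_cong[OF ev] by blast
qed

lemma hermite_3_pcompose:
  "pcompose (hermite_poly 3) Q = Q ^ 3 - smult 3 Q"
  by (rule poly_eq_poly_eq_iff[THEN iffD1], rule ext)
     (simp add: numeral_3_eq_3 poly_pcompose poly_hermite_poly algebra_simps power3_eq_cube)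

lemma hermite_4_pcompose:
  "pcompose (hermite_poly 4) Q = Q ^ 4 - smult 6 (Q ^ 2) + smult 3 1"
proof (rule poly_eq_poly_eq_iff[THEN iffD1], rule ext)
  have "hermite 4 x = x ^ 4 - 6 * x\<^sup>2 + 3" for x
  proof -
    have "hermite (Suc (Suc (Suc (Suc 0)))) x = x ^ 4 - 6 * x\<^sup>2 + 3"
      by (simp add: algebra_simps power4_eq_xxxx power2_eq_square)
    then show ?thesis by (simp add: eval_nat_numeral)
  qed
  then show "poly (pcompose (hermite_poly 4) Q) x = poly (Q ^ 4 - smult 6 (Q ^ 2) + smult 3 1) x" for x
    by (simp add: poly_pcompose poly_hermite_poly)
qed

lemma hermite_hermite_mean_3:
  assumes "p \<ge> 1"
  shows "hermite_hermite_mean 3 p = gauss_mean (hermite_poly p ^ 3) / sqrt (fact p) ^ 3"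
  using assms unfolding hermite_hermite_mean_def hermite_3_pcompose gauss_mean_diff gauss_mean_smult
  by (simp add: smult_power gauss_mean_smult gauss_mean_hermite power_divide)

lemma hermite_hermite_mean_4:
  shows "hermite_hermite_mean 4 p = (gauss_mean (hermite_poly p ^ 4) - 3 * (fact p)\<^sup>2) / sqrt (fact p) ^ 4"
proof -
  have "sqrt (fact p) ^ 4 = (fact p)\<^sup>2" "sqrt (fact p) ^ 2 = fact p"
    by (simp_all add: power4_eq_xxxx power2_eq_square)
  then show ?thesis
    unfolding hermite_hermite_mean_def hermite_4_pcompose gauss_mean_diff gauss_mean_add gauss_mean_smult
    by (simp add: smult_power gauss_mean_smult gauss_mean_hermite_sq power_divide diff_divide_distrib)
qed

lemma hermite_hermite_mean_ell_pos:
  assumes "p \<ge> 3"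
  shows "hermite_hermite_mean (ell p) p > 0"
proof (cases "even p")
  case True
  then show ?thesis
    using assms gauss_mean_hermite_cube_pos[OF True] by (simp add: ell_def hermite_hermite_mean_3)
next
  case False
  then show ?thesis
    using assms gauss_mean_hermite_fourth_gt[of p] by (simp add: ell_def hermite_hermite_mean_4)
qed

lemma limit_variance_eq:
  "limit_variance p \<beta> = \<beta> ^ (2 * ell p) / (fact (ell p) * sqrt (fact p) ^ ell p) * hermite_hermite_mean (ell p) p"
proof -
  have h: "(\<integral>\<eta>. hermite k (hermite p \<eta> / sqrt (fact p)) \<partial>std_normal_distribution) = hermite_hermite_mean k p" for k
    by (simp add: hermite_hermite_mean_def gauss_mean_def poly_pcompose poly_hermite_poly)
  have 1: "(fact p :: real) powr (3 / 2) = sqrt (fact p) ^ 3"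
    by (simp add: powr_half_sqrt[symmetric] powr_power)
  have 2: "(fact p :: real)\<^sup>2 = sqrt (fact p) ^ 4"
    by (simp add: power4_eq_xxxx power2_eq_square)
  show ?thesis unfolding limit_variance_def h 1 2 by (simp add: ell_def)
qed

lemma limit_variance_pos:
  assumes "p \<ge> 3" "0 < \<beta>"
  shows "limit_variance p \<beta> > 0"
  unfolding limit_variance_eq using hermite_hermite_mean_ell_pos[OF assms(1)] assms(2) by simp

lemma limit_variance_even:
  assumes "p \<ge> 3" "even p"
  shows "limit_variance p \<beta> =
    \<beta> ^ 6 / (fact 3 * (fact p) ^ 3) * (\<integral>\<eta>. hermite p \<eta> ^ 3 \<partial>std_normal_distribution)"
proof -
  have "sqrt (fact p) ^ 3 * sqrt (fact p) ^ 3 = (fact p :: real) ^ 3"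
    by (simp add: power_mult_distrib[symmetric])
  moreover have "(\<integral>\<eta>. hermite p \<eta> ^ 3 \<partial>std_normal_distribution) = gauss_mean (hermite_poly p ^ 3)"
    by (simp add: gauss_mean_def poly_power poly_hermite_poly)
  ultimately show ?thesis
    unfolding limit_variance_eq using assms by (simp add: ell_def hermite_hermite_mean_3 mult.assoc)
qed

lemma limit_variance_odd:
  assumes "odd p"
  shows "limit_variance p \<beta> =
    \<beta> ^ 8 / (fact 4 * (fact p) ^ 4) * (\<integral>\<eta>. hermite p \<eta> ^ 4 - 3 * (fact p)\<^sup>2 \<partial>std_normal_distribution)"
proof -
  have "sqrt (fact p) ^ 4 * sqrt (fact p) ^ 4 = (fact p :: real) ^ 4"
    by (simp add: power_mult_distrib[symmetric])
  moreover have "(\<integral>\<eta>. hermite p \<eta> ^ 4 - 3 * (fact p)\<^sup>2 \<partial>std_normal_distribution)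
      = gauss_mean (hermite_poly p ^ 4) - 3 * (fact p)\<^sup>2"
  proof -
    have "(\<integral>\<eta>. hermite p \<eta> ^ 4 - 3 * (fact p)\<^sup>2 \<partial>std_normal_distribution)
        = gauss_mean (hermite_poly p ^ 4 - smult (3 * (fact p)\<^sup>2) 1)"
      by (simp add: gauss_mean_def poly_power poly_hermite_poly)
    then show ?thesis by (simp only: gauss_mean_diff gauss_mean_smult gauss_mean_one mult_1_right)
  qed
  ultimately show ?thesis
    unfolding limit_variance_eq using assms
    by (simp add: ell_def hermite_hermite_mean_4 mult.assoc)
qed

text \<open>
  Convergent moments are bounded, and \<open>|y|\<^sup>m \<le> 1 + y\<^sup>2\<^sup>m\<close>.
\<close>
lemma spin_energy_abs_moment_le:
  "\<exists>C\<ge>0. \<forall>N\<ge>1. spin_mean N (\<lambda>\<sigma>. \<bar>spin_energy N p \<sigma>\<bar> ^ m) \<le> C * sqrt (real N) ^ (p * m)"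
proof -
  let ?Y = "\<lambda>N \<sigma>. 1 * (fact p * spin_energy N p \<sigma> / sqrt (real N) ^ p)"
  have "convergent (\<lambda>N. spin_mean N (\<lambda>\<sigma>. ?Y N \<sigma> ^ (2 * m)))"
    using moments_conv_spin_energy_scaled[OF tendsto_const[of 1], of p]
    unfolding moments_conv_def convergent_def by blast
  then have "Bseq (\<lambda>N. spin_mean N (\<lambda>\<sigma>. ?Y N \<sigma> ^ (2 * m)))" by (rule convergent_imp_Bseq)
  then obtain B where "0 < B" and B': "\<forall>N. norm (spin_mean N (\<lambda>\<sigma>. ?Y N \<sigma> ^ (2 * m))) \<le> B"
    by (rule BseqE)
  have B: "spin_mean N (\<lambda>\<sigma>. ?Y N \<sigma> ^ (2 * m)) \<le> B" for N
    using B'[rule_format, of N] unfolding real_norm_def by linarith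
  have "spin_mean N (\<lambda>\<sigma>. \<bar>spin_energy N p \<sigma>\<bar> ^ m) \<le> (1 + B) * sqrt (real N) ^ (p * m)" if N: "N \<ge> 1" for N
  proof -
    let ?q = "sqrt (real N) ^ p"
    have q: "?q > 0" using N by simp
    have "spin_mean N (\<lambda>\<sigma>. \<bar>spin_energy N p \<sigma>\<bar> ^ m) \<le> spin_mean N (\<lambda>\<sigma>. ?q ^ m * (1 + ?Y N \<sigma> ^ (2 * m)))"
    proof (rule spin_mean_mono)
      fix \<sigma>
      let ?X = "spin_energy N p \<sigma>"
      have "\<bar>?X\<bar> \<le> fact p * \<bar>?X\<bar>"
        using mult_right_mono[OF fact_ge_1[of p], of "\<bar>?X\<bar>"] by simp
      also have "\<dots> = ?q * \<bar>?Y N \<sigma>\<bar>" using q N by (simp add: abs_mult)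
      finally have "\<bar>?X\<bar> ^ m \<le> (?q * \<bar>?Y N \<sigma>\<bar>) ^ m" by (intro power_mono) auto
      also have "\<dots> = ?q ^ m * \<bar>?Y N \<sigma>\<bar> ^ m" by (rule power_mult_distrib)
      also have "\<bar>?Y N \<sigma>\<bar> ^ m \<le> 1 + ?Y N \<sigma> ^ (2 * m)"
      proof -
        have "0 \<le> (\<bar>?Y N \<sigma>\<bar> ^ m - 1 / 2)\<^sup>2" by simp
        also have "\<dots> = \<bar>?Y N \<sigma>\<bar> ^ m * \<bar>?Y N \<sigma>\<bar> ^ m - \<bar>?Y N \<sigma>\<bar> ^ m + 1 / 4"
          by (simp add: power2_eq_square algebra_simps)
        also have "\<bar>?Y N \<sigma>\<bar> ^ m * \<bar>?Y N \<sigma>\<bar> ^ m = ?Y N \<sigma> ^ (2 * m)"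
          unfolding power_mult_distrib[symmetric] abs_mult_self_eq power_mult power2_eq_square ..
        finally show ?thesis by linarith
      qed
      finally show "\<bar>?X\<bar> ^ m \<le> ?q ^ m * (1 + ?Y N \<sigma> ^ (2 * m))" using q by simp
    qed
    also have "\<dots> = ?q ^ m * (1 + spin_mean N (\<lambda>\<sigma>. ?Y N \<sigma> ^ (2 * m)))" by (simp add: distrib_left)
    also have "\<dots> \<le> ?q ^ m * (1 + B)" using B[of N] q by (intro mult_left_mono) auto
    finally show ?thesis unfolding power_mult by (simp only: mult.commute)
  qed
  moreover have "0 \<le> 1 + B" using \<open>0 < B\<close> by simp
  ultimately show ?thesis by blast
qed

lemma stretched_exp_negligible:
  assumes "c > 0"
  shows "(\<lambda>N. real N powr a * ((2 * real N + 1) * exp (- c * real N powr (1 / 3)))) \<longlonglongrightarrow> 0"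
proof -
  \<comment> \<open>the power that beats \<open>N\<^sup>a\<^sup>+\<^sup>1\<close> and leaves a factor \<open>1 / N\<close>\<close>
  define m where "m = nat \<lceil>3 * (a + 2)\<rceil>"
  have "3 * (a + 2) \<le> real m" unfolding m_def by (rule real_nat_ceiling_ge)
  then have m: "a + 1 - real m / 3 \<le> - 1" by (simp add: field_simps)
  let ?K = "3 * (fact m / c ^ m)"
  have lim: "(\<lambda>N. ?K * real N powr (- 1)) \<longlonglongrightarrow> ?K * 0"
    by (intro tendsto_intros tendsto_neg_powr filterlim_real_sequentially) auto
  have le: "real N powr a * ((2 * real N + 1) * exp (- c * real N powr (1 / 3))) \<le> ?K * real N powr (- 1)"
    if N: "N \<ge> 1" for N
  proof -
    let ?z = "real N powr (1 / 3)"
    have n: "real N \<ge> 1" using N by simp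
    have z: "0 < ?z ^ m" using n by simp
    have "?z ^ m \<le> fact m / c ^ m * exp (c * ?z)" using assms by (intro power_le_exp) auto
    then have "exp (- c * ?z) * ?z ^ m \<le> exp (- c * ?z) * (fact m / c ^ m * exp (c * ?z))"
      by (intro mult_left_mono) auto
    also have "\<dots> = fact m / c ^ m" by (simp add: exp_minus)
    finally have "exp (- c * ?z) \<le> fact m / c ^ m / ?z ^ m" using z by (simp only: pos_le_divide_eq)
    also have "\<dots> = fact m / c ^ m * real N powr (- real m / 3)"
      using n by (simp add: powr_power powr_minus_divide)
    finally have "real N powr a * ((2 * real N + 1) * exp (- c * ?z))
        \<le> real N powr a * ((3 * real N) * (fact m / c ^ m * real N powr (- real m / 3)))"
      using n by (intro mult_left_mono mult_mono) auto
    also have "\<dots> = ?K * (real N powr a * (real N powr 1 * real N powr (- real m / 3)))"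
      using n by simp
    also have "\<dots> = ?K * real N powr (a + 1 - real m / 3)"
      unfolding powr_add[symmetric] by (simp add: algebra_simps)
    also have "\<dots> \<le> ?K * real N powr (- 1)"
      using n m assms by (intro mult_left_mono powr_mono) auto
    finally show ?thesis .
  qed
  show ?thesis
    by (rule tendsto_sandwich[OF _ _ tendsto_const lim[simplified mult_zero_right]])
       (use le in \<open>auto intro: eventually_sequentiallyI[of 1]\<close>)
qed

text \<open>
  By the bound on the exponential moment, the sum is of order \<open>E\<^sub>0 (s
  |X|)\<^sup>k\<^sup>+\<^sup>1\<close>, that is
  \<open>N\<^sup>-\<^sup>(\<^sup>k\<^sup>+\<^sup>1\<^sup>)\<^sup>(\<^sup>p\<^sup>-\<^sup>2\<^sup>)\<^sup>/\<^sup>2\<close>,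
  up to a stretched exponential.
\<close>
lemma even_hypergraph_tail_negligible:
  assumes p: "p \<ge> 3" and \<beta>: "0 < \<beta>" "\<beta> < beta_f p"
    and s: "\<And>N. N \<ge> 1 \<Longrightarrow> 0 \<le> s N" "\<And>N. N \<ge> 1 \<Longrightarrow> s N \<le> \<beta>\<^sup>2 / real N ^ (p - 1)"
  shows "(\<lambda>N. real N powr (real k * (real p - 2) / 2) *
    (\<Sum>m=Suc k..N choose p. s N ^ m * real (card (even_hypergraphs N p m)))) \<longlonglongrightarrow> 0"
proof -
  let ?a = "real k * (real p - 2) / 2"
  let ?R = "\<lambda>N. \<Sum>m=Suc k..N choose p. s N ^ m * real (card (even_hypergraphs N p m))"
  obtain B C c where BCc: "0 \<le> B" "0 \<le> C" "0 < c"
    "\<And>N s. N \<ge> 1 \<Longrightarrow> 0 \<le> s \<Longrightarrow> s \<le> \<beta>\<^sup>2 / real N ^ (p - 1) \<Longrightarrow>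
    spin_mean N (\<lambda>\<sigma>. (s * \<bar>spin_energy N p \<sigma>\<bar>) ^ Suc k * exp (s * \<bar>spin_energy N p \<sigma>\<bar>))
      \<le> B * spin_mean N (\<lambda>\<sigma>. (s * \<bar>spin_energy N p \<sigma>\<bar>) ^ Suc k)
        + C * ((2 * real N + 1) * exp (- c * real N powr (1 / 3)))"
    using spin_mean_energy_exp_le[OF p \<beta>, of "Suc k"] by blast
  obtain D where D: "D \<ge> 0"
    "\<And>N. N \<ge> 1 \<Longrightarrow> spin_mean N (\<lambda>\<sigma>. \<bar>spin_energy N p \<sigma>\<bar> ^ Suc k) \<le> D * sqrt (real N) ^ (p * Suc k)"
    using spin_energy_abs_moment_le[of p "Suc k"] by blast
  define K where "K = B * ((\<beta>\<^sup>2) ^ Suc k * D)"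
  let ?g = "\<lambda>N. K * real N powr (- (real p - 2) / 2)
     + C * (real N powr ?a * ((2 * real N + 1) * exp (- c * real N powr (1 / 3))))"
  have "?g \<longlonglongrightarrow> K * 0 + C * 0"
    using p by (intro tendsto_intros stretched_exp_negligible BCc(3)
        tendsto_neg_powr filterlim_real_sequentially) auto
  then have g: "?g \<longlonglongrightarrow> 0" by simp
  have le: "real N powr ?a * ?R N \<le> ?g N" if N: "N \<ge> 1" for N
  proof -
    have n: "real N \<ge> 1" using N by simp
    have "?R N \<le> spin_mean N (\<lambda>\<sigma>. (s N * \<bar>spin_energy N p \<sigma>\<bar>) ^ Suc k * exp (s N * \<bar>spin_energy N p \<sigma>\<bar>))"
      by (rule even_hypergraph_sum_le[OF s(1)[OF N]])
    also have "\<dots> \<le> B * spin_mean N (\<lambda>\<sigma>. (s N * \<bar>spin_energy N p \<sigma>\<bar>) ^ Suc k)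
        + C * ((2 * real N + 1) * exp (- c * real N powr (1 / 3)))"
      by (rule BCc(4)[OF N s(1)[OF N] s(2)[OF N]])
    finally have 1: "?R N \<le> B * spin_mean N (\<lambda>\<sigma>. (s N * \<bar>spin_energy N p \<sigma>\<bar>) ^ Suc k)
        + C * ((2 * real N + 1) * exp (- c * real N powr (1 / 3)))" .
    have "spin_mean N (\<lambda>\<sigma>. (s N * \<bar>spin_energy N p \<sigma>\<bar>) ^ Suc k)
        = s N ^ Suc k * spin_mean N (\<lambda>\<sigma>. \<bar>spin_energy N p \<sigma>\<bar> ^ Suc k)"
      unfolding power_mult_distrib by (rule integral_mult_right_zero)
    also have "\<dots> \<le> (\<beta>\<^sup>2 / real N ^ (p - 1)) ^ Suc k * (D * sqrt (real N) ^ (p * Suc k))"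
      using s[OF N] D N by (intro mult_mono power_mono) (auto intro!: Bochner_Integration.integral_nonneg)
    also have "\<dots> = (\<beta>\<^sup>2) ^ Suc k * D * (sqrt (real N) ^ (p * Suc k) / (real N ^ (p - 1)) ^ Suc k)"
      by (simp only: power_divide times_divide_eq_left times_divide_eq_right mult.assoc)
    also have "sqrt (real N) ^ (p * Suc k) / (real N ^ (p - 1)) ^ Suc k
        = real N powr (real (p * Suc k) / 2 - real ((p - 1) * Suc k))"
    proof -
      have "sqrt (real N) ^ (p * Suc k) = real N powr (real (p * Suc k) / 2)"
        using n by (simp add: powr_half_sqrt[symmetric] powr_power)
      moreover have "(real N ^ (p - 1)) ^ Suc k = real N powr (real ((p - 1) * Suc k))"
        using n by (simp only: power_mult[symmetric] powr_realpow)
      ultimately show ?thesis by (simp only: powr_diff)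
    qed
    finally have 2: "spin_mean N (\<lambda>\<sigma>. (s N * \<bar>spin_energy N p \<sigma>\<bar>) ^ Suc k)
        \<le> (\<beta>\<^sup>2) ^ Suc k * D * real N powr (real (p * Suc k) / 2 - real ((p - 1) * Suc k))" .
    have "?R N \<le> K * real N powr (real (p * Suc k) / 2 - real ((p - 1) * Suc k))
        + C * ((2 * real N + 1) * exp (- c * real N powr (1 / 3)))"
      using 1 mult_left_mono[OF 2 BCc(1)] unfolding K_def by (simp only: mult.assoc)
    then have "real N powr ?a * ?R N \<le> real N powr ?a * (K * real N powr (real (p * Suc k) / 2 - real ((p - 1) * Suc k))
        + C * ((2 * real N + 1) * exp (- c * real N powr (1 / 3))))"
      by (intro mult_left_mono) auto
    also have "\<dots> = K * (real N powr ?a * real N powr (real (p * Suc k) / 2 - real ((p - 1) * Suc k)))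
       + C * (real N powr ?a * ((2 * real N + 1) * exp (- c * real N powr (1 / 3))))"
      by (simp only: distrib_left mult.left_commute)
    also have "real N powr ?a * real N powr (real (p * Suc k) / 2 - real ((p - 1) * Suc k))
        = real N powr (- (real p - 2) / 2)"
    proof -
      have "?a + (real (p * Suc k) / 2 - real ((p - 1) * Suc k)) = - (real p - 2) / 2"
        using p by (simp add: of_nat_diff field_simps)
      then show ?thesis by (simp only: powr_add[symmetric])
    qed
    finally show ?thesis .
  qed
  have ge: "0 \<le> real N powr ?a * ?R N" if N: "N \<ge> 1" for N
    using s(1)[OF N] by (intro mult_nonneg_nonneg sum_nonneg) auto
  show ?thesis
    by (rule tendsto_sandwich[OF _ _ tendsto_const g])
       (use le ge in \<open>auto intro: eventually_sequentiallyI[of 1]\<close>)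
qed

section \<open>From the partition function to its logarithm\<close>

lemma abs_tanh_le: "\<bar>tanh x\<bar> \<le> \<bar>x :: real\<bar>"
proof -
  have "tanh y \<le> y" if "0 \<le> y" for y :: real
  proof -
    have "0 - tanh 0 \<le> y - tanh y"
    proof (rule DERIV_nonneg_imp_nondecreasing[OF that])
      fix z :: real assume "0 \<le> z"
      have "((\<lambda>y. y - tanh y) has_real_derivative (1 - (1 - (tanh z)\<^sup>2))) (at z)"
        by (auto intro!: derivative_eq_intros)
      then show "\<exists>d. ((\<lambda>y. y - tanh y) has_real_derivative d) (at z) \<and> 0 \<le> d"
        by (intro exI conjI) auto
    qed
    then show ?thesis by simp
  qed
  from this[of "\<bar>x\<bar>"] show ?thesis by simp
qed

lemma abs_tanh_le_1: "\<bar>tanh x\<bar> \<le> (1 :: real)"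
  using tanh_real_lt_1[of x] tanh_real_gt_neg1[of x] by linarith

lemma tanh_scaled_tendsto:
  assumes "filterlim q at_top sequentially"
  shows "(\<lambda>N. q N * tanh (y / q N)) \<longlonglongrightarrow> (y :: real)"
proof (cases "y = 0")
  case False
  have "(tanh has_real_derivative (1 - (tanh 0)\<^sup>2)) (at (0::real))"
    by (auto intro!: derivative_eq_intros)
  then have D: "((\<lambda>h. tanh h / h) \<longlongrightarrow> 1) (at (0::real))"
    by (simp add: DERIV_def)
  have "(\<lambda>N. y / q N) \<longlonglongrightarrow> 0"
    by (rule tendsto_divide_0[OF tendsto_const filterlim_at_top_imp_at_infinity[OF assms]])
  moreover have ev: "\<forall>\<^sub>F N in sequentially. q N > 0"
    using assms by (simp add: filterlim_at_top_dense)
  ultimately have "filterlim (\<lambda>N. y / q N) (at 0) sequentially"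
    using False by (auto simp: filterlim_at elim!: eventually_mono)
  from filterlim_compose[OF D this]
  have "(\<lambda>N. y * (tanh (y / q N) / (y / q N))) \<longlonglongrightarrow> y * 1" by (intro tendsto_intros)
  moreover have e: "\<forall>\<^sub>F N in sequentially. y * (tanh (y / q N) / (y / q N)) = q N * tanh (y / q N)"
    using ev by eventually_elim (use False in auto)
  ultimately show ?thesis using tendsto_cong[OF e] by simp
qed simp

lemma measurable_tanh [measurable]: "tanh \<in> borel_measurable (borel :: real measure)"
  by (intro borel_measurable_continuous_onI continuous_intros) auto

lemma char_normal:
  assumes "\<sigma> > 0"
  shows "char (density lborel (normal_density 0 \<sigma>)) u = of_real (exp (- (\<sigma>\<^sup>2 * u\<^sup>2) / 2))"
proof -
  interpret S: real_distribution std_normal_distribution by (rule real_dist_normal_dist)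
  have "distributed std_normal_distribution lborel (\<lambda>x. x) std_normal_density"
    by (auto simp: distributed_def distr_id2 sets_density)
  from S.normal_density_affine[OF this, of \<sigma> 0] assms
  have "distributed std_normal_distribution lborel (\<lambda>x. \<sigma> * x) (normal_density 0 \<sigma>)" by simp
  then have d: "density lborel (normal_density 0 \<sigma>) = distr std_normal_distribution lborel (\<lambda>x. \<sigma> * x)"
    by (simp add: distributed_def)
  have "char (density lborel (normal_density 0 \<sigma>)) u
      = (CLINT x|std_normal_distribution. iexp ((u * \<sigma>) * x))"
    unfolding char_def d by (subst integral_distr) (auto simp: mult_ac)
  also have "\<dots> = char std_normal_distribution (u * \<sigma>)" unfolding char_def ..
  also have "\<dots> = of_real (exp (- (u * \<sigma>)\<^sup>2 / 2))"
    by (rule fun_cong[OF char_std_normal_distribution])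
  finally show ?thesis by (simp add: power_mult_distrib mult.commute)
qed

lemma norm_iexp_diff_le: "norm (iexp x - iexp y) \<le> \<bar>x - y\<bar>" "norm (iexp x - iexp y) \<le> 2"
proof -
  define z where "z = x - y"
  have e: "iexp x = iexp y * iexp z"
    unfolding exp_add[symmetric] by (simp add: z_def algebra_simps)
  have "norm (iexp x - iexp y) = norm (iexp y * (iexp z - 1))"
    unfolding e by (simp only: right_diff_distrib mult_1_right)
  also have "\<dots> = norm (iexp z - 1)" by (simp only: norm_mult norm_exp_i_times mult_1_left)
  also have "\<dots> \<le> \<bar>z\<bar>" using iexp_approx1[of z 0] by simp
  also have "\<dots> = \<bar>x - y\<bar>" by (simp add: z_def)
  finally show "norm (iexp x - iexp y) \<le> \<bar>x - y\<bar>" .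
  show "norm (iexp x - iexp y) \<le> 2"
    by (rule order_trans[OF norm_triangle_ineq4]) simp
qed

context prob_space
begin

lemma expectation_abs_le_sqrt:
  assumes "bounded_rv (R :: 'a \<Rightarrow> real)"
  shows "expectation (\<lambda>\<omega>. \<bar>R \<omega>\<bar>) \<le> sqrt (expectation (\<lambda>\<omega>. R \<omega> ^ 2))"
proof -
  have "0 \<le> variance (\<lambda>\<omega>. \<bar>R \<omega>\<bar>)" by (rule variance_positive)
  also have "\<dots> = expectation (\<lambda>\<omega>. \<bar>R \<omega>\<bar> ^ 2) - (expectation (\<lambda>\<omega>. \<bar>R \<omega>\<bar>))\<^sup>2"
    by (rule variance_eq) (intro bounded_rv_integrable bounded_rv_intros assms)+
  finally show ?thesis by (intro real_le_rsqrt) simp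
qed

text \<open>
  Where \<open>|W + R| \<le> 1 / 2\<close> the logarithm is linear up to \<open>2 (W + R)\<^sup>2\<close>;
  elsewhere the characters differ by at most \<open>2 \<le> 8 (W + R)\<^sup>2\<close>.
\<close>
lemma charfun_log_perturbation:
  assumes W: "bounded_rv W" and R: "bounded_rv R" and "a > 0"
  shows "norm ((CLINT \<omega>|M. iexp (u * (a * ln (1 + (W \<omega> + R \<omega>))))) - (CLINT \<omega>|M. iexp (u * (a * W \<omega>))))
    \<le> \<bar>u\<bar> * (a * sqrt (expectation (\<lambda>\<omega>. R \<omega> ^ 2)) +
        4 * a * (expectation (\<lambda>\<omega>. W \<omega> ^ 2) + expectation (\<lambda>\<omega>. R \<omega> ^ 2)))
      + 16 * (expectation (\<lambda>\<omega>. W \<omega> ^ 2) + expectation (\<lambda>\<omega>. R \<omega> ^ 2))"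
proof -
  let ?L = "\<lambda>\<omega>. a * ln (1 + (W \<omega> + R \<omega>))"
  let ?g = "\<lambda>\<omega>. \<bar>u\<bar> * (a * \<bar>R \<omega>\<bar> + 4 * a * (W \<omega> ^ 2 + R \<omega> ^ 2)) + 16 * (W \<omega> ^ 2 + R \<omega> ^ 2)"
  have [measurable]: "W \<in> borel_measurable M" "R \<in> borel_measurable M"
    using W R by (auto simp: bounded_rv_def)
  have Lb: "bounded_rv (\<lambda>\<omega>. iexp (u * ?L \<omega>))" unfolding bounded_rv_def
    by (auto intro!: exI[of _ 1])
  have Wb: "bounded_rv (\<lambda>\<omega>. iexp (u * (a * W \<omega>)))"
    by (intro bounded_rv_intros W)
  have gb: "bounded_rv ?g" by (intro bounded_rv_intros W R)
  have pointwise: "norm (iexp (u * ?L \<omega>) - iexp (u * (a * W \<omega>))) \<le> ?g \<omega>" for \<omega>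
  proof -
    define D where "D = W \<omega> + R \<omega>"
    have "0 \<le> (W \<omega> - R \<omega>)\<^sup>2" by simp
    then have D2: "D\<^sup>2 \<le> 2 * (W \<omega> ^ 2 + R \<omega> ^ 2)"
      by (simp add: D_def power2_eq_square algebra_simps)
    show ?thesis
    proof (cases "\<bar>D\<bar> \<le> 1 / 2")
      case True
      have "norm (iexp (u * ?L \<omega>) - iexp (u * (a * W \<omega>))) \<le> \<bar>u * ?L \<omega> - u * (a * W \<omega>)\<bar>"
        by (rule norm_iexp_diff_le)
      also have "u * ?L \<omega> - u * (a * W \<omega>) = (u * a) * ((ln (1 + D) - D) + R \<omega>)"
        by (simp add: D_def algebra_simps)
      also have "\<bar>(u * a) * ((ln (1 + D) - D) + R \<omega>)\<bar> = \<bar>u\<bar> * (a * \<bar>(ln (1 + D) - D) + R \<omega>\<bar>)"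
        using \<open>a > 0\<close> by (simp add: abs_mult)
      also have "\<dots> \<le> \<bar>u\<bar> * (a * (4 * (W \<omega> ^ 2 + R \<omega> ^ 2) + \<bar>R \<omega>\<bar>))"
      proof (intro mult_left_mono)
        show "\<bar>(ln (1 + D) - D) + R \<omega>\<bar> \<le> 4 * (W \<omega> ^ 2 + R \<omega> ^ 2) + \<bar>R \<omega>\<bar>"
          using abs_ln_one_plus_x_minus_x_bound[OF True] D2 by linarith
      qed (use \<open>a > 0\<close> in auto)
      also have "\<dots> = \<bar>u\<bar> * (a * \<bar>R \<omega>\<bar> + 4 * a * (W \<omega> ^ 2 + R \<omega> ^ 2))" by (simp add: algebra_simps)
      also have "\<dots> \<le> ?g \<omega>" by simp
      finally show ?thesis .
    next
      case False
      then have "(1 / 2)\<^sup>2 \<le> \<bar>D\<bar>\<^sup>2" by (intro power_mono) auto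
      then have "2 \<le> 16 * (W \<omega> ^ 2 + R \<omega> ^ 2)" using D2 by (simp add: power2_eq_square)
      moreover have "0 \<le> \<bar>u\<bar> * (a * \<bar>R \<omega>\<bar> + 4 * a * (W \<omega> ^ 2 + R \<omega> ^ 2))"
        using \<open>a > 0\<close> by simp
      ultimately show ?thesis
        using norm_iexp_diff_le(2)[of "u * ?L \<omega>" "u * (a * W \<omega>)"] by linarith
    qed
  qed
  have iR: "integrable M (\<lambda>\<omega>. \<bar>R \<omega>\<bar>)"
    and iW2: "integrable M (\<lambda>\<omega>. W \<omega> ^ 2)" and iR2: "integrable M (\<lambda>\<omega>. R \<omega> ^ 2)"
    by (intro bounded_rv_integrable bounded_rv_intros W R)+
  have diff: "(CLINT \<omega>|M. iexp (u * ?L \<omega>)) - (CLINT \<omega>|M. iexp (u * (a * W \<omega>)))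
      = (CLINT \<omega>|M. iexp (u * ?L \<omega>) - iexp (u * (a * W \<omega>)))"
    by (rule Bochner_Integration.integral_diff
        [OF bounded_rv_integrable[OF Lb] bounded_rv_integrable[OF Wb], symmetric])
  have "norm ((CLINT \<omega>|M. iexp (u * ?L \<omega>)) - (CLINT \<omega>|M. iexp (u * (a * W \<omega>)))) \<le> expectation ?g"
    unfolding diff by (rule norm_expectation_le[OF bounded_rv_diff[OF Lb Wb] gb pointwise])
  also have "expectation ?g = \<bar>u\<bar> * (a * expectation (\<lambda>\<omega>. \<bar>R \<omega>\<bar>) +
        4 * a * (expectation (\<lambda>\<omega>. W \<omega> ^ 2) + expectation (\<lambda>\<omega>. R \<omega> ^ 2)))
      + 16 * (expectation (\<lambda>\<omega>. W \<omega> ^ 2) + expectation (\<lambda>\<omega>. R \<omega> ^ 2))"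
    by (simp only: Bochner_Integration.integral_add integral_mult_right_zero
        Bochner_Integration.integrable_add integrable_mult_right iR iW2 iR2)
  also have "\<dots> \<le> \<bar>u\<bar> * (a * sqrt (expectation (\<lambda>\<omega>. R \<omega> ^ 2)) +
        4 * a * (expectation (\<lambda>\<omega>. W \<omega> ^ 2) + expectation (\<lambda>\<omega>. R \<omega> ^ 2)))
      + 16 * (expectation (\<lambda>\<omega>. W \<omega> ^ 2) + expectation (\<lambda>\<omega>. R \<omega> ^ 2))"
    using expectation_abs_le_sqrt[OF R] \<open>a > 0\<close>
    by (intro add_right_mono mult_left_mono) auto
  finally show ?thesis .
qed

end

section \<open>The couplings\<close>

lemma powr_sequence_at_top:
  assumes "c > 0"
  shows "filterlim (\<lambda>N. real N powr c) at_top sequentially"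
proof -
  have "filterlim (\<lambda>N. exp (c * ln (real N))) at_top sequentially"
    by (intro filterlim_compose[OF exp_at_top]
        filterlim_tendsto_pos_mult_at_top[OF tendsto_const assms]
        filterlim_compose[OF ln_at_top] filterlim_real_sequentially)
  moreover have ev: "\<forall>\<^sub>F N in sequentially. exp (c * ln (real N)) = real N powr c"
    using eventually_gt_at_top[of 0] by eventually_elim (simp add: powr_def)
  ultimately show ?thesis using filterlim_cong[OF refl refl ev] by blast
qed

locale pspin_couplings = prob_space M for M :: "'a measure" +
  fixes J :: "nat list \<Rightarrow> 'a \<Rightarrow> real" and p :: nat and \<beta> :: real
  assumes indep_J: "\<And>N. indep_vars (\<lambda>_. borel) J (index_tuples N p)"
    and ident: "\<And>N i j. i \<in> index_tuples N p \<Longrightarrow> j \<in> index_tuples N p \<Longrightarrow>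
                  distr M borel (J i) = distr M borel (J j)"
    and symm: "\<And>N i. i \<in> index_tuples N p \<Longrightarrow>
                  distr M borel (\<lambda>\<omega>. - J i \<omega>) = distr M borel (J i)"
    and mean_J: "\<And>N i. i \<in> index_tuples N p \<Longrightarrow> expectation (J i) = 0"
    and var_J: "\<And>N i. i \<in> index_tuples N p \<Longrightarrow> variance (J i) = 1"
    and fourth_J: "\<And>N i. i \<in> index_tuples N p \<Longrightarrow> integrable M (\<lambda>\<omega>. J i \<omega> ^ 4)"
    and p_ge: "p \<ge> 3" and \<beta>_pos: "0 < \<beta>" and \<beta>_less: "\<beta> < beta_f p"
begin

abbreviation E :: "nat \<Rightarrow> nat list set" where "E N \<equiv> index_tuples N p"

abbreviation k :: nat where "k \<equiv> ell p"

definition t :: "nat \<Rightarrow> nat list \<Rightarrow> 'a \<Rightarrow> real" where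
  "t N i \<omega> = tanh (\<beta> * J i \<omega> / real N powr ((real p - 1) / 2))"

text \<open>
  A reference edge, present as soon as \<open>N \<ge> p\<close>; all couplings have the law of this one.
\<close>
definition i0 :: "nat list" where "i0 = [1..<Suc p]"

lemma i0_mem: "N \<ge> p \<Longrightarrow> i0 \<in> E N"
  by (auto simp: i0_def index_tuples_def simp del: upt_Suc)

definition s :: "nat \<Rightarrow> real" where "s N = expectation (\<lambda>\<omega>. t N i0 \<omega> ^ 2)"

definition K :: real where "K = max 1 (expectation (\<lambda>\<omega>. J i0 \<omega> ^ 4))"

lemma rv_J: "i \<in> E N \<Longrightarrow> J i \<in> borel_measurable M"
  using indep_J[of N] by (auto simp: indep_vars_def)

lemma expectation_J_cong:
  assumes "i \<in> E N" "j \<in> E N" "g \<in> borel_measurable borel"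
  shows "expectation (\<lambda>\<omega>. g (J i \<omega>)) = (expectation (\<lambda>\<omega>. g (J j \<omega>)) :: real)"
proof -
  have "expectation (\<lambda>\<omega>. g (J l \<omega>)) = (\<integral>x. g x \<partial>distr M borel (J l))" if "l \<in> E N" for l
    using assms(3) rv_J[OF that] by (simp add: integral_distr)
  from this[OF assms(1)] this[OF assms(2)] show ?thesis
    unfolding ident[OF assms(1,2)] by simp
qed

lemma expectation_J_odd:
  assumes "i \<in> E N" "g \<in> borel_measurable borel" "\<And>x. g (- x) = - g x"
  shows "expectation (\<lambda>\<omega>. g (J i \<omega>)) = (0 :: real)"
proof -
  have "expectation (\<lambda>\<omega>. g (J i \<omega>)) = (\<integral>x. g x \<partial>distr M borel (J i))"
    using assms(2) rv_J[OF assms(1)] by (simp add: integral_distr)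
  also have "\<dots> = (\<integral>x. g x \<partial>distr M borel (\<lambda>\<omega>. - J i \<omega>))"
    unfolding symm[OF assms(1)] ..
  also have "\<dots> = expectation (\<lambda>\<omega>. g (- J i \<omega>))"
    using assms(2) rv_J[OF assms(1)] by (simp add: integral_distr)
  also have "\<dots> = - expectation (\<lambda>\<omega>. g (J i \<omega>))" by (simp add: assms(3))
  finally show ?thesis by simp
qed

text \<open>
  A function that is not integrable has integral \<open>0\<close>, so the value \<open>1\<close> already
  implies integrability.
\<close>
lemma second_moment_J:
  assumes "i \<in> E N"
  shows "expectation (\<lambda>\<omega>. J i \<omega> ^ 2) = 1" "integrable M (\<lambda>\<omega>. J i \<omega> ^ 2)"
proof -
  show 1: "expectation (\<lambda>\<omega>. J i \<omega> ^ 2) = 1"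
    using var_J[OF assms] by (simp add: mean_J[OF assms])
  show "integrable M (\<lambda>\<omega>. J i \<omega> ^ 2)"
    using 1 not_integrable_integral_eq[of M "\<lambda>\<omega>. J i \<omega> ^ 2"] by linarith
qed

lemma scale_sq:
  assumes "N \<ge> 1"
  shows "(real N powr ((real p - 1) / 2)) ^ 2 = real N ^ (p - 1)"
proof -
  have e: "(real p - 1) / 2 + (real p - 1) / 2 = real (p - 1)" using p_ge by (simp add: of_nat_diff)
  have "(real N powr ((real p - 1) / 2)) ^ 2 = real N powr ((real p - 1) / 2 + (real p - 1) / 2)"
    by (simp only: power2_eq_square powr_add)
  also have "\<dots> = real N ^ (p - 1)" unfolding e using assms by (simp add: powr_realpow)
  finally show ?thesis .
qed

lemma t_sq_le:
  assumes "N \<ge> 1"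
  shows "t N i \<omega> ^ 2 \<le> \<beta>\<^sup>2 / real N ^ (p - 1) * J i \<omega> ^ 2"
proof -
  let ?q = "real N powr ((real p - 1) / 2)"
  have q: "?q ^ 2 = real N ^ (p - 1)" by (rule scale_sq[OF assms])
  have "t N i \<omega> ^ 2 = \<bar>tanh (\<beta> * J i \<omega> / ?q)\<bar> ^ 2" by (simp add: t_def)
  also have "\<dots> \<le> \<bar>\<beta> * J i \<omega> / ?q\<bar> ^ 2" by (intro power_mono abs_tanh_le) simp
  also have "\<dots> = \<beta>\<^sup>2 / ?q ^ 2 * J i \<omega> ^ 2" by (simp add: power_divide power_mult_distrib)
  finally show ?thesis unfolding q .
qed

lemma t_measurable: "i \<in> E N \<Longrightarrow> t N i \<in> borel_measurable M"
  unfolding t_def[abs_def] using rv_J by measurable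

lemma t_family:
  assumes N: "N \<ge> p"
  shows "symmetric_family M (E N) (t N) (s N) (\<beta>\<^sup>2 / real N ^ (p - 1)) K"
proof unfold_locales
  let ?g = "\<lambda>x. tanh (\<beta> * x / real N powr ((real p - 1) / 2))"
  have g: "?g \<in> borel_measurable borel" by measurable
  have g2: "(\<lambda>x. ?g x ^ 2) \<in> borel_measurable borel" and g3: "(\<lambda>x. ?g x ^ 3) \<in> borel_measurable borel"
    by (intro borel_measurable_power g)+
  have odd: "?g (- x) = - ?g x" for x by simp
  have odd3: "?g (- x) ^ 3 = - (?g x ^ 3)" for x unfolding odd by (rule power_minus_odd) simp
  have N1: "N \<ge> 1" using N p_ge by simp
  show "finite (E N)" by simp
  show "indep_vars (\<lambda>_. borel) (t N) (E N)"
    using indep_vars_compose2[OF indep_J[of N], of "\<lambda>_. ?g" "\<lambda>_. borel"] by (simp add: t_def[abs_def])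
  show "0 \<le> s N" by (simp add: s_def)
  show "1 \<le> K" by (simp add: K_def)
  have bdd: "bounded_rv (t N i)" if "i \<in> E N" for i
    using t_measurable[OF that] abs_tanh_le_1
    by (auto simp: bounded_rv_def t_def[abs_def] simp del: tanh_real_abs intro!: exI[of _ 1])
  have "s N \<le> expectation (\<lambda>\<omega>. \<beta>\<^sup>2 / real N ^ (p - 1) * J i0 \<omega> ^ 2)"
    unfolding s_def
  proof (rule integral_mono)
    show "integrable M (\<lambda>\<omega>. t N i0 \<omega> ^ 2)"
      by (intro bounded_rv_integrable bounded_rv_power bdd i0_mem N)
    show "integrable M (\<lambda>\<omega>. \<beta>\<^sup>2 / real N ^ (p - 1) * J i0 \<omega> ^ 2)"
      by (intro integrable_mult_right second_moment_J(2)[OF i0_mem[OF N]])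
  qed (rule t_sq_le[OF N1])
  also have "\<dots> = \<beta>\<^sup>2 / real N ^ (p - 1)" using second_moment_J[OF i0_mem[OF N]] by simp
  finally show "s N \<le> \<beta>\<^sup>2 / real N ^ (p - 1)" .
  fix i \<omega> assume i: "i \<in> E N"
  show "\<bar>t N i \<omega>\<bar> \<le> 1"
    unfolding t_def by (rule abs_tanh_le_1)
  have t_eq: "t N j = (\<lambda>\<omega>. ?g (J j \<omega>))" for j by (simp only: t_def[abs_def])
  show "expectation (t N i) = 0"
    unfolding t_eq by (rule expectation_J_odd[OF i g odd])
  show "expectation (\<lambda>\<omega>. t N i \<omega> ^ 3) = 0"
    unfolding t_eq by (rule expectation_J_odd[OF i g3 odd3])
  show "expectation (\<lambda>\<omega>. t N i \<omega> ^ 2) = s N"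
    unfolding s_def t_eq by (rule expectation_J_cong[OF i i0_mem[OF N] g2])
  have "expectation (\<lambda>\<omega>. t N i \<omega> ^ 4) \<le> expectation (\<lambda>\<omega>. (\<beta>\<^sup>2 / real N ^ (p - 1))\<^sup>2 * J i \<omega> ^ 4)"
  proof (rule integral_mono)
    show "integrable M (\<lambda>\<omega>. t N i \<omega> ^ 4)"
      by (intro bounded_rv_integrable bounded_rv_power bdd i)
    show "integrable M (\<lambda>\<omega>. (\<beta>\<^sup>2 / real N ^ (p - 1))\<^sup>2 * J i \<omega> ^ 4)"
      by (intro integrable_mult_right fourth_J[OF i])
    fix \<omega>
    have "(t N i \<omega> ^ 2)\<^sup>2 \<le> (\<beta>\<^sup>2 / real N ^ (p - 1) * J i \<omega> ^ 2)\<^sup>2"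
      by (intro power_mono t_sq_le[OF N1]) simp
    moreover have "(x ^ 2)\<^sup>2 = x ^ 4" for x :: real by (simp flip: power_mult)
    ultimately show "t N i \<omega> ^ 4 \<le> (\<beta>\<^sup>2 / real N ^ (p - 1))\<^sup>2 * J i \<omega> ^ 4"
      by (simp only: power_mult_distrib)
  qed
  also have "\<dots> = (\<beta>\<^sup>2 / real N ^ (p - 1))\<^sup>2 * expectation (\<lambda>\<omega>. J i \<omega> ^ 4)" by simp
  also have "expectation (\<lambda>\<omega>. J i \<omega> ^ 4) = expectation (\<lambda>\<omega>. J i0 \<omega> ^ 4)"
    by (rule expectation_J_cong[OF i i0_mem[OF N]]) measurable
  also have "(\<beta>\<^sup>2 / real N ^ (p - 1))\<^sup>2 * expectation (\<lambda>\<omega>. J i0 \<omega> ^ 4) \<le> (\<beta>\<^sup>2 / real N ^ (p - 1))\<^sup>2 * K"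
    by (intro mult_left_mono) (auto simp: K_def)
  finally show "expectation (\<lambda>\<omega>. t N i \<omega> ^ 4) \<le> K * (\<beta>\<^sup>2 / real N ^ (p - 1))\<^sup>2"
    by (simp add: mult.commute)
qed

text \<open>
  Dominated convergence, with the dominating function \<open>\<beta>\<^sup>2 J\<^sup>2\<close>.
\<close>
lemma s_asymp: "(\<lambda>N. real N ^ (p - 1) * s N) \<longlonglongrightarrow> \<beta>\<^sup>2"
proof -
  let ?q = "\<lambda>N. real N powr ((real p - 1) / 2)"
  have qat: "filterlim ?q at_top sequentially"
    using p_ge by (intro powr_sequence_at_top) simp
  have q2: "?q N ^ 2 = real N ^ (p - 1)" if "N \<ge> 1" for N by (rule scale_sq[OF that])
  have i0: "i0 \<in> E p" by (rule i0_mem) simp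
  have rv[measurable]: "J i0 \<in> borel_measurable M" by (rule rv_J[OF i0])
  have "(\<lambda>N. expectation (\<lambda>\<omega>. (?q N * tanh (\<beta> * J i0 \<omega> / ?q N)) ^ 2)) \<longlonglongrightarrow> expectation (\<lambda>\<omega>. (\<beta> * J i0 \<omega>) ^ 2)"
  proof (rule integral_dominated_convergence[where w = "\<lambda>\<omega>. \<beta>\<^sup>2 * J i0 \<omega> ^ 2"])
    show "integrable M (\<lambda>\<omega>. \<beta>\<^sup>2 * J i0 \<omega> ^ 2)"
      by (intro integrable_mult_right second_moment_J(2)[OF i0])
    show "AE \<omega> in M. (\<lambda>N. (?q N * tanh (\<beta> * J i0 \<omega> / ?q N)) ^ 2) \<longlonglongrightarrow> (\<beta> * J i0 \<omega>) ^ 2"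
      by (intro AE_I2 tendsto_power tanh_scaled_tendsto qat)
    show "AE \<omega> in M. norm ((?q N * tanh (\<beta> * J i0 \<omega> / ?q N)) ^ 2) \<le> \<beta>\<^sup>2 * J i0 \<omega> ^ 2" for N
    proof (rule AE_I2)
      fix \<omega>
      have "\<bar>?q N * tanh (\<beta> * J i0 \<omega> / ?q N)\<bar> \<le> ?q N * \<bar>\<beta> * J i0 \<omega> / ?q N\<bar>"
        unfolding abs_mult[of "?q N"] abs_of_nonneg[OF powr_ge_zero]
        by (intro mult_left_mono abs_tanh_le) simp
      also have "\<dots> \<le> \<bar>\<beta> * J i0 \<omega>\<bar>" by (cases "N = 0") auto
      finally have "\<bar>?q N * tanh (\<beta> * J i0 \<omega> / ?q N)\<bar> ^ 2 \<le> \<bar>\<beta> * J i0 \<omega>\<bar> ^ 2"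
        by (intro power_mono) auto
      then show "norm ((?q N * tanh (\<beta> * J i0 \<omega> / ?q N)) ^ 2) \<le> \<beta>\<^sup>2 * J i0 \<omega> ^ 2"
        by (simp add: power_mult_distrib)
    qed
  qed measurable
  also have "expectation (\<lambda>\<omega>. (\<beta> * J i0 \<omega>) ^ 2) = \<beta>\<^sup>2"
    using second_moment_J(1)[OF i0] by (simp add: power_mult_distrib)
  finally have lim: "(\<lambda>N. expectation (\<lambda>\<omega>. (?q N * tanh (\<beta> * J i0 \<omega> / ?q N)) ^ 2)) \<longlonglongrightarrow> \<beta>\<^sup>2" .
  have ev: "\<forall>\<^sub>F N in sequentially. expectation (\<lambda>\<omega>. (?q N * tanh (\<beta> * J i0 \<omega> / ?q N)) ^ 2) = real N ^ (p - 1) * s N"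
    using eventually_ge_at_top[of 1]
  proof eventually_elim
    case (elim N)
    show ?case unfolding power_mult_distrib q2[OF elim] s_def t_def by simp
  qed
  show ?thesis using tendsto_cong[OF ev] lim by blast
qed

definition a :: "nat \<Rightarrow> real" where "a N = real N powr (real k * (real p - 2) / 4)"

abbreviation G :: "nat \<Rightarrow> nat list set set" where "G N \<equiv> even_hypergraphs N p k"

definition mon :: "nat \<Rightarrow> nat list set \<Rightarrow> 'a \<Rightarrow> real" where
  "mon N \<Gamma> \<omega> = (\<Prod>i\<in>\<Gamma>. t N i \<omega>)"

text \<open>
  \<open>W\<close> and \<open>R\<close> split the nontrivial part of the expansion of the partition
  function into the even hypergraphs with the least number of edges and those with more.
\<close>
definition W :: "nat \<Rightarrow> 'a \<Rightarrow> real" where "W N \<omega> = (\<Sum>\<Gamma>\<in>G N. mon N \<Gamma> \<omega>)"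

definition F :: "nat \<Rightarrow> nat list set set" where
  "F N = (\<Union>m\<in>{Suc k..N choose p}. even_hypergraphs N p m)"

definition R :: "nat \<Rightarrow> 'a \<Rightarrow> real" where "R N \<omega> = (\<Sum>\<Gamma>\<in>F N. mon N \<Gamma> \<omega>)"

definition v :: "nat \<Rightarrow> real" where "v N = (a N)\<^sup>2 * real (card (G N)) * s N ^ k"

lemma a_sq: "N \<ge> 1 \<Longrightarrow> (a N)\<^sup>2 = real N powr (real k * (real p - 2) / 2)"
  by (simp add: a_def powr_power)

lemma k_pos: "k > 0" by (simp add: ell_def)

text \<open>
  There is no even hypergraph with fewer than \<open>ell p\<close> edges other than the empty one, which
  gives the term \<open>1\<close>.
\<close>
lemma Z_hat_decomposition: "Z_hat p N \<beta> (\<lambda>i. J i \<omega>) = 1 + (W N \<omega> + R N \<omega>)"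
proof -
  have fin: "finite \<Gamma>" if "\<Gamma> \<subseteq> E N" for \<Gamma> using that by (rule finite_subset) simp
  have split: "{\<Gamma>. \<Gamma> \<subseteq> E N \<and> even_hypergraph \<Gamma>} = insert {} (G N \<union> F N)"
  proof (intro equalityI subsetI)
    fix \<Gamma> assume "\<Gamma> \<in> {\<Gamma>. \<Gamma> \<subseteq> E N \<and> even_hypergraph \<Gamma>}"
    then have \<Gamma>: "\<Gamma> \<subseteq> E N" "even_hypergraph \<Gamma>" by auto
    have c: "card \<Gamma> \<le> N choose p"
      using card_mono[OF finite_index_tuples \<Gamma>(1)] by (simp add: card_index_tuples)
    show "\<Gamma> \<in> insert {} (G N \<union> F N)"
    proof (cases "\<Gamma> = {}")
      case False
      then have "k \<le> card \<Gamma>" using even_hypergraph_card_ge[OF \<Gamma>] p_ge by simp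
      then have "\<Gamma> \<in> even_hypergraphs N p (card \<Gamma>)" "card \<Gamma> = k \<or> card \<Gamma> \<in> {Suc k..N choose p}"
        using \<Gamma> c by (auto simp: even_hypergraphs_def)
      then show ?thesis unfolding F_def by (metis UN_I Un_iff insertI2)
    qed simp
  qed (auto simp: even_hypergraphs_def F_def even_hypergraph_def edge_degree_def)
  have disj: "G N \<inter> F N = {}" by (auto simp: even_hypergraphs_def F_def)
  have ne: "{} \<notin> G N \<union> F N" using k_pos by (auto simp: even_hypergraphs_def F_def)
  have finF: "finite (F N)" by (simp add: F_def)
  have "Z_hat p N \<beta> (\<lambda>i. J i \<omega>) = (\<Sum>\<Gamma>\<in>insert {} (G N \<union> F N). mon N \<Gamma> \<omega>)"
    unfolding Z_hat_expansion split mon_def t_def ..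
  also have "\<dots> = 1 + (\<Sum>\<Gamma>\<in>G N \<union> F N. mon N \<Gamma> \<omega>)"
    using ne finF by (subst sum.insert) (auto simp: mon_def)
  also have "(\<Sum>\<Gamma>\<in>G N \<union> F N. mon N \<Gamma> \<omega>) = W N \<omega> + R N \<omega>"
    unfolding W_def R_def using disj finF by (intro sum.union_disjoint) auto
  finally show ?thesis .
qed

text \<open>
  The normalisation \<open>N\<^sup>k\<^sup>(\<^sup>p\<^sup>-\<^sup>2\<^sup>)\<^sup>/\<^sup>2\<close> is
  \<open>N\<^sup>p\<^sup>-\<^sup>1\<close> for each of the \<open>k\<close> second moments, divided by
  \<open>N\<^sup>k\<^sup>p\<^sup>/\<^sup>2\<close> for the number of minimal even hypergraphs.
\<close>
lemma v_asymp: "v \<longlonglongrightarrow> limit_variance p \<beta>"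
proof -
  let ?M = "\<lambda>N. real (N choose p)"
  have p1: "p \<ge> 1" using p_ge by simp
  have lim: "(\<lambda>N. (fact k * real (card (G N)) / sqrt (?M N) ^ k) / fact k * sqrt (?M N / real N ^ p) ^ k
      * (real N ^ (p - 1) * s N) ^ k) \<longlonglongrightarrow>
    hermite_hermite_mean k p / fact k * sqrt (1 / fact p) ^ k * (\<beta>\<^sup>2) ^ k"
    by (intro tendsto_intros card_even_hypergraphs_asymp[OF p1] binomial_over_power_tendsto s_asymp) simp
  have ev: "\<forall>\<^sub>F N in sequentially. (fact k * real (card (G N)) / sqrt (?M N) ^ k) / fact k * sqrt (?M N / real N ^ p) ^ k
      * (real N ^ (p - 1) * s N) ^ k = v N"
    using eventually_ge_at_top[of p]
  proof eventually_elim
    case (elim N)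
    have N: "N \<ge> 1" "real N > 0" using elim p_ge by auto
    have M: "?M N > 0" using elim by simp
    have "(fact k * real (card (G N)) / sqrt (?M N) ^ k) / fact k * sqrt (?M N / real N ^ p) ^ k
      * (real N ^ (p - 1) * s N) ^ k
      = real (card (G N)) * s N ^ k * ((real N ^ (p - 1)) ^ k / sqrt (real N ^ p) ^ k)"
      using M by (simp add: real_sqrt_divide power_divide power_mult_distrib)
    also have "(real N ^ (p - 1)) ^ k / sqrt (real N ^ p) ^ k = (a N)\<^sup>2"
    proof -
      have pw: "(real N powr c) ^ k = real N powr (c * real k)" for c
        using N by (simp add: powr_powr[symmetric] powr_realpow[symmetric] del: powr_powr)
      have "real N ^ (p - 1) = real N powr real (p - 1)"
        using N by (simp add: powr_realpow)
      then have "(real N ^ (p - 1)) ^ k = real N powr (real (p - 1) * real k)"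
        by (simp only: pw)
      moreover have "sqrt (real N ^ p) = real N powr (real p / 2)"
        using N by (simp add: powr_half_sqrt[symmetric] powr_realpow[symmetric] powr_powr)
      then have "sqrt (real N ^ p) ^ k = real N powr (real p / 2 * real k)"
        by (simp only: pw)
      ultimately have "(real N ^ (p - 1)) ^ k / sqrt (real N ^ p) ^ k
          = real N powr (real (p - 1) * real k - real p / 2 * real k)"
        by (simp only: powr_diff)
      also have "real (p - 1) * real k - real p / 2 * real k = real k * (real p - 2) / 2"
        using p1 by (simp add: of_nat_diff field_simps)
      finally show ?thesis using a_sq[OF N(1)] by simp
    qed
    finally show ?case by (simp add: v_def mult_ac)
  qed
  have "hermite_hermite_mean k p / fact k * sqrt (1 / fact p) ^ k * (\<beta>\<^sup>2) ^ k = limit_variance p \<beta>"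
    unfolding limit_variance_eq by (simp add: real_sqrt_divide power_divide power_mult)
  then show ?thesis using lim tendsto_cong[OF ev] by simp
qed

end

section \<open>The limit theorem\<close>

context pspin_couplings
begin

text \<open>
  The powers of \<open>N\<close> add up to \<open>k (p - 2) + (k p - 1) - 2 k (p - 1) = - 1\<close>:
  without the vertex that bad quadruples lose, the error would be of order one.
\<close>
lemma error_term_le:
  "\<exists>C>0. \<forall>N\<ge>p. a N ^ 4 * real (card (bad_quads (E N) (G N))) * (K * (\<beta>\<^sup>2 / real N ^ (p - 1))) ^ (2 * k)
     \<le> C / real N"
proof -
  define c where "c = (2 ^ (k * p) ^ p) ^ 4 * (2 :: real) ^ (k * p - 1) * (K * \<beta>\<^sup>2) ^ (2 * k)"
  have K0: "K > 0" by (simp add: K_def)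
  have c: "c > 0" using K0 \<beta>_pos by (simp add: c_def)
  have "a N ^ 4 * real (card (bad_quads (E N) (G N))) * (K * (\<beta>\<^sup>2 / real N ^ (p - 1))) ^ (2 * k) \<le> c / real N"
    if N: "N \<ge> p" for N
  proof -
    define n where "n = real N"
    have n: "n \<ge> 1" using N p_ge by (simp add: n_def)
    have a4: "a N ^ 4 = n ^ (k * (p - 2))"
    proof -
      have "a N ^ 4 = n powr (real k * (real p - 2) / 4 * real 4)"
        unfolding a_def n_def[symmetric] using n by (subst powr_power) auto
      also have "real k * (real p - 2) / 4 * real 4 = real (k * (p - 2))"
        using p_ge by (simp add: of_nat_diff)
      finally show ?thesis using n by (simp only: powr_realpow)
    qed
    have "card (bad_quads (E N) (G N)) \<le> (2 ^ (k * p) ^ p) ^ 4 * (N + 1) ^ (k * p - 1)"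
      using p_ge by (intro card_bad_quads_le) simp
    then have "real (card (bad_quads (E N) (G N))) \<le> real ((2 ^ (k * p) ^ p) ^ 4 * (N + 1) ^ (k * p - 1))"
      by (simp only: of_nat_le_iff)
    also have "\<dots> = (2 ^ (k * p) ^ p) ^ 4 * (n + 1) ^ (k * p - 1)"
      by (simp only: of_nat_mult of_nat_power of_nat_add of_nat_1 of_nat_numeral n_def)
    also have "\<dots> \<le> (2 ^ (k * p) ^ p) ^ 4 * (2 * n) ^ (k * p - 1)"
      using n by (intro mult_left_mono power_mono) auto
    finally have bad: "real (card (bad_quads (E N) (G N))) \<le> (2 ^ (k * p) ^ p) ^ 4 * (2 * n) ^ (k * p - 1)" .
    have pow: "n ^ (k * (p - 2)) * n ^ (k * p - 1) * n = (n ^ (p - 1)) ^ (2 * k)"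
    proof -
      have "k * (p - 2) + (k * p - 1) + 1 = (p - 1) * (2 * k)"
      proof -
        obtain r where r: "p = r + 2" using p_ge by (metis add.commute le_Suc_ex numeral_3_eq_3 numeral_2_eq_2 le_add_diff_inverse Suc_leD)
        have "k * p \<ge> 1" using k_pos p_ge by simp
        then show ?thesis unfolding r by (simp add: algebra_simps)
      qed
      then show ?thesis
        by (metis power_add power_mult power_one_right)
    qed
    have "a N ^ 4 * real (card (bad_quads (E N) (G N))) * (K * (\<beta>\<^sup>2 / n ^ (p - 1))) ^ (2 * k)
        \<le> n ^ (k * (p - 2)) * ((2 ^ (k * p) ^ p) ^ 4 * (2 * n) ^ (k * p - 1)) * (K * (\<beta>\<^sup>2 / n ^ (p - 1))) ^ (2 * k)"
      unfolding a4 using n K0 by (intro mult_right_mono mult_left_mono bad) auto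
    also have "\<dots> = c * ((n ^ (k * (p - 2)) * n ^ (k * p - 1)) / (n ^ (p - 1)) ^ (2 * k))"
      unfolding c_def power_mult_distrib times_divide_eq_right power_divide by (simp only: mult_ac times_divide_eq_left times_divide_eq_right)
    also have "(n ^ (k * (p - 2)) * n ^ (k * p - 1)) / (n ^ (p - 1)) ^ (2 * k) = 1 / n"
      unfolding pow[symmetric] using n by simp
    finally show ?thesis by (simp add: n_def)
  qed
  then show ?thesis using c by blast
qed

lemma charfun_W_le:
  assumes N: "N \<ge> p" and "b > 0"
    and err: "a N ^ 4 * real (card (bad_quads (E N) (G N))) * (K * (\<beta>\<^sup>2 / real N ^ (p - 1))) ^ (2 * k) \<le> b\<^sup>2"
  shows "norm ((CLINT \<omega>|M. iexp (u * (a N * W N \<omega>))) - of_real (exp (- v N * u\<^sup>2 / 2)))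
    \<le> \<bar>u\<bar> * (b * (\<bar>u\<bar> * (1 + (real k)\<^sup>2) / 2 + u\<^sup>2 * (v N + 1) / 4))"
proof -
  interpret F: symmetric_family M "E N" "t N" "s N" "\<beta>\<^sup>2 / real N ^ (p - 1)" K
    by (rule t_family[OF N])
  interpret L: multilinear_sum M "E N" "t N" "s N" "\<beta>\<^sup>2 / real N ^ (p - 1)" K "G N" k "a N"
    by unfold_locales (auto simp: even_hypergraphs_def k_pos)
  have Y: "L.Y = (\<lambda>\<omega>. a N * W N \<omega>)"
    by (simp add: fun_eq_iff L.Y_def W_def mon_def F.mon_def)
  have V: "L.var_Y = v N" by (simp add: L.var_Y_def v_def)
  have "L.err \<le> b\<^sup>2" using err by (simp only: L.err_def)
  from L.charfun_gaussian_approx[OF \<open>b > 0\<close> this, of u] show ?thesis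
    unfolding Y V by simp
qed

lemma mon_measurable: "\<Gamma> \<subseteq> E N \<Longrightarrow> mon N \<Gamma> \<in> borel_measurable M"
  unfolding mon_def[abs_def] using t_measurable by (intro borel_measurable_prod) auto

lemma F_subset: "\<Gamma> \<in> F N \<Longrightarrow> \<Gamma> \<subseteq> E N"
  by (auto simp: F_def even_hypergraphs_def)

lemma finite_F: "finite (F N)"
  by (simp add: F_def)

lemma W_brv: "bounded_rv (W N)" and R_brv: "bounded_rv (R N)"
proof -
  have m: "bounded_rv (mon N \<Gamma>)" if "\<Gamma> \<subseteq> E N" for \<Gamma>
  proof -
    have "\<bar>mon N \<Gamma> \<omega>\<bar> \<le> 1" for \<omega>
      unfolding mon_def abs_prod t_def using abs_tanh_le_1 by (intro prod_le_1 conjI abs_ge_zero)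
    then show ?thesis using mon_measurable[OF that] unfolding bounded_rv_def real_norm_def by blast
  qed
  show "bounded_rv (W N)"
    unfolding W_def[abs_def] by (intro bounded_rv_sum m) (simp add: even_hypergraphs_def)
  show "bounded_rv (R N)"
    unfolding R_def[abs_def] by (intro bounded_rv_sum m F_subset)
qed

lemma expectation_W_sq:
  assumes N: "N \<ge> p"
  shows "expectation (\<lambda>\<omega>. W N \<omega> ^ 2) = real (card (G N)) * s N ^ k"
proof -
  interpret F: symmetric_family M "E N" "t N" "s N" "\<beta>\<^sup>2 / real N ^ (p - 1)" K
    by (rule t_family[OF N])
  have "expectation (\<lambda>\<omega>. (\<Sum>\<Gamma>\<in>G N. F.mon \<Gamma> \<omega>)\<^sup>2) = (\<Sum>\<Gamma>\<in>G N. s N ^ card \<Gamma>)"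
    by (rule F.expectation_sum_mon_sq) (auto simp: even_hypergraphs_def)
  also have "\<dots> = (\<Sum>\<Gamma>\<in>G N. s N ^ k)" by (intro sum.cong refl) (simp add: even_hypergraphs_def)
  finally show ?thesis by (simp add: W_def mon_def F.mon_def)
qed

lemma expectation_R_sq:
  assumes N: "N \<ge> p"
  shows "expectation (\<lambda>\<omega>. R N \<omega> ^ 2) =
    (\<Sum>m=Suc k..N choose p. s N ^ m * real (card (even_hypergraphs N p m)))"
proof -
  interpret F: symmetric_family M "E N" "t N" "s N" "\<beta>\<^sup>2 / real N ^ (p - 1)" K
    by (rule t_family[OF N])
  have "expectation (\<lambda>\<omega>. (\<Sum>\<Gamma>\<in>F N. F.mon \<Gamma> \<omega>)\<^sup>2) = (\<Sum>\<Gamma>\<in>F N. s N ^ card \<Gamma>)"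
    by (rule F.expectation_sum_mon_sq[OF finite_F F_subset])
  also have "\<dots> = (\<Sum>m=Suc k..N choose p. \<Sum>\<Gamma>\<in>even_hypergraphs N p m. s N ^ card \<Gamma>)"
    unfolding F_def by (intro sum.UNION_disjoint) (auto simp: even_hypergraphs_def)
  also have "\<dots> = (\<Sum>m=Suc k..N choose p. \<Sum>\<Gamma>\<in>even_hypergraphs N p m. s N ^ m)"
    by (intro sum.cong refl) (simp add: even_hypergraphs_def)
  finally show ?thesis by (simp add: R_def mon_def F.mon_def mult.commute)
qed

text \<open>
  The tail estimate is stated for all \<open>N \<ge> 1\<close>, while the reference edge exists only for
  \<open>N \<ge> p\<close>; the second moment is set to \<open>0\<close> for the finitely many other
  \<open>N\<close>.
\<close>
lemma R_negligible: "(\<lambda>N. (a N)\<^sup>2 * expectation (\<lambda>\<omega>. R N \<omega> ^ 2)) \<longlonglongrightarrow> 0"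
proof -
  define s' where "s' N = (if N \<ge> p then s N else 0)" for N
  have s': "0 \<le> s' N" "s' N \<le> \<beta>\<^sup>2 / real N ^ (p - 1)" for N
    using t_family[of N] unfolding s'_def symmetric_family_def symmetric_family_axioms_def by auto
  have lim: "(\<lambda>N. real N powr (real k * (real p - 2) / 2) *
    (\<Sum>m=Suc k..N choose p. s' N ^ m * real (card (even_hypergraphs N p m)))) \<longlonglongrightarrow> 0"
    by (rule even_hypergraph_tail_negligible[OF p_ge \<beta>_pos \<beta>_less s'])
  have ev: "\<forall>\<^sub>F N in sequentially. real N powr (real k * (real p - 2) / 2) *
    (\<Sum>m=Suc k..N choose p. s' N ^ m * real (card (even_hypergraphs N p m)))
    = (a N)\<^sup>2 * expectation (\<lambda>\<omega>. R N \<omega> ^ 2)"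
    using eventually_ge_at_top[of p]
  proof eventually_elim
    case (elim N)
    have "N \<ge> 1" using elim p_ge by simp
    then show ?case unfolding a_sq[OF \<open>N \<ge> 1\<close>] expectation_R_sq[OF elim] s'_def using elim by simp
  qed
  show ?thesis using tendsto_cong[OF ev] lim by blast
qed

lemma a_at_top: "filterlim a at_top sequentially"
  unfolding a_def[abs_def] using k_pos p_ge by (intro powr_sequence_at_top) simp

lemma charfun_W_tendsto:
  "(\<lambda>N. CLINT \<omega>|M. iexp (u * (a N * W N \<omega>))) \<longlonglongrightarrow> of_real (exp (- limit_variance p \<beta> * u\<^sup>2 / 2))"
proof -
  obtain C where C: "C > 0" "\<And>N. N \<ge> p \<Longrightarrow>
      a N ^ 4 * real (card (bad_quads (E N) (G N))) * (K * (\<beta>\<^sup>2 / real N ^ (p - 1))) ^ (2 * k) \<le> C / real N"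
    using error_term_le by blast
  let ?b = "\<lambda>N. sqrt (C / real N)"
  let ?g = "\<lambda>N. \<bar>u\<bar> * (?b N * (\<bar>u\<bar> * (1 + (real k)\<^sup>2) / 2 + u\<^sup>2 * (v N + 1) / 4))"
  let ?z = "\<lambda>N. complex_of_real (exp (- v N * u\<^sup>2 / 2))"
  have "?b \<longlonglongrightarrow> sqrt 0" by (intro tendsto_intros lim_const_over_n)
  then have b: "?b \<longlonglongrightarrow> 0" by simp
  have "?g \<longlonglongrightarrow> \<bar>u\<bar> * (0 * (\<bar>u\<bar> * (1 + (real k)\<^sup>2) / 2 + u\<^sup>2 * (limit_variance p \<beta> + 1) / 4))"
    by (intro tendsto_intros b v_asymp) auto
  then have g: "?g \<longlonglongrightarrow> 0" by simp
  have "\<forall>\<^sub>F N in sequentially. norm ((CLINT \<omega>|M. iexp (u * (a N * W N \<omega>))) - ?z N) \<le> ?g N"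
    using eventually_ge_at_top[of p]
  proof eventually_elim
    case (elim N)
    have N: "real N > 0" using elim p_ge by simp
    show ?case
    proof (rule charfun_W_le[OF elim])
      show "?b N > 0" using C(1) N by simp
      have "(?b N)\<^sup>2 = C / real N" using C(1) N by simp
      then show "a N ^ 4 * real (card (bad_quads (E N) (G N))) * (K * (\<beta>\<^sup>2 / real N ^ (p - 1))) ^ (2 * k) \<le> (?b N)\<^sup>2"
        using C(2)[OF elim] by (simp only:)
    qed
  qed
  from Lim_null_comparison[OF this g]
  have d: "(\<lambda>N. (CLINT \<omega>|M. iexp (u * (a N * W N \<omega>))) - ?z N) \<longlonglongrightarrow> 0" .
  have z: "?z \<longlonglongrightarrow> of_real (exp (- limit_variance p \<beta> * u\<^sup>2 / 2))"
    by (intro tendsto_intros v_asymp) auto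
  show ?thesis by (rule Lim_transform[OF z d])
qed

lemma charfun_log_tendsto:
  "(\<lambda>N. CLINT \<omega>|M. iexp (u * (a N * ln (Z_hat p N \<beta> (\<lambda>i. J i \<omega>)))))
     \<longlonglongrightarrow> of_real (exp (- limit_variance p \<beta> * u\<^sup>2 / 2))"
proof -
  let ?w = "\<lambda>N. expectation (\<lambda>\<omega>. W N \<omega> ^ 2)" and ?r = "\<lambda>N. expectation (\<lambda>\<omega>. R N \<omega> ^ 2)"
  let ?q = "\<lambda>N. (a N)\<^sup>2 * ?r N"
  let ?g = "\<lambda>N. \<bar>u\<bar> * (sqrt (?q N) + 4 * ((v N + ?q N) / a N)) + 16 * ((v N + ?q N) / a N / a N)"
  have ai: "filterlim a at_infinity sequentially"
    by (rule filterlim_at_top_imp_at_infinity[OF a_at_top])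
  have d: "(\<lambda>N. (v N + ?q N) / a N) \<longlonglongrightarrow> 0"
    by (rule tendsto_divide_0[OF tendsto_add[OF v_asymp R_negligible] ai])
  have d2: "(\<lambda>N. (v N + ?q N) / a N / a N) \<longlonglongrightarrow> 0"
    by (rule tendsto_divide_0[OF d ai])
  have "?g \<longlonglongrightarrow> \<bar>u\<bar> * (sqrt 0 + 4 * 0) + 16 * 0"
    by (intro tendsto_intros R_negligible d d2)
  then have g: "?g \<longlonglongrightarrow> 0" by simp
  have "\<forall>\<^sub>F N in sequentially. norm ((CLINT \<omega>|M. iexp (u * (a N * ln (Z_hat p N \<beta> (\<lambda>i. J i \<omega>)))))
      - (CLINT \<omega>|M. iexp (u * (a N * W N \<omega>)))) \<le> ?g N"
    using eventually_ge_at_top[of p]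
  proof eventually_elim
    case (elim N)
    have ap: "a N > 0" using elim p_ge by (simp add: a_def)
    have vw: "v N = (a N)\<^sup>2 * ?w N" by (simp add: v_def expectation_W_sq[OF elim] mult.assoc)
    have sq: "sqrt (?q N) = a N * sqrt (?r N)" using ap by (simp add: real_sqrt_mult)
    have e1: "(v N + ?q N) / a N = a N * (?w N + ?r N)"
    proof -
      have "(x\<^sup>2 * w + x\<^sup>2 * r) / x = x * (w + r)" if "x > 0" for x w r :: real
        using that by (simp add: power2_eq_square field_simps)
      then show ?thesis unfolding vw using ap by blast
    qed
    have e2: "(v N + ?q N) / a N / a N = ?w N + ?r N"
      unfolding e1 using ap by simp
    have "norm ((CLINT \<omega>|M. iexp (u * (a N * ln (1 + (W N \<omega> + R N \<omega>)))))
        - (CLINT \<omega>|M. iexp (u * (a N * W N \<omega>))))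
      \<le> \<bar>u\<bar> * (a N * sqrt (?r N) + 4 * a N * (?w N + ?r N)) + 16 * (?w N + ?r N)"
      by (rule charfun_log_perturbation[OF W_brv R_brv ap])
    also have "\<dots> = ?g N" unfolding e2 sq unfolding e1 by (simp only: mult.assoc)
    finally show ?case unfolding Z_hat_decomposition .
  qed
  from Lim_null_comparison[OF this g]
  have "(\<lambda>N. (CLINT \<omega>|M. iexp (u * (a N * ln (Z_hat p N \<beta> (\<lambda>i. J i \<omega>)))))
      - (CLINT \<omega>|M. iexp (u * (a N * W N \<omega>)))) \<longlonglongrightarrow> 0" .
  then show ?thesis by (rule Lim_transform[OF charfun_W_tendsto])
qed

lemma log_Z_hat_measurable:
  "(\<lambda>\<omega>. a N * ln (Z_hat p N \<beta> (\<lambda>i. J i \<omega>))) \<in> borel_measurable M"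
proof -
  have [measurable]: "W N \<in> borel_measurable M" "R N \<in> borel_measurable M"
    using W_brv R_brv by (auto simp: bounded_rv_def)
  show ?thesis unfolding Z_hat_decomposition by measurable
qed

lemma log_Z_hat_weak_conv:
  "weak_conv_m (\<lambda>N. distr M borel (\<lambda>\<omega>. a N * ln (Z_hat p N \<beta> (\<lambda>i. J i \<omega>))))
     (density lborel (normal_density 0 (sqrt (limit_variance p \<beta>))))"
proof (rule levy_continuity)
  have lv: "limit_variance p \<beta> > 0" by (rule limit_variance_pos[OF p_ge \<beta>_pos])
  show "real_distribution (distr M borel (\<lambda>\<omega>. a N * ln (Z_hat p N \<beta> (\<lambda>i. J i \<omega>))))" for N
    by (rule real_distribution_distr[OF log_Z_hat_measurable])
  interpret D: prob_space "density lborel (normal_density 0 (sqrt (limit_variance p \<beta>)))"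
    using lv by (intro prob_space_normal_density) simp
  show "real_distribution (density lborel (normal_density 0 (sqrt (limit_variance p \<beta>))))"
    by unfold_locales auto
  fix u
  have "char (distr M borel (\<lambda>\<omega>. a N * ln (Z_hat p N \<beta> (\<lambda>i. J i \<omega>)))) u
      = (CLINT \<omega>|M. iexp (u * (a N * ln (Z_hat p N \<beta> (\<lambda>i. J i \<omega>)))))" for N
    unfolding char_def by (rule integral_distr[OF log_Z_hat_measurable]) measurable
  moreover have "char (density lborel (normal_density 0 (sqrt (limit_variance p \<beta>)))) u
      = of_real (exp (- limit_variance p \<beta> * u\<^sup>2 / 2))"
    using lv by (subst char_normal) simp_all
  ultimately show "(\<lambda>N. char (distr M borel (\<lambda>\<omega>. a N * ln (Z_hat p N \<beta> (\<lambda>i. J i \<omega>)))) u)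
      \<longlonglongrightarrow> char (density lborel (normal_density 0 (sqrt (limit_variance p \<beta>)))) u"
    using charfun_log_tendsto[of u] by (simp only:)
qed

end

theorem theorem1p9:
  fixes M :: "'a measure" and J :: "nat list \<Rightarrow> 'a \<Rightarrow> real" and p :: nat and \<beta> :: real
  assumes "prob_space M"
    and indep: "\<And>N. prob_space.indep_vars M (\<lambda>_. borel) J (index_tuples N p)"
    and ident: "\<And>N i j. i \<in> index_tuples N p \<Longrightarrow> j \<in> index_tuples N p \<Longrightarrow>
                  distr M borel (J i) = distr M borel (J j)"
    and symm: "\<And>N i. i \<in> index_tuples N p \<Longrightarrow>
                  distr M borel (\<lambda>\<omega>. - J i \<omega>) = distr M borel (J i)"
    and mean: "\<And>N i. i \<in> index_tuples N p \<Longrightarrow> prob_space.expectation M (J i) = 0"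
    and var: "\<And>N i. i \<in> index_tuples N p \<Longrightarrow> prob_space.variance M (J i) = 1"
    and fourth: "\<And>N i. i \<in> index_tuples N p \<Longrightarrow> integrable M (\<lambda>\<omega>. J i \<omega> ^ 4)"
    and "p \<ge> 3" and "0 < \<beta>" and "\<beta> < beta_f p"
  shows "0 < limit_variance p \<beta> \<and>
    weak_conv_m
      (\<lambda>N. distr M borel
         (\<lambda>\<omega>. real N powr (real (ell p) * (real p - 2) / 4) * ln (Z_hat p N \<beta> (\<lambda>i. J i \<omega>))))
      (density lborel (normal_density 0 (sqrt (limit_variance p \<beta>)))) \<and>
    (even p \<longrightarrow> limit_variance p \<beta> =
       \<beta> ^ 6 / (fact 3 * (fact p) ^ 3) * (\<integral>\<eta>. hermite p \<eta> ^ 3 \<partial>std_normal_distribution)) \<and>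
    (odd p \<longrightarrow> limit_variance p \<beta> =
       \<beta> ^ 8 / (fact 4 * (fact p) ^ 4) *
       (\<integral>\<eta>. hermite p \<eta> ^ 4 - 3 * (fact p)\<^sup>2 \<partial>std_normal_distribution))"
proof -
  interpret pspin_couplings M J p \<beta>
    by (rule pspin_couplings.intro[OF assms(1)]) (unfold_locales, fact assms)+
  show ?thesis
    using limit_variance_pos[OF p_ge \<beta>_pos] log_Z_hat_weak_conv[unfolded a_def]
      limit_variance_even[OF p_ge] limit_variance_odd by blast
qed

end
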